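(* Let $n\ge2$. The following property holds if and only if $n$ is squarefree: any two centralizers (in $PSL(n,\mathbb{C})$) of irreducible subgroups of $PSL(n,\mathbb{C})$ that are isomorphic as abstract groups are conjugate in $PSL(n,\mathbb{C})$.
   Context: A subgroup of $SL(n,\mathbb{C})$ is irreducible if no nonzero proper subspace of $\mathbb{C}^n$ is invariant; a subgroup of $PSL(n,\mathbb{C})=SL(n,\mathbb{C})/Z(SL(n,\mathbb{C}))$ is irreducible if its preimage in $SL(n,\mathbb{C})$ is. An integer $n\ge2$ is squarefree if no square of a prime divides it. *)

theory Defs
  imports "Jordan_Normal_Form.Determinant" "HOL-Algebra.Coset" "HOL-Computational_Algebra.Squarefree"
begin

definition SL :: "nat \<Rightarrow> complex mat monoid" where
  "SL n = \<lparr> carrier = {A \<in> carrier_mat n n. det A = 1}, mult = (*), one = 1\<^sub>m n \<rparr>"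

definition group_center :: "('a, 'b) monoid_scheme \<Rightarrow> 'a set" where
  "group_center G = {z \<in> carrier G. \<forall>g \<in> carrier G. z \<otimes>\<^bsub>G\<^esub> g = g \<otimes>\<^bsub>G\<^esub> z}"

definition PSL :: "nat \<Rightarrow> complex mat set monoid" where
  "PSL n = SL n Mod group_center (SL n)"

definition is_subspace :: "nat \<Rightarrow> complex vec set \<Rightarrow> bool" where
  "is_subspace n W \<longleftrightarrow> W \<subseteq> carrier_vec n \<and> 0\<^sub>v n \<in> W \<and>
     (\<forall>v\<in>W. \<forall>w\<in>W. v + w \<in> W) \<and> (\<forall>c. \<forall>v\<in>W. c \<cdot>\<^sub>v v \<in> W)"

definition irreducible_SL :: "nat \<Rightarrow> complex mat set \<Rightarrow> bool" where
  "irreducible_SL n H \<longleftrightarrow>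
     (\<forall>W. is_subspace n W \<and> (\<forall>A\<in>H. \<forall>w\<in>W. A *\<^sub>v w \<in> W) \<longrightarrow> W = {0\<^sub>v n} \<or> W = carrier_vec n)"

(* a subgroup S of PSL(n,C) is irreducible iff its preimage in SL(n,C) is *)
definition irreducible_PSL :: "nat \<Rightarrow> complex mat set set \<Rightarrow> bool" where
  "irreducible_PSL n S \<longleftrightarrow> irreducible_SL n (\<Union>S)"

definition centralizer :: "('a, 'b) monoid_scheme \<Rightarrow> 'a set \<Rightarrow> 'a set" where
  "centralizer G S = {x \<in> carrier G. \<forall>y\<in>S. x \<otimes>\<^bsub>G\<^esub> y = y \<otimes>\<^bsub>G\<^esub> x}"

definition conjugate_subsets :: "('a, 'b) monoid_scheme \<Rightarrow> 'a set \<Rightarrow> 'a set \<Rightarrow> bool" where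
  "conjugate_subsets G A B \<longleftrightarrow>
     (\<exists>g\<in>carrier G. B = (\<lambda>x. g \<otimes>\<^bsub>G\<^esub> x \<otimes>\<^bsub>G\<^esub> inv\<^bsub>G\<^esub> g) ` A)"

end

theory Submission
  imports Defs "Jordan_Normal_Form.Spectral_Radius" "HOL-Algebra.Multiplicative_Group"
begin

text \<open>
  Let \<open>H\<close> be the preimage of an irreducible subgroup and \<open>A\<close> its centralizer in \<open>PSL(n)\<close>. By Schur's
  lemma \<open>A\<close> is abelian of exponent dividing \<open>n\<close>, and a non-scalar lift of an element of \<open>A\<close> is
  conjugate to a nontrivial multiple of itself, hence has trace \<open>0\<close>. If commuting lifts generate a
  group of order \<open>N\<close> modulo scalars, averaging over it gives an idempotent of trace \<open>n / N\<close>, so \<open>N\<close>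
  divides \<open>n\<close>.

  Suppose that \<open>n\<close> is squarefree and let \<open>x\<close> be an element of \<open>A\<close> whose order \<open>m\<close> is the exponent of
  \<open>A\<close>. The divisibility shows that only powers of \<open>x\<close> have lifts commuting with the lift of \<open>x\<close>, so
  \<open>A\<close> is generated by \<open>x\<close> and one element \<open>y\<close> whose commutator with \<open>x\<close> is a primitive \<open>k\<close>-th root of
  unity, and \<open>y\<close> can be chosen of order \<open>k\<close>. All eigenspaces of \<open>x\<close> have the same dimension
  and \<open>y\<close> permutes them cyclically in blocks, so \<open>m\<close> and \<open>k\<close> determine the pair up to
  simultaneous conjugacy; and the isomorphism type of \<open>A\<close> determines \<open>m\<close> (the exponent) and
  \<open>m * k\<close> (the order).

  If \<open>p\<^sup>2\<close> divides \<open>n\<close>, the product of two cyclic groups of order \<open>p\<close> occurs both as the image of a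
  Heisenberg group of \<open>p\<close> by \<open>p\<close> matrices and as a group of diagonal matrices. Lifts commute
  in the second case only.
\<close>

section \<open>Projective classes of matrices\<close>

text \<open>Why only powers of \<open>x\<close> have lifts commuting with \<open>x\<close>: correct
  such a class by a power of \<open>x\<close> until it has an order \<open>k\<close> that divides
  \<open>m\<close> and generates a cyclic group meeting that of \<open>x\<close> trivially. Then
  \<open>m * k\<close> divides \<open>n\<close>, and the square of a prime factor of
  \<open>k\<close> would divide \<open>n\<close>. The correction works because \<open>m\<close> is
  the exponent of the group; the same correction gives \<open>y\<close> its order \<open>k\<close>.

  Elements of PSL are labelled by arbitrary invertible matrices, not only by those of determinant
  one. A lift can then be rescaled until its \<open>m\<close>-th power is exactly the identity, as
  averaging over powers requires.

  In the non-squarefree case the obstacle is to compute a centralizer exactly. The subgroup is taken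
  to be the centralizer of two chosen classes, so these classes lie in its own centralizer for free.
  The opposite inclusion only needs an explicit irreducible set \<open>K\<close> of matrices whose
  classes lie in the subgroup: two of them detect the exponents in a product of powers of the pair,
  and the others have nonzero trace, so that whatever commutes with them up to a scalar commutes
  with them.\<close>

definition GL :: "nat \<Rightarrow> complex mat set" where
  "GL n = {A \<in> carrier_mat n n. det A \<noteq> 0}"

text \<open>The image of \<open>A\<close> in PGL = PSL, as a coset of the center of SL: the
  multiples of \<open>A\<close> of determinant one. For \<open>A\<close> in \<open>GL n\<close> the
  scalar is automatically nonzero.\<close>

definition proj_class :: "nat \<Rightarrow> complex mat \<Rightarrow> complex mat set" where
  "proj_class n A = {B \<in> carrier_mat n n. det B = 1 \<and> (\<exists>c. B = c \<cdot>\<^sub>m A)}"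

text \<open>Lifts of commuting classes commute only up to a scalar, and this scalar may vary with
  \<open>h\<close>.\<close>

definition proj_centralizer :: "nat \<Rightarrow> complex mat set \<Rightarrow> complex mat set" where
  "proj_centralizer n H = {u \<in> GL n. \<forall>h\<in>H. \<exists>c. u * h = c \<cdot>\<^sub>m (h * u)}"

definition matrix_unit :: "nat \<Rightarrow> nat \<Rightarrow> nat \<Rightarrow> complex mat" where
  "matrix_unit n a b = mat n n (\<lambda>(i, j). if i = a \<and> j = b then 1 else 0)"

lemma smult_smult_mat [simp]: "c \<cdot>\<^sub>m (d \<cdot>\<^sub>m A) = (c * d :: 'a :: semigroup_mult) \<cdot>\<^sub>m A"
  by (rule eq_matI) (auto simp: mult.assoc)

lemma one_smult_mat [simp]: "(1 :: 'a :: monoid_mult) \<cdot>\<^sub>m A = A"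
  by (rule eq_matI) auto

lemma smult_mat_cancel:
  assumes "c \<cdot>\<^sub>m A = d \<cdot>\<^sub>m A" "A \<in> carrier_mat n n" "det A \<noteq> 0" "n > 0"
  shows "c = (d :: 'a :: field)"
proof (rule ccontr)
  assume "c \<noteq> d"
  have "A $$ (i, j) = 0" if "i < n" "j < n" for i j
  proof -
    have "(c \<cdot>\<^sub>m A) $$ (i, j) = (d \<cdot>\<^sub>m A) $$ (i, j)" using assms(1) by simp
    then show ?thesis using that assms(2) \<open>c \<noteq> d\<close> by auto
  qed
  then have "A = 0 \<cdot>\<^sub>m A"
    using assms(2) by (intro eq_matI) auto
  then have "det A = 0 ^ n * det A"
    using assms(2) det_smult[of 0 A] by auto
  then show False using assms(3,4) by (simp add: power_0_left)
qed

section \<open>Matrix algebra in a fixed positive dimension\<close>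

locale matrix_dim =
  fixes n :: nat
  assumes n_pos: "n > 0"
begin

abbreviation M :: "complex mat set" where "M \<equiv> carrier_mat n n"

lemma sq_mult [simp]: "A \<in> M \<Longrightarrow> B \<in> M \<Longrightarrow> A * B \<in> M"
  by (rule mult_carrier_mat)

lemma sq_assoc: "A \<in> M \<Longrightarrow> B \<in> M \<Longrightarrow> C \<in> M \<Longrightarrow> A * B * C = A * (B * C)"
  by (rule assoc_mult_mat)

lemma sq_smult_left [simp]: "A \<in> M \<Longrightarrow> B \<in> M \<Longrightarrow> (c \<cdot>\<^sub>m A) * B = c \<cdot>\<^sub>m (A * B)"
  by (rule mult_smult_assoc_mat)

lemma sq_smult_right [simp]: "A \<in> M \<Longrightarrow> B \<in> M \<Longrightarrow> A * (c \<cdot>\<^sub>m B) = c \<cdot>\<^sub>m (A * B)"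
  by (rule mult_smult_distrib)

lemma sq_one_left [simp]: "A \<in> M \<Longrightarrow> 1\<^sub>m n * A = A"
  by (rule left_mult_one_mat)

lemma sq_one_right [simp]: "A \<in> M \<Longrightarrow> A * 1\<^sub>m n = A"
  by (rule right_mult_one_mat)

lemma sq_pow_0 [simp]: "A \<in> M \<Longrightarrow> A ^\<^sub>m 0 = 1\<^sub>m n"
  by simp

lemma sq_pow_add: "A \<in> M \<Longrightarrow> A ^\<^sub>m (i + j) = A ^\<^sub>m i * A ^\<^sub>m j"
  by (induction j) (auto simp: sq_assoc[symmetric])

lemma sq_pow_mult: "A \<in> M \<Longrightarrow> A ^\<^sub>m (i * j) = (A ^\<^sub>m i) ^\<^sub>m j"
  by (induction j) (auto simp: sq_pow_add[of A] add.commute[of i])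

lemma sq_pow_one [simp]: "1\<^sub>m n ^\<^sub>m j = (1\<^sub>m n :: complex mat)"
  by (induction j) auto

lemma sq_pow_smult: "A \<in> M \<Longrightarrow> (c \<cdot>\<^sub>m A) ^\<^sub>m j = c ^ j \<cdot>\<^sub>m A ^\<^sub>m j"
  by (induction j) (auto simp: mult.commute)

lemma GL_M [simp]: "A \<in> GL n \<Longrightarrow> A \<in> M"
  by (auto simp: GL_def)

lemma GL_one [simp]: "1\<^sub>m n \<in> GL n"
  by (auto simp: GL_def simp del: GL_M)

lemma GL_mult [simp]: "A \<in> GL n \<Longrightarrow> B \<in> GL n \<Longrightarrow> A * B \<in> GL n"
  by (auto simp: GL_def det_mult[of _ n] simp del: GL_M)

lemma GL_smult [simp]: "A \<in> GL n \<Longrightarrow> c \<noteq> 0 \<Longrightarrow> c \<cdot>\<^sub>m A \<in> GL n"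
  by (auto simp: GL_def simp del: GL_M)

lemma GL_pow [simp]: "A \<in> GL n \<Longrightarrow> A ^\<^sub>m k \<in> GL n"
  using carrier_matD[OF GL_M[of A]] by (induction k) simp_all

lemma GL_I: "A \<in> M \<Longrightarrow> B \<in> M \<Longrightarrow> A * B = 1\<^sub>m n \<Longrightarrow> A \<in> GL n"
  using det_mult[of A n B] by (auto simp: GL_def simp del: GL_M)

lemma GL_inverse:
  assumes "A \<in> GL n"
  obtains B where "B \<in> GL n" "A * B = 1\<^sub>m n" "B * A = 1\<^sub>m n"
proof -
  have A: "A \<in> M" "det A \<noteq> 0" using assms by (auto simp: GL_def simp del: GL_M)
  obtain B where "B \<in> M" "B * A = 1\<^sub>m n" "A * B = 1\<^sub>m n"
    using det_non_zero_imp_unit[OF A, of "()"] by (auto simp: Units_def ring_mat_def)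
  then show ?thesis using that A GL_I by blast
qed

lemma GL_smult_nonzero: "c \<cdot>\<^sub>m A \<in> GL n \<Longrightarrow> c \<noteq> 0"
  using n_pos by (auto simp: GL_def simp del: GL_M)

lemma GL_smult_cancel: "c \<cdot>\<^sub>m A = d \<cdot>\<^sub>m A \<Longrightarrow> A \<in> GL n \<Longrightarrow> c = d"
  using smult_mat_cancel[of c A d n] n_pos by (auto simp: GL_def simp del: GL_M)

lemma GL_cancel_left: "A * B = A * C \<Longrightarrow> A \<in> GL n \<Longrightarrow> B \<in> M \<Longrightarrow> C \<in> M \<Longrightarrow> B = C"
  by (metis GL_inverse GL_M sq_assoc sq_one_left)

lemma GL_cancel_right: "B * A = C * A \<Longrightarrow> A \<in> GL n \<Longrightarrow> B \<in> M \<Longrightarrow> C \<in> M \<Longrightarrow> B = C"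
  by (metis GL_inverse GL_M sq_assoc sq_one_right)

lemma complex_root_exists:
  assumes "c \<noteq> (0::complex)" "k > 0"
  obtains d where "d \<noteq> 0" "d ^ k = c"
proof -
  have "{z. z ^ k = c} \<noteq> {}"
    using card_nth_roots[OF assms] assms by (metis card.empty less_irrefl)
  then obtain d where "d ^ k = c" by blast
  moreover from this have "d \<noteq> 0" using assms by (auto simp: power_0_left)
  ultimately show ?thesis using that by blast
qed

text \<open>Scales by an \<open>n\<close>-th root of the inverse determinant; this is why every
  invertible matrix labels an element of PSL.\<close>

lemma GL_normalize:
  assumes "A \<in> GL n"
  obtains c where "c \<noteq> 0" "det (c \<cdot>\<^sub>m A) = 1"
proof -
  obtain c where "c \<noteq> 0" "c ^ n = inverse (det A)"
    using complex_root_exists[of "inverse (det A)" n] assms n_pos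
    by (auto simp: GL_def simp del: GL_M)
  then show ?thesis using that[of c] assms by (auto simp: GL_def simp del: GL_M)
qed

lemma proj_class_eq_iff:
  assumes "A \<in> GL n" "B \<in> GL n"
  shows "proj_class n A = proj_class n B \<longleftrightarrow> (\<exists>c. A = c \<cdot>\<^sub>m B)"
proof
  assume eq: "proj_class n A = proj_class n B"
  obtain c where c: "c \<noteq> 0" "det (c \<cdot>\<^sub>m A) = 1" using GL_normalize assms(1) .
  then have "c \<cdot>\<^sub>m A \<in> proj_class n A" using assms(1) by (auto simp: proj_class_def)
  then obtain d where "c \<cdot>\<^sub>m A = d \<cdot>\<^sub>m B" unfolding eq by (auto simp: proj_class_def)
  then have "inverse c \<cdot>\<^sub>m (c \<cdot>\<^sub>m A) = inverse c \<cdot>\<^sub>m (d \<cdot>\<^sub>m B)" by simp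
  then show "\<exists>c. A = c \<cdot>\<^sub>m B" using c by auto
next
  assume "\<exists>c. A = c \<cdot>\<^sub>m B"
  then obtain c where c: "A = c \<cdot>\<^sub>m B" by auto
  then have "c \<noteq> 0" using GL_smult_nonzero assms(1) by auto
  then have B: "B = inverse c \<cdot>\<^sub>m A" using c by simp
  show "proj_class n A = proj_class n B"
    unfolding proj_class_def using c B by (metis (no_types, opaque_lifting) smult_smult_mat)
qed

section \<open>The center of SL and the quotient PSL\<close>

lemma matrix_unit_M [simp]: "matrix_unit n a b \<in> M"
  by (simp add: matrix_unit_def)

lemma mult_matrix_unit:
  assumes "A \<in> M" "a < n" "b < n" "i < n" "j < n"
  shows "(A * matrix_unit n a b) $$ (i, j) = (if j = b then A $$ (i, a) else 0)"
    and "(matrix_unit n a b * A) $$ (i, j) = (if i = a then A $$ (b, j) else 0)"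
  using assms
  by (auto simp: matrix_unit_def scalar_prod_def if_distrib[of "\<lambda>x. _ * x"] if_distrib[of "\<lambda>x. x * _"] cong: if_cong)

lemma one_plus_unit:
  assumes "a < n" "b < n" "a \<noteq> b"
  shows "1\<^sub>m n + matrix_unit n a b = addrow_mat n 1 a b"
  using assms by (intro eq_matI) (auto simp: matrix_unit_def addrow_mat_def)

text \<open>Commuting with the transvection \<open>1 + E_ab\<close>, which has determinant one,
  amounts to commuting with the matrix unit \<open>E_ab\<close>. Comparing entries of
  \<open>z * E_ab\<close> and \<open>E_ab * z\<close> makes \<open>z\<close> diagonal with equal
  diagonal entries.\<close>

lemma center_SL: "group_center (SL n) = {c \<cdot>\<^sub>m 1\<^sub>m n | c :: complex. c ^ n = 1}"
proof (intro equalityI subsetI)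
  fix z assume "z \<in> {c \<cdot>\<^sub>m 1\<^sub>m n | c :: complex. c ^ n = 1}"
  then show "z \<in> group_center (SL n)" by (auto simp: group_center_def SL_def)
next
  fix z assume z: "z \<in> group_center (SL n)"
  then have zM: "z \<in> M" and dz: "det z = 1" by (auto simp: group_center_def SL_def)
  have comm: "z * matrix_unit n a b = matrix_unit n a b * z" if ab: "a < n" "b < n" "a \<noteq> b" for a b
  proof -
    have "1\<^sub>m n + matrix_unit n a b \<in> carrier (SL n)"
      using det_addrow_mat[OF ab(3), of n 1] one_plus_unit[OF ab] by (auto simp: SL_def)
    then have "z * (1\<^sub>m n + matrix_unit n a b) = (1\<^sub>m n + matrix_unit n a b) * z"
      using z by (auto simp: group_center_def SL_def)
    then have e: "z + z * matrix_unit n a b = z + matrix_unit n a b * z"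
      using zM by (simp add: mult_add_distrib_mat[of _ n n _ n] add_mult_distrib_mat[of _ n n _ _ n])
    show ?thesis
    proof (rule eq_matI)
      fix i j assume "i < dim_row (matrix_unit n a b * z)" "j < dim_col (matrix_unit n a b * z)"
      then have ij: "i < n" "j < n" using zM by (auto simp: matrix_unit_def)
      have "(z + z * matrix_unit n a b) $$ (i,j) = (z + matrix_unit n a b * z) $$ (i,j)" using e by simp
      then show "(z * matrix_unit n a b) $$ (i,j) = (matrix_unit n a b * z) $$ (i,j)"
        using ij zM matrix_unit_M[of a b] by (auto simp del: matrix_unit_M)
    qed (use zM in \<open>auto simp: matrix_unit_def\<close>)
  qed
  have off: "z $$ (i, a) = 0" if "i < n" "a < n" "i \<noteq> a" for i a
    using comm[of a i] mult_matrix_unit[OF zM, of a i i i] that by auto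
  have diag: "z $$ (i, i) = z $$ (a, a)" if "i < n" "a < n" for i a
  proof (cases "i = a")
    case False
    then show ?thesis using comm[of a i] mult_matrix_unit[OF zM, of a i a i] that by auto
  qed auto
  have zeq: "z = z $$ (0,0) \<cdot>\<^sub>m 1\<^sub>m n"
  proof (rule eq_matI)
    fix i j assume "i < dim_row (z $$ (0,0) \<cdot>\<^sub>m 1\<^sub>m n)" "j < dim_col (z $$ (0,0) \<cdot>\<^sub>m 1\<^sub>m n)"
    then show "z $$ (i,j) = (z $$ (0,0) \<cdot>\<^sub>m 1\<^sub>m n) $$ (i,j)"
      using off[of i j] diag[of i 0] by auto
  qed (use zM in auto)
  have "det (z $$ (0,0) \<cdot>\<^sub>m 1\<^sub>m n) = 1" using dz zeq by simp
  then have "z $$ (0,0) ^ n = 1" by simp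
  then show "z \<in> {c \<cdot>\<^sub>m 1\<^sub>m n | c :: complex. c ^ n = 1}" using zeq by blast
qed

lemma SL_simps [simp]:
  "A \<in> carrier (SL n) \<longleftrightarrow> A \<in> M \<and> det A = 1" "A \<otimes>\<^bsub>SL n\<^esub> B = A * B" "\<one>\<^bsub>SL n\<^esub> = 1\<^sub>m n"
  by (auto simp: SL_def)

lemma group_SL: "group (SL n)"
proof (rule groupI)
  fix x assume x: "x \<in> carrier (SL n)"
  then have "x \<in> GL n" by (auto simp: GL_def simp del: GL_M)
  then obtain y where "y \<in> GL n" "y * x = 1\<^sub>m n" using GL_inverse by blast
  moreover from this have "det y = 1" using x det_mult[of y n x] by auto
  ultimately show "\<exists>y\<in>carrier (SL n). y \<otimes>\<^bsub>SL n\<^esub> x = \<one>\<^bsub>SL n\<^esub>" by auto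
qed (auto simp: sq_assoc det_mult[of _ n])

lemma normal_center_SL: "group_center (SL n) \<lhd> SL n"
proof -
  interpret group "SL n" by (rule group_SL)
  have "subgroup (group_center (SL n)) (SL n)"
  proof (rule subgroupI)
    fix a assume a: "a \<in> group_center (SL n)"
    then have aS: "a \<in> carrier (SL n)" by (auto simp: group_center_def)
    show "inv\<^bsub>SL n\<^esub> a \<in> group_center (SL n)"
      unfolding group_center_def
    proof safe
      fix g assume g: "g \<in> carrier (SL n)"
      have "a \<otimes>\<^bsub>SL n\<^esub> g = g \<otimes>\<^bsub>SL n\<^esub> a" using a g by (auto simp: group_center_def)
      then show "inv\<^bsub>SL n\<^esub> a \<otimes>\<^bsub>SL n\<^esub> g = g \<otimes>\<^bsub>SL n\<^esub> inv\<^bsub>SL n\<^esub> a"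
        using aS g by (metis inv_closed inv_equality inv_solve_left inv_solve_right m_assoc m_closed)
    qed (use aS in \<open>simp_all del: SL_simps\<close>)
  next
    show "group_center (SL n) \<noteq> {}" unfolding center_SL using power_one by blast
  next
    fix a b assume "a \<in> group_center (SL n)" "b \<in> group_center (SL n)"
    then show "a \<otimes>\<^bsub>SL n\<^esub> b \<in> group_center (SL n)"
      unfolding center_SL by (auto simp: power_mult_distrib)
  qed (auto simp: group_center_def)
  then show ?thesis
  proof (rule normalI[rule_format, OF _ ])
    fix x assume x: "x \<in> carrier (SL n)"
    show "group_center (SL n) #>\<^bsub>SL n\<^esub> x = x <#\<^bsub>SL n\<^esub> group_center (SL n)"
      using x unfolding r_coset_def l_coset_def by (auto simp: group_center_def)
  qed
qed

lemma rcoset_center_SL: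
  assumes "A \<in> carrier (SL n)"
  shows "group_center (SL n) #>\<^bsub>SL n\<^esub> A = proj_class n A"
proof (intro equalityI subsetI)
  fix B assume "B \<in> group_center (SL n) #>\<^bsub>SL n\<^esub> A"
  then obtain z where "z \<in> group_center (SL n)" "B = z * A"
    by (auto simp: r_coset_def)
  then obtain c where "c ^ n = 1" "B = c \<cdot>\<^sub>m A"
    using assms by (auto simp: center_SL)
  then show "B \<in> proj_class n A"
    using assms by (auto simp: proj_class_def)
next
  fix B assume "B \<in> proj_class n A"
  then obtain c where c: "det B = 1" "B = c \<cdot>\<^sub>m A" by (auto simp: proj_class_def)
  then have "c ^ n = 1" using assms by auto
  then have "c \<cdot>\<^sub>m 1\<^sub>m n \<in> group_center (SL n)" by (auto simp: center_SL)
  moreover have "B = c \<cdot>\<^sub>m 1\<^sub>m n * A" using c assms by simp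
  ultimately show "B \<in> group_center (SL n) #>\<^bsub>SL n\<^esub> A"
    unfolding r_coset_def by auto
qed

lemma carrier_PSL: "carrier (PSL n) = proj_class n ` GL n"
proof -
  have "carrier (PSL n) = proj_class n ` carrier (SL n)"
    using rcoset_center_SL by (auto simp: PSL_def FactGroup_def RCOSETS_def)
  also have "\<dots> = proj_class n ` GL n"
  proof safe
    fix A assume A: "A \<in> GL n"
    then obtain c where c: "c \<noteq> 0" "det (c \<cdot>\<^sub>m A) = 1" using GL_normalize by blast
    then have "proj_class n A = proj_class n (c \<cdot>\<^sub>m A)"
      using proj_class_eq_iff[of "c \<cdot>\<^sub>m A" A] A by auto
    then show "proj_class n A \<in> proj_class n ` carrier (SL n)" using c A by auto
  qed (auto simp: GL_def simp del: GL_M)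
  finally show ?thesis .
qed

lemma proj_class_PSL [simp]: "A \<in> GL n \<Longrightarrow> proj_class n A \<in> carrier (PSL n)"
  by (auto simp: carrier_PSL)

lemma group_PSL: "group (PSL n)"
  unfolding PSL_def by (rule normal.factorgroup_is_group[OF normal_center_SL])

lemma one_PSL: "\<one>\<^bsub>PSL n\<^esub> = proj_class n (1\<^sub>m n)"
proof -
  have "group_center (SL n) = proj_class n (1\<^sub>m n)"
    by (auto simp: center_SL proj_class_def)
  then show ?thesis by (simp add: PSL_def FactGroup_def)
qed

text \<open>Rescaling both factors to determinant one reduces this to the product of cosets in SL;
  the scalars disappear again in the class of the product.\<close>

lemma mult_PSL:
  assumes "A \<in> GL n" "B \<in> GL n"
  shows "proj_class n A \<otimes>\<^bsub>PSL n\<^esub> proj_class n B = proj_class n (A * B)"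
proof -
  obtain c where c: "c \<noteq> 0" "det (c \<cdot>\<^sub>m A) = 1" using assms GL_normalize by blast
  obtain d where d: "d \<noteq> 0" "det (d \<cdot>\<^sub>m B) = 1" using assms GL_normalize by blast
  have cA: "proj_class n A = proj_class n (c \<cdot>\<^sub>m A)" "proj_class n B = proj_class n (d \<cdot>\<^sub>m B)"
    using proj_class_eq_iff[of "c \<cdot>\<^sub>m A" A] proj_class_eq_iff[of "d \<cdot>\<^sub>m B" B] assms c d by auto
  have S: "c \<cdot>\<^sub>m A \<in> carrier (SL n)" "d \<cdot>\<^sub>m B \<in> carrier (SL n)"
    using assms c d by auto
  then have "proj_class n A \<otimes>\<^bsub>PSL n\<^esub> proj_class n B
      = group_center (SL n) #>\<^bsub>SL n\<^esub> ((c \<cdot>\<^sub>m A) * (d \<cdot>\<^sub>m B))"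
    unfolding cA rcoset_center_SL[symmetric, OF S(1)] rcoset_center_SL[symmetric, OF S(2)]
    using normal.rcos_sum[OF normal_center_SL S] by (simp add: PSL_def FactGroup_def)
  also have "\<dots> = proj_class n ((c \<cdot>\<^sub>m A) * (d \<cdot>\<^sub>m B))"
    using S by (intro rcoset_center_SL) (auto simp: det_mult[of _ n])
  also have "\<dots> = proj_class n (A * B)"
    using assms c d by (subst proj_class_eq_iff) auto
  finally show ?thesis .
qed

lemma commute_PSL:
  assumes "A \<in> GL n" "B \<in> GL n"
  shows "proj_class n A \<otimes>\<^bsub>PSL n\<^esub> proj_class n B = proj_class n B \<otimes>\<^bsub>PSL n\<^esub> proj_class n A
    \<longleftrightarrow> (\<exists>c. A * B = c \<cdot>\<^sub>m (B * A))"
  using assms by (simp add: mult_PSL proj_class_eq_iff)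

lemma inv_PSL:
  assumes "A \<in> GL n" "B \<in> GL n" "A * B = 1\<^sub>m n"
  shows "inv\<^bsub>PSL n\<^esub> (proj_class n A) = proj_class n B"
proof -
  interpret group "PSL n" by (rule group_PSL)
  show ?thesis
    using inv_equality[of "proj_class n B" "proj_class n A"] assms
      mat_mult_left_right_inverse[of A n B] by (simp add: mult_PSL one_PSL)
qed

lemma proj_centralizer_GL: "u \<in> proj_centralizer n H \<Longrightarrow> u \<in> GL n"
  by (auto simp: proj_centralizer_def)

lemma proj_class_GL: "A \<in> proj_class n B \<Longrightarrow> A \<in> GL n"
  by (simp add: proj_class_def GL_def del: GL_M)

lemma proj_class_subset_GL: "S \<subseteq> carrier (PSL n) \<Longrightarrow> \<Union>S \<subseteq> GL n"
  unfolding carrier_PSL using proj_class_GL by blast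

lemma proj_class_self:
  assumes "A \<in> proj_class n B" "B \<in> GL n"
  shows "proj_class n B = proj_class n A"
proof -
  have "A \<in> GL n" using assms(1) by (rule proj_class_GL)
  then show ?thesis using assms proj_class_eq_iff[of A B] by (auto simp: proj_class_def)
qed

text \<open>Every member of \<open>S\<close> contains a determinant-one representative, and each of
  its elements represents it; commuting up to a scalar does not depend on the representative.
  Computations in PSL thus become computations with matrices.\<close>

lemma centralizer_PSL:
  assumes "S \<subseteq> carrier (PSL n)"
  shows "centralizer (PSL n) S = proj_class n ` proj_centralizer n (\<Union>S)"
proof -
  have "(\<forall>y\<in>S. proj_class n u \<otimes>\<^bsub>PSL n\<^esub> y = y \<otimes>\<^bsub>PSL n\<^esub> proj_class n u)
      \<longleftrightarrow> (\<forall>h\<in>\<Union>S. \<exists>c. u * h = c \<cdot>\<^sub>m (h * u))" if u: "u \<in> GL n" for u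
  proof
    assume L: "\<forall>y\<in>S. proj_class n u \<otimes>\<^bsub>PSL n\<^esub> y = y \<otimes>\<^bsub>PSL n\<^esub> proj_class n u"
    show "\<forall>h\<in>\<Union>S. \<exists>c. u * h = c \<cdot>\<^sub>m (h * u)"
    proof safe
      fix h y assume h: "h \<in> y" "y \<in> S"
      then obtain B where B: "B \<in> GL n" "y = proj_class n B" using assms by (auto simp: carrier_PSL)
      have "h \<in> GL n" "y = proj_class n h"
        using proj_class_self[of h B] proj_class_GL[of h B] h B by auto
      then show "\<exists>c. u * h = c \<cdot>\<^sub>m (h * u)" using L h commute_PSL[OF u] by auto
    qed
  next
    assume R: "\<forall>h\<in>\<Union>S. \<exists>c. u * h = c \<cdot>\<^sub>m (h * u)"
    show "\<forall>y\<in>S. proj_class n u \<otimes>\<^bsub>PSL n\<^esub> y = y \<otimes>\<^bsub>PSL n\<^esub> proj_class n u"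
    proof
      fix y assume y: "y \<in> S"
      then obtain B where B: "B \<in> GL n" "y = proj_class n B" using assms by (auto simp: carrier_PSL)
      obtain c where c: "c \<noteq> 0" "det (c \<cdot>\<^sub>m B) = 1" using B GL_normalize by blast
      have h: "c \<cdot>\<^sub>m B \<in> y" using B c by (auto simp: proj_class_def)
      then have "c \<cdot>\<^sub>m B \<in> GL n" "y = proj_class n (c \<cdot>\<^sub>m B)"
        using proj_class_self[of "c \<cdot>\<^sub>m B" B] B c by auto
      then show "proj_class n u \<otimes>\<^bsub>PSL n\<^esub> y = y \<otimes>\<^bsub>PSL n\<^esub> proj_class n u"
        using R h y commute_PSL[OF u] by auto
    qed
  qed
  then show ?thesis
    unfolding centralizer_def proj_centralizer_def carrier_PSL by blast
qed

end

section \<open>Traces and idempotents\<close>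

definition trace_mat :: "complex mat \<Rightarrow> complex" where
  "trace_mat A = (\<Sum>i<dim_row A. A $$ (i, i))"

lemma trace_mat_smult [simp]: "A \<in> carrier_mat n n \<Longrightarrow> trace_mat (c \<cdot>\<^sub>m A) = c * trace_mat A"
  by (simp add: trace_mat_def sum_distrib_left)

lemma trace_mat_one [simp]: "trace_mat (1\<^sub>m n) = of_nat n"
  by (simp add: trace_mat_def)

lemma trace_mat_mult_commute:
  assumes "A \<in> carrier_mat r s" "B \<in> carrier_mat s r"
  shows "trace_mat (A * B) = trace_mat (B * A)"
proof -
  have "trace_mat (A * B) = (\<Sum>i<r. \<Sum>j<s. A $$ (i, j) * B $$ (j, i))"
    using assms by (auto simp: trace_mat_def scalar_prod_def lessThan_atLeast0 intro!: sum.cong)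
  also have "\<dots> = (\<Sum>j<s. \<Sum>i<r. B $$ (j, i) * A $$ (i, j))"
    by (subst sum.swap) (simp add: mult.commute)
  also have "\<dots> = trace_mat (B * A)"
    using assms by (auto simp: trace_mat_def scalar_prod_def lessThan_atLeast0 intro!: sum.cong)
  finally show ?thesis .
qed

text \<open>Moving the window of summation by one trades the term at \<open>q\<close> for the equal
  term at \<open>m + q\<close>.\<close>

lemma sum_shift_periodic:
  fixes g :: "nat \<Rightarrow> 'a :: ab_group_add"
  assumes "\<And>i. g (i + m) = g i"
  shows "(\<Sum>i<m. g (i + q)) = (\<Sum>i<m. g i)"
proof (induction q)
  case (Suc q)
  have "g q + (\<Sum>i<m. g (Suc i + q)) = (\<Sum>i<m. g (i + q)) + g (m + q)"
    using sum.lessThan_Suc_shift[of "\<lambda>i. g (i + q)" m] sum.lessThan_Suc[of "\<lambda>i. g (i + q)" m] by simp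
  then show ?case using Suc assms[of q] by (simp add: add.commute)
qed simp

text \<open>If \<open>k < s\<close>, padding with zeros to \<open>s\<close> by \<open>s\<close>
  matrices keeps \<open>R' * C' = 1\<close>, so also \<open>C' * R' = 1\<close>; but row
  \<open>k\<close> of \<open>C'\<close> is zero.\<close>

lemma left_inverse_dim_le:
  fixes C :: "'a :: field mat"
  assumes C: "C \<in> carrier_mat k s" and R: "R \<in> carrier_mat s k" and RC: "R * C = 1\<^sub>m s"
  shows "s \<le> k"
proof (rule ccontr)
  assume "\<not> s \<le> k"
  then have ks: "k < s" by simp
  define C' where "C' = mat s s (\<lambda>(a, b). if a < k then C $$ (a, b) else 0)"
  define R' where "R' = mat s s (\<lambda>(a, b). if b < k then R $$ (a, b) else 0)"
  have "R' * C' = R * C"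
  proof (rule eq_matI)
    fix a b assume "a < dim_row (R * C)" "b < dim_col (R * C)"
    then have ab: "a < s" "b < s" using C R by auto
    have "(R' * C') $$ (a, b) = (\<Sum>i<s. if i < k then R $$ (a, i) * C $$ (i, b) else 0)"
      using ab by (auto simp: R'_def C'_def scalar_prod_def lessThan_atLeast0 intro!: sum.cong)
    also have "\<dots> = (\<Sum>i<k. R $$ (a, i) * C $$ (i, b))"
      using ks by (intro sum.mono_neutral_cong_right) auto
    also have "\<dots> = (R * C) $$ (a, b)"
      using ab C R by (auto simp: scalar_prod_def lessThan_atLeast0)
    finally show "(R' * C') $$ (a, b) = (R * C) $$ (a, b)" .
  qed (use C R in \<open>auto simp: R'_def C'_def\<close>)
  then have "C' * R' = 1\<^sub>m s"
    using RC mat_mult_left_right_inverse[of R' s C'] by (simp add: R'_def C'_def)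
  then have "(C' * R') $$ (k, k) = 1" using ks by simp
  moreover have "(C' * R') $$ (k, k) = 0"
    using ks by (auto simp: R'_def C'_def scalar_prod_def)
  ultimately show False by simp
qed

text \<open>Rank factorization by maximality. For a partial factorization with \<open>r\<close> as
  large as possible, the remainder \<open>P - C * R\<close> is an idempotent orthogonal to
  \<open>C\<close> and \<open>R\<close>; a nonzero entry of it would allow one more column and
  row.\<close>

lemma idempotent_factorization:
  fixes P :: "complex mat"
  assumes P: "P \<in> carrier_mat n n" and idem: "P * P = P"
  obtains r C R where "C \<in> carrier_mat n r" "R \<in> carrier_mat r n" "R * C = 1\<^sub>m r" "C * R = P"
proof -
  \<comment> \<open>The last two equations say that \<open>C * R\<close> is an idempotent below
    \<open>P\<close>; they keep the remainder orthogonal to what has been split off.\<close>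
  define Q where "Q r \<longleftrightarrow> (\<exists>C R. C \<in> carrier_mat n r \<and> R \<in> carrier_mat r n \<and> R * C = 1\<^sub>m r \<and> P * C = C \<and> R * P = R)" for r
  have "Q 0" unfolding Q_def
    by (rule exI[of _ "0\<^sub>m n 0"], rule exI[of _ "0\<^sub>m 0 n"]) (use P in auto)
  moreover have bound: "Q r \<Longrightarrow> r \<le> n" for r
    unfolding Q_def using left_inverse_dim_le by blast
  ultimately obtain r where r: "Q r" "\<And>s. Q s \<Longrightarrow> s \<le> r"
    using Nat.ex_has_greatest_nat[of Q 0 n] by blast
  obtain C R where C: "C \<in> carrier_mat n r" and R: "R \<in> carrier_mat r n" and RC: "R * C = 1\<^sub>m r"
    and PC: "P * C = C" and RP: "R * P = R" using r(1) unfolding Q_def by blast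
  define P' where "P' = P - C * R"
  have CR: "C * R \<in> carrier_mat n n" using C R by auto
  have P': "P' \<in> carrier_mat n n" using P C R by (auto simp: P'_def)
  have CRCR: "C * R * (C * R) = C * R"
    using C R RC by (metis CR assoc_mult_mat left_mult_one_mat)
  have P'P': "P * P' = P'" "P' * P = P'" "P' * C = 0\<^sub>m n r" "R * P' = 0\<^sub>m r n"
    unfolding P'_def
    using mult_minus_distrib_mat[OF P P CR] minus_mult_distrib_mat[OF P CR P]
      minus_mult_distrib_mat[OF P CR C] mult_minus_distrib_mat[OF R P CR] idem
      assoc_mult_mat[OF P C R] assoc_mult_mat[OF C R P] assoc_mult_mat[OF C R C] assoc_mult_mat[OF R C R]
      PC RP RC C R
    by auto
  have "P' * P' = P * P' - C * R * P'"
    using minus_mult_distrib_mat[OF P CR P'] by (simp add: P'_def)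
  also have "\<dots> = P' - 0\<^sub>m n n" using P'P' assoc_mult_mat[OF C R P'] C by auto
  finally have idem': "P' * P' = P'" using P' by auto
  have "P' = 0\<^sub>m n n"
  proof (rule ccontr)
    assume "P' \<noteq> 0\<^sub>m n n"
    then obtain i j where ij: "i < n" "j < n" "P' $$ (i, j) \<noteq> 0"
      using P' by (metis carrier_matD eq_matI index_zero_mat)
    \<comment> \<open>Column \<open>j\<close> of \<open>P'\<close> and row \<open>i\<close> of
      \<open>P'\<close> scaled by its entry at \<open>j\<close>. Their product is
      \<open>(P' * P') $$ (i, j) / P' $$ (i, j) = 1\<close> by idempotence.\<close>
    define C' where "C' = mat n (Suc r) (\<lambda>(a, b). if b < r then C $$ (a, b) else P' $$ (a, j))"
    define R' where "R' = mat (Suc r) n (\<lambda>(a, b). if a < r then R $$ (a, b) else P' $$ (i, b) / P' $$ (i, j))"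
    have entry: "(X * Y) $$ (a, b) = (\<Sum>l<n. X $$ (a, l) * Y $$ (l, b))"
      if "X \<in> carrier_mat u n" "Y \<in> carrier_mat n v" "a < u" "b < v" for X Y :: "complex mat" and a b u v
      using that by (auto simp: scalar_prod_def lessThan_atLeast0)
    have C': "C' \<in> carrier_mat n (Suc r)" and R': "R' \<in> carrier_mat (Suc r) n"
      by (auto simp: C'_def R'_def)
    have 1: "R' * C' = 1\<^sub>m (Suc r)"
    proof (rule eq_matI)
      fix a b assume "a < dim_row (1\<^sub>m (Suc r))" "b < dim_col (1\<^sub>m (Suc r))"
      then have ab: "a < Suc r" "b < Suc r" by auto
      have e: "(R' * C') $$ (a, b) = (\<Sum>l<n. R' $$ (a, l) * C' $$ (l, b))"
        using entry[OF R' C'] ab by auto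
      consider "a < r" "b < r" | "a < r" "b = r" | "a = r" "b < r" | "a = r" "b = r" using ab by linarith
      then show "(R' * C') $$ (a, b) = 1\<^sub>m (Suc r) $$ (a, b)"
      proof cases
        case 1
        then show ?thesis unfolding e using entry[OF R C, of a b] RC by (simp add: R'_def C'_def)
      next
        case 2
        then show ?thesis unfolding e using entry[OF R P', of a j] P'P' ij by (simp add: R'_def C'_def)
      next
        case 3
        then show ?thesis unfolding e using entry[OF P' C, of i b] P'P' ij
          by (simp add: R'_def C'_def flip: sum_divide_distrib)
      next
        case 4
        then show ?thesis unfolding e using entry[OF P' P', of i j] idem' ij
          by (simp add: R'_def C'_def flip: sum_divide_distrib)
      qed
    qed (use C' R' in auto)
    have 2: "P * C' = C'"
    proof (rule eq_matI)
      fix a b assume "a < dim_row C'" "b < dim_col C'"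
      then have ab: "a < n" "b < Suc r" using C' by auto
      then show "(P * C') $$ (a, b) = C' $$ (a, b)"
        using entry[OF P C', of a b] entry[OF P C, of a b] entry[OF P P', of a j] PC P'P' ij
        by (auto simp: C'_def)
    qed (use P C' in auto)
    have 3: "R' * P = R'"
    proof (rule eq_matI)
      fix a b assume "a < dim_row R'" "b < dim_col R'"
      then have ab: "a < Suc r" "b < n" using R' by auto
      then show "(R' * P) $$ (a, b) = R' $$ (a, b)"
        using entry[OF R' P, of a b] entry[OF R P, of a b] entry[OF P' P, of i b] RP P'P' ij
        by (auto simp: R'_def simp flip: sum_divide_distrib)
    qed (use P R' in auto)
    have "Q (Suc r)" unfolding Q_def using C' R' 1 2 3 by blast
    then show False using r(2) by fastforce
  qed
  then have "C * R = P"
  proof -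
    have "P = P' + C * R" unfolding P'_def using P CR by (intro eq_matI) auto
    then show ?thesis using \<open>P' = 0\<^sub>m n n\<close> CR by simp
  qed
  then show ?thesis using that C R RC by blast
qed

text \<open>With \<open>P = C * R\<close>, the trace of \<open>C * R\<close> is that of
  \<open>R * C\<close>, an identity matrix: the trace of an idempotent is its rank.\<close>

lemma idempotent_trace:
  assumes "P \<in> carrier_mat n n" "P * P = P"
  obtains r where "trace_mat P = of_nat r"
proof -
  obtain r C R where "C \<in> carrier_mat n r" "R \<in> carrier_mat r n" "R * C = 1\<^sub>m r" "C * R = P"
    using idempotent_factorization[OF assms] .
  then show ?thesis using that[of r] trace_mat_mult_commute by (metis trace_mat_one)
qed

text \<open>Equal traces mean equal ranks, so \<open>E = C * R\<close> and \<open>F = D * S\<close>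
  factor through the same space, and \<open>T = D * R\<close>, \<open>T' = C * S\<close> are
  mutually inverse isomorphisms between the images of \<open>E\<close> and \<open>F\<close>.\<close>

lemma idempotents_equivalent:
  assumes "E \<in> carrier_mat n n" "E * E = E" "F \<in> carrier_mat n n" "F * F = F" "trace_mat E = trace_mat F"
  obtains T T' where "T \<in> carrier_mat n n" "T' \<in> carrier_mat n n" "T * T' = F" "T' * T = E"
    "F * T = T" "T * E = T" "E * T' = T'" "T' * F = T'"
proof -
  obtain r C R where 1: "C \<in> carrier_mat n r" "R \<in> carrier_mat r n" "R * C = 1\<^sub>m r" "C * R = E"
    using idempotent_factorization[OF assms(1,2)] .
  obtain s D S where 2: "D \<in> carrier_mat n s" "S \<in> carrier_mat s n" "S * D = 1\<^sub>m s" "D * S = F"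
    using idempotent_factorization[OF assms(3,4)] .
  have "trace_mat E = of_nat r" "trace_mat F = of_nat s"
    using 1 2 trace_mat_mult_commute by (metis trace_mat_one)+
  then have "s = r" using assms(5) by simp
  note 2 = 2[unfolded this]
  have red: "X * Y * (Z * W) = X * W"
    if "X \<in> carrier_mat n r" "W \<in> carrier_mat r n" "Y \<in> carrier_mat r n" "Z \<in> carrier_mat n r" "Y * Z = 1\<^sub>m r"
    for X Y Z W :: "complex mat"
  proof -
    have "X * Y * (Z * W) = X * (Y * (Z * W))" using that by (intro assoc_mult_mat) auto
    also have "Y * (Z * W) = W" using that by (simp add: assoc_mult_mat[symmetric, of Y r n Z r W n])
    finally show ?thesis .
  qed
  show ?thesis
  proof (rule that[of "D * R" "C * S"])
    show "D * R * (C * S) = F" "C * S * (D * R) = E" using red 1 2 by metis+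
    show "F * (D * R) = D * R" "D * R * E = D * R" "E * (C * S) = C * S" "C * S * F = C * S"
      using red 1 2 by metis+
  qed (use 1 2 in auto)
qed

section \<open>Sums of matrices and averaging over powers\<close>

context matrix_dim
begin

text \<open>The entrywise form fixes the dimension, so that the empty sum is the \<open>n\<close> by
  \<open>n\<close> zero matrix.\<close>

definition msum :: "(nat \<Rightarrow> complex mat) \<Rightarrow> nat \<Rightarrow> complex mat" where
  "msum f m = mat n n (\<lambda>(a, b). \<Sum>i<m. f i $$ (a, b))"

lemma msum_M [simp]: "msum f m \<in> M"
  by (simp add: msum_def)

lemma msum_cong: "(\<And>i. i < m \<Longrightarrow> f i = g i) \<Longrightarrow> msum f m = msum g m"
  by (auto simp: msum_def)

lemma msum_left:
  assumes "A \<in> M" "\<And>i. i < m \<Longrightarrow> f i \<in> M"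
  shows "A * msum f m = msum (\<lambda>i. A * f i) m"
proof (rule eq_matI)
  fix a b assume "a < dim_row (msum (\<lambda>i. A * f i) m)" "b < dim_col (msum (\<lambda>i. A * f i) m)"
  then have ab: "a < n" "b < n" by (auto simp: msum_def)
  have "(A * msum f m) $$ (a, b) = (\<Sum>l<n. \<Sum>i<m. A $$ (a, l) * f i $$ (l, b))"
    using ab assms by (simp add: msum_def scalar_prod_def sum_distrib_left lessThan_atLeast0)
  also have "\<dots> = (\<Sum>i<m. \<Sum>l<n. A $$ (a, l) * f i $$ (l, b))" by (rule sum.swap)
  also have "\<dots> = (\<Sum>i<m. (A * f i) $$ (a, b))"
    using ab assms by (intro sum.cong) (auto simp: scalar_prod_def lessThan_atLeast0 carrier_matD[OF assms(2)])
  finally show "(A * msum f m) $$ (a, b) = msum (\<lambda>i. A * f i) m $$ (a, b)"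
    using ab by (simp add: msum_def)
qed (use assms in \<open>auto simp: msum_def\<close>)

lemma msum_right:
  assumes "A \<in> M" "\<And>i. i < m \<Longrightarrow> f i \<in> M"
  shows "msum f m * A = msum (\<lambda>i. f i * A) m"
proof (rule eq_matI)
  fix a b assume "a < dim_row (msum (\<lambda>i. f i * A) m)" "b < dim_col (msum (\<lambda>i. f i * A) m)"
  then have ab: "a < n" "b < n" by (auto simp: msum_def)
  have "(msum f m * A) $$ (a, b) = (\<Sum>l<n. \<Sum>i<m. f i $$ (a, l) * A $$ (l, b))"
    using ab assms by (simp add: msum_def scalar_prod_def sum_distrib_right lessThan_atLeast0)
  also have "\<dots> = (\<Sum>i<m. \<Sum>l<n. f i $$ (a, l) * A $$ (l, b))" by (rule sum.swap)
  also have "\<dots> = (\<Sum>i<m. (f i * A) $$ (a, b))"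
    using ab assms by (intro sum.cong) (auto simp: scalar_prod_def lessThan_atLeast0 carrier_matD[OF assms(2)])
  finally show "(msum f m * A) $$ (a, b) = msum (\<lambda>i. f i * A) m $$ (a, b)"
    using ab by (simp add: msum_def)
qed (use assms in \<open>auto simp: msum_def\<close>)

lemma trace_msum:
  assumes "\<And>i. i < m \<Longrightarrow> f i \<in> M"
  shows "trace_mat (msum f m) = (\<Sum>i<m. trace_mat (f i))"
proof -
  have "trace_mat (msum f m) = (\<Sum>a<n. \<Sum>i<m. f i $$ (a, a))"
    by (simp add: msum_def trace_mat_def)
  also have "\<dots> = (\<Sum>i<m. \<Sum>a<n. f i $$ (a, a))" by (rule sum.swap)
  also have "\<dots> = (\<Sum>i<m. trace_mat (f i))"
    by (intro sum.cong) (auto simp: trace_mat_def carrier_matD[OF assms])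
  finally show ?thesis .
qed

lemma msum_shift:
  assumes "\<And>i. f (i + m) = f i"
  shows "msum (\<lambda>i. f (i + q)) m = msum f m"
  unfolding msum_def using sum_shift_periodic[of "\<lambda>i. f i $$ _" m q] assms by (intro eq_matI) auto

lemma msum_const: "A \<in> M \<Longrightarrow> msum (\<lambda>_. A) m = of_nat m \<cdot>\<^sub>m A"
  by (rule eq_matI) (auto simp: msum_def)

lemma msum_single:
  assumes "k < m" "f k \<in> M" "\<And>i. i < m \<Longrightarrow> i \<noteq> k \<Longrightarrow> f i = 0\<^sub>m n n"
  shows "msum f m = f k"
proof (rule eq_matI)
  fix a b assume "a < dim_row (f k)" "b < dim_col (f k)"
  then have ab: "a < n" "b < n" using assms(2) by auto
  have "(\<Sum>i<m. f i $$ (a, b)) = (\<Sum>i<m. if i = k then f k $$ (a, b) else 0)"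
    using assms(3) ab by (intro sum.cong) auto
  then show "msum f m $$ (a, b) = f k $$ (a, b)"
    using ab assms(1) by (simp add: msum_def)
qed (use assms in \<open>auto simp: msum_def\<close>)

text \<open>If \<open>x\<close> has \<open>m\<close>-th power 1 and \<open>m > 0\<close>, this is
  the projection onto the vectors fixed by \<open>x\<close>.\<close>

definition average :: "complex mat \<Rightarrow> nat \<Rightarrow> complex mat" where
  "average x m = (1 / of_nat m) \<cdot>\<^sub>m msum (\<lambda>i. x ^\<^sub>m i) m"

lemma average_M [simp]: "average x m \<in> M"
  by (simp add: average_def)

lemma average_fixed:
  assumes "x \<in> M" "x ^\<^sub>m m = 1\<^sub>m n"
  shows "x * average x m = average x m"
proof -
  have "x * average x m = (1 / of_nat m) \<cdot>\<^sub>m msum (\<lambda>i. x * x ^\<^sub>m i) m"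
    using assms by (simp add: average_def msum_left)
  also have "msum (\<lambda>i. x * x ^\<^sub>m i) m = msum (\<lambda>i. x ^\<^sub>m (i + 1)) m"
    using sq_pow_add[OF assms(1), of 1] assms by (intro msum_cong) (simp add: add.commute)
  also have "\<dots> = msum (\<lambda>i. x ^\<^sub>m i) m"
    using assms by (intro msum_shift) (simp add: sq_pow_add)
  finally show ?thesis by (simp add: average_def)
qed

lemma average_fixed_pow:
  assumes "x \<in> M" "x ^\<^sub>m m = 1\<^sub>m n"
  shows "x ^\<^sub>m i * average x m = average x m"
  using assms by (induction i) (auto simp: sq_assoc average_fixed)

lemma average_idempotent:
  assumes "x \<in> M" "x ^\<^sub>m m = 1\<^sub>m n" "m > 0"
  shows "average x m * average x m = average x m"
proof -
  have "average x m * average x m = (1 / of_nat m) \<cdot>\<^sub>m (msum (\<lambda>i. x ^\<^sub>m i) m * average x m)"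
    by (subst (1) average_def) simp
  also have "msum (\<lambda>i. x ^\<^sub>m i) m * average x m = msum (\<lambda>i. average x m) m"
    using assms by (simp add: msum_right average_fixed_pow)
  also have "\<dots> = of_nat m \<cdot>\<^sub>m average x m" by (simp add: msum_const)
  finally show ?thesis using assms(3) by simp
qed

lemma average_commute:
  assumes "x \<in> M" "w \<in> M" "w * x = x * w"
  shows "w * average x m = average x m * w"
proof -
  have "w * x ^\<^sub>m i = x ^\<^sub>m i * w" for i
    using assms by (induction i) (auto, metis pow_carrier_mat sq_assoc)
  then show ?thesis using assms by (simp add: average_def msum_left msum_right)
qed

end

section \<open>Irreducible sets and their projective centralizers\<close>

text \<open>Take \<open>x\<close> of maximal order, which exists because all orders divide
  \<open>N\<close>. If \<open>ord g\<close> did not divide \<open>ord x\<close>, multiplying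
  \<open>x\<close> by an element of prime order \<open>p\<close> not dividing \<open>ord x\<close>
  would give an element of larger order.\<close>

lemma (in comm_group) exists_exponent_element:
  fixes N :: nat
  assumes sqf: "squarefree N" "N > 0" and exp: "\<And>g. g \<in> carrier G \<Longrightarrow> g [^] N = \<one>"
  obtains x where "x \<in> carrier G" "ord x > 0" "\<And>g. g \<in> carrier G \<Longrightarrow> g [^] ord x = \<one>"
proof -
  have ord_dvd: "ord g dvd N" if "g \<in> carrier G" for g
    using exp[OF that] pow_eq_id[OF that] by simp
  have ord_le: "ord g \<le> N" if "g \<in> carrier G" for g
    using ord_dvd[OF that] sqf(2) by (auto intro: dvd_imp_le)
  have ord_pos: "ord g > 0" if "g \<in> carrier G" for g
    using ord_dvd[OF that] sqf(2) by (auto intro: Nat.gr0I)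
  obtain x where x: "x \<in> carrier G" "\<And>g. g \<in> carrier G \<Longrightarrow> ord g \<le> ord x"
    using Lattices_Big.ex_has_greatest_nat[of "\<lambda>g. g \<in> carrier G" \<one> ord "Suc N"] ord_le by (auto simp: less_Suc_eq_le)
  have "ord g dvd ord x" if g: "g \<in> carrier G" for g
  proof (rule ccontr)
    assume nd: "\<not> ord g dvd ord x"
    have sq: "squarefree (ord g)" using ord_dvd[OF g] sqf(1) squarefree_mono by blast
    \<comment> \<open>As \<open>ord g\<close> is squarefree, its prime factors all have multiplicity
      one, so its divisibility into \<open>ord x\<close> is decided by primes alone.\<close>
    have "\<exists>p. prime p \<and> p dvd ord g \<and> \<not> p dvd ord x"
    proof (rule ccontr)
      assume c: "\<nexists>p. prime p \<and> p dvd ord g \<and> \<not> p dvd ord x"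
      have "ord g dvd ord x"
      proof (rule multiplicity_le_imp_dvd)
        show "ord g \<noteq> 0" using ord_pos[OF g] by simp
        fix p :: nat assume p: "prime p"
        show "multiplicity p (ord g) \<le> multiplicity p (ord x)"
        proof (cases "p dvd ord g")
          case True
          then have "multiplicity p (ord g) = 1"
            using sq p ord_pos[OF g] squarefree_factorial_semiring'[of "ord g"]
            by (auto simp: in_prime_factors_iff)
          moreover have "multiplicity p (ord x) \<ge> 1"
            using True p c ord_pos[OF x(1)] by (metis less_one linorder_not_le multiplicity_eq_zero_iff not_gr_zero not_prime_unit)
          ultimately show ?thesis by simp
        next
          case False
          then show ?thesis by (simp add: not_dvd_imp_multiplicity_0)
        qed
      qed
      then show False using nd by simp
    qed
    then obtain p where p: "prime p" "p dvd ord g" "\<not> p dvd ord x" by blast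
    \<comment> \<open>An element of order \<open>p\<close>, as \<open>h_pow\<close> records.\<close>
    define h where "h = g [^] (ord g div p)"
    have h: "h \<in> carrier G" using g by (simp add: h_def)
    have h_pow: "h [^] j = \<one> \<longleftrightarrow> p dvd j" for j :: nat
    proof -
      obtain l where l: "ord g = p * l" using p(2) by auto
      have "l > 0" "p > 0" using ord_pos[OF g] l by auto
      then have "ord g dvd (ord g div p) * j \<longleftrightarrow> p dvd j" using l by (simp add: mult.commute)
      then show ?thesis using g by (simp add: h_def nat_pow_pow pow_eq_id)
    qed
    define K where "K = ord (x \<otimes> h)"
    have xh: "x \<otimes> h \<in> carrier G" using x h by simp
    have 1: "x [^] K \<otimes> h [^] K = \<one>"
      using pow_ord_eq_1[OF xh] nat_pow_distrib[OF x(1) h] unfolding K_def by metis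
    \<comment> \<open>The \<open>p\<close>-th power removes \<open>h\<close> from the relation and
      leaves one for \<open>x\<close> alone; \<open>p\<close> is then cancelled by
      coprimality.\<close>
    have "(x [^] K \<otimes> h [^] K) [^] p = \<one>" using 1 by simp
    then have "x [^] (K * p) \<otimes> h [^] (K * p) = \<one>"
      using x h by (simp add: nat_pow_distrib nat_pow_pow)
    moreover have "h [^] (K * p) = \<one>" using h_pow by simp
    ultimately have "x [^] (K * p) = \<one>" using x by simp
    then have "ord x dvd K * p" using x pow_eq_id by simp
    moreover have "coprime (ord x) p" using p prime_imp_coprime[of p "ord x"] by (simp add: coprime_commute)
    ultimately have xK: "ord x dvd K" using coprime_dvd_mult_left_iff by blast
    then have "x [^] K = \<one>" using x pow_eq_id by simp
    then have "h [^] K = \<one>" using 1 h by simp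
    then have "p dvd K" using h_pow by simp
    then have "ord x * p dvd K" using divides_mult[OF xK] \<open>coprime (ord x) p\<close> by blast
    moreover have "K > 0" using ord_pos xh K_def by simp
    ultimately have "ord x * p \<le> K" by (auto intro: dvd_imp_le)
    moreover have "ord x * p > ord x" using ord_pos[OF x(1)] prime_gt_1_nat[OF p(1)] by simp
    ultimately show False using x(2)[OF xh] K_def by simp
  qed
  then show ?thesis using that[of x] x ord_pos pow_eq_id by simp
qed

text \<open>Here \<open>k\<close> is the order of \<open>w\<close> modulo the powers of
  \<open>x\<close>. If \<open>w ^ k = x ^ l\<close> and \<open>m = ord x = k * r\<close>, then
  \<open>x ^ (l * r) = w ^ m = 1\<close>, so \<open>m\<close> divides \<open>l * r\<close> and
  \<open>k\<close> divides \<open>l\<close>. With \<open>s = l / k\<close> the element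
  \<open>w * x ^ (- s)\<close> has \<open>k\<close>-th power 1. The last conclusion says that its
  powers meet those of \<open>x\<close> trivially below \<open>k\<close>.\<close>

lemma (in comm_group) adjusted_root:
  assumes x: "x \<in> carrier G" and w: "w \<in> carrier G" and pos: "ord x > 0" and wm: "w [^] ord x = \<one>"
  obtains k i :: nat where "k > 0" "k dvd ord x" "(w \<otimes> x [^] i) [^] k = \<one>"
    "\<And>j l :: nat. w [^] j = x [^] l \<Longrightarrow> k dvd j"
proof -
  define m where "m = ord x"
  have xm: "x [^] m = \<one>" using x by (simp add: m_def)
  \<comment> \<open>Exponents are natural numbers, so \<open>(m - 1) * l\<close> plays the role of
    \<open>- l\<close>.\<close>
  have inv_pow: "x [^] l \<otimes> x [^] ((m - 1) * l) = \<one>" for l :: nat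
  proof -
    have "x [^] l \<otimes> x [^] ((m - 1) * l) = x [^] (m * l)"
      using x pos by (simp add: nat_pow_mult m_def) (metis Suc_pred mult_Suc)
    also have "\<dots> = \<one>" using x xm by (simp flip: nat_pow_pow)
    finally show ?thesis .
  qed
  define Q where "Q j \<longleftrightarrow> j > 0 \<and> (\<exists>l::nat. w [^] j = x [^] l)" for j :: nat
  define k where "k = (LEAST j. Q j)"
  have "Q m" unfolding Q_def using pos wm by (auto simp: m_def intro!: exI[of _ 0])
  then have Qk: "Q k" unfolding k_def by (rule LeastI)
  then obtain l where l: "w [^] k = x [^] (l :: nat)" and k0: "k > 0" by (auto simp: Q_def)
  have dvd: "k dvd j" if "w [^] j = x [^] t" for j t :: nat
  proof -
    define q where "q = j div k"
    have "w [^] j = w [^] (k * q) \<otimes> w [^] (j mod k)"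
      using w by (simp add: nat_pow_mult q_def)
    moreover have "w [^] (k * q) = x [^] (l * q)"
      using w x l by (simp flip: nat_pow_pow)
    ultimately have e: "x [^] t = x [^] (l * q) \<otimes> w [^] (j mod k)" using that by simp
    have "w [^] (j mod k) = (x [^] (l * q) \<otimes> x [^] ((m - 1) * (l * q))) \<otimes> w [^] (j mod k)"
      using inv_pow w by simp
    also have "\<dots> = x [^] ((m - 1) * (l * q)) \<otimes> x [^] t"
      unfolding e using x w by (simp add: m_ac)
    also have "\<dots> = x [^] ((m - 1) * (l * q) + t)" using x by (simp add: nat_pow_mult)
    finally have "\<exists>l::nat. w [^] (j mod k) = x [^] l" by blast
    then have "j mod k = 0"
      using not_less_Least[of "j mod k" Q, folded k_def] mod_less_divisor[OF k0, of j]
      unfolding Q_def by (metis neq0_conv)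
    then show ?thesis by auto
  qed
  have km: "k dvd m" using dvd[of m 0] wm by (simp add: m_def)
  then obtain r where r: "m = k * r" by auto
  have r0: "r > 0" using pos r by (auto simp: m_def intro: Nat.gr0I)
  have "x [^] (l * r) = w [^] (k * r)" using l x w by (simp flip: nat_pow_pow)
  also have "\<dots> = \<one>" using wm r by (simp add: m_def)
  finally have "m dvd l * r" using x pow_eq_id by (simp add: m_def)
  then have "k dvd l" using r r0 by simp
  then obtain s where s: "l = k * s" by auto
  have "(w \<otimes> x [^] ((m - 1) * s)) [^] k = w [^] k \<otimes> x [^] ((m - 1) * s * k)"
    using w x by (simp add: nat_pow_distrib nat_pow_pow)
  also have "(m - 1) * s * k = (m - 1) * l" using s by simp
  also have "w [^] k \<otimes> x [^] ((m - 1) * l) = \<one>" unfolding l by (rule inv_pow)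
  finally show ?thesis using that[of k "(m - 1) * s"] km k0 dvd by (simp add: m_def)
qed

section \<open>Commutation up to a scalar and Schur's lemma\<close>

context matrix_dim
begin

text \<open>For invertible \<open>a\<close> and \<open>b\<close> the scalar \<open>c\<close> is
  their group commutator. The rules below say that this pairing is multiplicative in each argument
  and blind to rescaling.\<close>

definition qcomm :: "complex \<Rightarrow> complex mat \<Rightarrow> complex mat \<Rightarrow> bool" where
  "qcomm c a b \<longleftrightarrow> a * b = c \<cdot>\<^sub>m (b * a)"

lemma GL_det: "A \<in> GL n \<Longrightarrow> det A \<noteq> 0"
  unfolding GL_def by blast

lemma qcomm_mult_right:
  assumes "qcomm c a b" "qcomm d a b'" "a \<in> M" "b \<in> M" "b' \<in> M"
  shows "qcomm (c * d) a (b * b')"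
proof -
  have "a * (b * b') = (a * b) * b'" using assms by (simp add: sq_assoc)
  also have "\<dots> = c \<cdot>\<^sub>m (b * (a * b'))" using assms by (simp add: qcomm_def sq_assoc)
  also have "\<dots> = (c * d) \<cdot>\<^sub>m (b * b' * a)" using assms by (simp add: qcomm_def sq_assoc)
  finally show ?thesis by (simp add: qcomm_def)
qed

lemma qcomm_mult_left:
  assumes "qcomm c a b" "qcomm d a' b" "a \<in> M" "a' \<in> M" "b \<in> M"
  shows "qcomm (c * d) (a * a') b"
proof -
  have "a * a' * b = a * (a' * b)" using assms by (simp add: sq_assoc)
  also have "\<dots> = d \<cdot>\<^sub>m (a * (b * a'))" using assms by (simp add: qcomm_def)
  also have "a * (b * a') = (a * b) * a'" using assms(3-5) by (simp add: sq_assoc)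
  also have "a * b = c \<cdot>\<^sub>m (b * a)" using assms by (simp add: qcomm_def)
  also have "d \<cdot>\<^sub>m (c \<cdot>\<^sub>m (b * a) * a') = (c * d) \<cdot>\<^sub>m (b * (a * a'))"
    using assms by (simp add: sq_assoc mult.commute)
  finally show ?thesis by (simp add: qcomm_def)
qed

lemma qcomm_one [simp]: "a \<in> M \<Longrightarrow> qcomm 1 a (1\<^sub>m n)" "a \<in> M \<Longrightarrow> qcomm 1 (1\<^sub>m n) a"
  by (auto simp: qcomm_def)

lemma qcomm_pow_right: "qcomm c a b \<Longrightarrow> a \<in> M \<Longrightarrow> b \<in> M \<Longrightarrow> qcomm (c ^ j) a (b ^\<^sub>m j)"
proof (induction j)
  case (Suc j)
  then show ?case using qcomm_mult_right[of "c ^ j" a "b ^\<^sub>m j" c b] by (simp add: mult.commute)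
qed simp

lemma qcomm_pow_left: "qcomm c a b \<Longrightarrow> a \<in> M \<Longrightarrow> b \<in> M \<Longrightarrow> qcomm (c ^ j) (a ^\<^sub>m j) b"
proof (induction j)
  case (Suc j)
  then show ?case using qcomm_mult_left[of "c ^ j" "a ^\<^sub>m j" b c a] by (simp add: mult.commute)
qed simp

lemma qcomm_smult_right: "qcomm c a b \<Longrightarrow> a \<in> M \<Longrightarrow> b \<in> M \<Longrightarrow> qcomm c a (d \<cdot>\<^sub>m b)"
  by (simp add: qcomm_def mult.commute)

lemma qcomm_smult_left: "qcomm c a b \<Longrightarrow> a \<in> M \<Longrightarrow> b \<in> M \<Longrightarrow> qcomm c (d \<cdot>\<^sub>m a) b"
  by (simp add: qcomm_def mult.commute)

lemma qcomm_unique: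
  assumes "qcomm c a b" "qcomm d a b" "a \<in> GL n" "b \<in> GL n"
  shows "c = d"
  using GL_smult_cancel[OF _ GL_mult[OF assms(4,3)]] assms(1,2) unfolding qcomm_def by metis

lemma qcomm_nonzero:
  assumes "qcomm c a b" "a \<in> GL n" "b \<in> GL n"
  shows "c \<noteq> 0"
  using GL_mult[OF assms(2,3)] assms(1) GL_smult_nonzero unfolding qcomm_def by metis

lemma qcomm_swap:
  assumes "qcomm c a b" "c \<noteq> 0" "a \<in> M" "b \<in> M"
  shows "qcomm (inverse c) b a"
  using assms by (simp add: qcomm_def)

lemma qcomm_inverse_left:
  assumes "qcomm c a b" "a \<in> GL n" "b \<in> GL n" "a' \<in> M" "a' * a = 1\<^sub>m n"
  shows "qcomm (inverse c) a' b"
proof -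
  have c: "c \<noteq> 0" using qcomm_nonzero assms by blast
  have a': "a * a' = 1\<^sub>m n" using mat_mult_left_right_inverse[of a' n a] assms by simp
  have "b * a' = a' * (a * b) * a'" using assms by (simp add: sq_assoc[symmetric])
  also have "\<dots> = c \<cdot>\<^sub>m (a' * b * (a * a'))"
    using assms(1-4) by (simp add: qcomm_def sq_assoc)
  finally have "b * a' = c \<cdot>\<^sub>m (a' * b)" using a' assms by simp
  then show ?thesis using c by (simp add: qcomm_def)
qed

lemma qcomm_pow_eq_one:
  assumes "qcomm c a b" "a \<in> GL n" "b \<in> GL n" "a ^\<^sub>m k = d \<cdot>\<^sub>m 1\<^sub>m n"
  shows "c ^ k = 1"
proof -
  have "qcomm (c ^ k) (a ^\<^sub>m k) b" using qcomm_pow_left assms(1-3) by simp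
  moreover have "qcomm 1 (a ^\<^sub>m k) b" using assms(3,4) by (simp add: qcomm_def)
  ultimately show ?thesis using qcomm_unique GL_pow assms by blast
qed

text \<open>Over the complex numbers \<open>A\<close> has an eigenvalue; its eigenspace is nonzero
  and invariant under everything commuting with \<open>A\<close>, hence the whole space.\<close>

lemma schur:
  assumes irr: "irreducible_SL n H" and H: "H \<subseteq> M" and A: "A \<in> M"
    and comm: "\<And>h. h \<in> H \<Longrightarrow> A * h = h * A"
  obtains c where "A = c \<cdot>\<^sub>m 1\<^sub>m n"
proof -
  obtain k v where v: "v \<in> carrier_vec n" "v \<noteq> 0\<^sub>v n" "A *\<^sub>v v = k \<cdot>\<^sub>v v"
    using spectrum_non_empty[OF A n_pos] A
    by (auto simp: spectrum_def eigenvalue_def eigenvector_def)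
  define W where "W = {w \<in> carrier_vec n. A *\<^sub>v w = k \<cdot>\<^sub>v w}"
  have "is_subspace n W"
    unfolding is_subspace_def W_def using A
    by (auto simp: mult_add_distrib_mat_vec[of A n n] smult_add_distrib_vec mult_mat_vec[of A n n]
        smult_smult_assoc mult.commute)
  moreover have "h *\<^sub>v w \<in> W" if h: "h \<in> H" and w: "w \<in> W" for h w
  proof -
    have hM: "h \<in> M" and wM: "w \<in> carrier_vec n" using h w H by (auto simp: W_def)
    have "A *\<^sub>v (h *\<^sub>v w) = (A * h) *\<^sub>v w" using A hM wM by (simp add: assoc_mult_mat_vec[of A n n h n])
    also have "\<dots> = h *\<^sub>v (A *\<^sub>v w)" using A hM wM comm[OF h] by (simp add: assoc_mult_mat_vec[of h n n A n])
    also have "\<dots> = k \<cdot>\<^sub>v (h *\<^sub>v w)" using w hM wM by (simp add: W_def mult_mat_vec[of h n n])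
    finally show ?thesis using hM wM by (simp add: W_def)
  qed
  ultimately have "W = {0\<^sub>v n} \<or> W = carrier_vec n" using irr unfolding irreducible_SL_def by blast
  moreover have "v \<in> W" using v by (simp add: W_def)
  ultimately have W: "W = carrier_vec n" using v by auto
  have "A = k \<cdot>\<^sub>m 1\<^sub>m n"
  proof (rule eq_matI)
    fix i j assume "i < dim_row (k \<cdot>\<^sub>m 1\<^sub>m n)" "j < dim_col (k \<cdot>\<^sub>m 1\<^sub>m n)"
    then have ij: "i < n" "j < n" by auto
    have "unit_vec n j \<in> W" unfolding W by simp
    then have "(A *\<^sub>v unit_vec n j) $ i = (k \<cdot>\<^sub>v unit_vec n j) $ i" by (simp add: W_def)
    moreover have "(A *\<^sub>v unit_vec n j) $ i = A $$ (i, j)" using ij A by simp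
    ultimately show "A $$ (i, j) = (k \<cdot>\<^sub>m 1\<^sub>m n) $$ (i, j)" using ij by simp
  qed (use A in auto)
  then show ?thesis using that by blast
qed

lemma proj_class_eq_one: "A \<in> GL n \<Longrightarrow> proj_class n A = \<one>\<^bsub>PSL n\<^esub> \<longleftrightarrow> (\<exists>c. A = c \<cdot>\<^sub>m 1\<^sub>m n)"
  by (simp add: one_PSL proj_class_eq_iff)

lemma subgroup_centralizer_PSL:
  assumes "S \<subseteq> carrier (PSL n)"
  shows "subgroup (centralizer (PSL n) S) (PSL n)"
proof -
  interpret group "PSL n" by (rule group_PSL)
  show ?thesis
  proof (rule subgroupI)
    show "centralizer (PSL n) S \<noteq> {}" using assms by (auto simp: centralizer_def intro!: exI[of _ "\<one>\<^bsub>PSL n\<^esub>"])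
  next
    fix a assume a: "a \<in> centralizer (PSL n) S"
    then have ac: "a \<in> carrier (PSL n)" by (simp add: centralizer_def)
    have "inv\<^bsub>PSL n\<^esub> a \<otimes>\<^bsub>PSL n\<^esub> y = y \<otimes>\<^bsub>PSL n\<^esub> inv\<^bsub>PSL n\<^esub> a" if y: "y \<in> S" for y
    proof -
      have yc: "y \<in> carrier (PSL n)" using y assms by blast
      have "a \<otimes>\<^bsub>PSL n\<^esub> y = y \<otimes>\<^bsub>PSL n\<^esub> a" using a y by (auto simp: centralizer_def)
      then show ?thesis using ac yc by (metis inv_closed inv_solve_left inv_solve_right m_assoc m_closed)
    qed
    then show "inv\<^bsub>PSL n\<^esub> a \<in> centralizer (PSL n) S" using ac by (simp add: centralizer_def)
  next
    fix a b assume ab: "a \<in> centralizer (PSL n) S" "b \<in> centralizer (PSL n) S"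
    have "a \<otimes>\<^bsub>PSL n\<^esub> b \<otimes>\<^bsub>PSL n\<^esub> y = y \<otimes>\<^bsub>PSL n\<^esub> (a \<otimes>\<^bsub>PSL n\<^esub> b)" if y: "y \<in> S" for y
    proof -
      have c: "y \<in> carrier (PSL n)" "a \<in> carrier (PSL n)" "b \<in> carrier (PSL n)"
        using y ab assms by (auto simp: centralizer_def)
      have "a \<otimes>\<^bsub>PSL n\<^esub> y = y \<otimes>\<^bsub>PSL n\<^esub> a" "b \<otimes>\<^bsub>PSL n\<^esub> y = y \<otimes>\<^bsub>PSL n\<^esub> b"
        using ab y by (auto simp: centralizer_def)
      then show ?thesis using c by (metis m_assoc)
    qed
    then show "a \<otimes>\<^bsub>PSL n\<^esub> b \<in> centralizer (PSL n) S" using ab by (simp add: centralizer_def)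
  qed (auto simp: centralizer_def)
qed

end

text \<open>\<open>H\<close> is only a set of matrices, so the locale serves both for the preimage
  of a subgroup and for the hand-made irreducible sets of the counterexample.\<close>

locale irreducible_set = matrix_dim +
  fixes H :: "complex mat set"
  assumes H_GL: "H \<subseteq> GL n" and irreducible: "irreducible_SL n H"
begin

abbreviation U :: "complex mat set" where "U \<equiv> proj_centralizer n H"

lemma U_GL [simp]: "u \<in> U \<Longrightarrow> u \<in> GL n"
  by (simp add: proj_centralizer_def)

lemma U_qcomm: "u \<in> U \<Longrightarrow> h \<in> H \<Longrightarrow> \<exists>c. qcomm c u h"
  unfolding proj_centralizer_def qcomm_def by blast

lemma U_I: "u \<in> GL n \<Longrightarrow> (\<And>h. h \<in> H \<Longrightarrow> \<exists>c. qcomm c u h) \<Longrightarrow> u \<in> U"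
  unfolding proj_centralizer_def qcomm_def by blast

lemma H_in_GL [simp]: "h \<in> H \<Longrightarrow> h \<in> GL n"
  using H_GL by blast

lemma U_mult [simp]:
  assumes "u \<in> U" "v \<in> U"
  shows "u * v \<in> U"
proof (rule U_I)
  fix h assume h: "h \<in> H"
  then obtain c d where "qcomm c u h" "qcomm d v h" using assms U_qcomm by blast
  then have "qcomm (c * d) (u * v) h" using qcomm_mult_left assms h by simp
  then show "\<exists>c. qcomm c (u * v) h" by blast
qed (use assms in simp)

lemma U_smult [simp]:
  assumes "u \<in> U" "c \<noteq> 0"
  shows "c \<cdot>\<^sub>m u \<in> U"
proof (rule U_I)
  fix h assume h: "h \<in> H"
  then obtain d where "qcomm d u h" using assms U_qcomm by blast
  then have "qcomm d (c \<cdot>\<^sub>m u) h" using qcomm_smult_left assms h by simp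
  then show "\<exists>d. qcomm d (c \<cdot>\<^sub>m u) h" by blast
qed (use assms in simp)

lemma U_one [simp]: "1\<^sub>m n \<in> U"
proof (rule U_I)
  fix h assume h: "h \<in> H"
  then have "qcomm 1 (1\<^sub>m n) h" by simp
  then show "\<exists>c. qcomm c (1\<^sub>m n) h" by blast
qed simp

lemma U_pow [simp]: "u \<in> U \<Longrightarrow> u ^\<^sub>m k \<in> U"
  using carrier_matD[OF GL_M[OF U_GL[of u]]] by (induction k) auto

lemma U_inverse:
  assumes "u \<in> U"
  obtains v where "v \<in> U" "u * v = 1\<^sub>m n" "v * u = 1\<^sub>m n"
proof -
  obtain v where v: "v \<in> GL n" "u * v = 1\<^sub>m n" "v * u = 1\<^sub>m n" using GL_inverse U_GL assms by blast
  have "v \<in> U"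
  proof (rule U_I)
    fix h assume h: "h \<in> H"
    then obtain c where "qcomm c u h" using U_qcomm assms by blast
    then have "qcomm (inverse c) v h" using qcomm_inverse_left[of c u h v] assms v h by simp
    then show "\<exists>c. qcomm c v h" by blast
  qed (use v in simp)
  then show ?thesis using that v by blast
qed

lemma commuting_scalar:
  assumes "A \<in> M" "\<And>h. h \<in> H \<Longrightarrow> qcomm 1 A h"
  shows "\<exists>c. A = c \<cdot>\<^sub>m 1\<^sub>m n"
proof -
  have "H \<subseteq> M" using H_GL GL_M by blast
  then show ?thesis using schur[OF irreducible _ assms(1)] assms(2) by (metis one_smult_mat qcomm_def)
qed

text \<open>Determinants of \<open>u * h = c h u\<close> give \<open>c ^ n = 1\<close>, so the
  \<open>n\<close>-th power of \<open>u\<close> commutes with all of \<open>H\<close> and Schur's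
  lemma applies.\<close>

lemma U_pow_scalar:
  assumes "u \<in> U"
  shows "\<exists>c. u ^\<^sub>m n = c \<cdot>\<^sub>m 1\<^sub>m n"
proof (rule commuting_scalar)
  fix h assume h: "h \<in> H"
  then obtain c where c: "qcomm c u h" using U_qcomm assms by blast
  have ne: "u \<in> GL n" "h \<in> GL n" using assms h by simp_all
  have "det u * det h = det (u * h)" using ne by (simp add: det_mult[of _ n])
  also have "\<dots> = c ^ n * det (h * u)"
    using c ne carrier_matD[OF GL_M[OF ne(1)]] unfolding qcomm_def by simp
  also have "det (h * u) = det h * det u" using ne by (simp add: det_mult[of _ n])
  finally have "c ^ n = 1" using GL_det ne by simp
  then show "qcomm 1 (u ^\<^sub>m n) h" using qcomm_pow_left[OF c, of n] assms h by simp
qed (use assms in simp)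

text \<open>The scalars of \<open>u * v\<close> and of \<open>v * u\<close> against each
  \<open>h\<close> are the same product, so \<open>(v * u)\<close> inverse times
  \<open>u * v\<close> commutes with \<open>H\<close> and is a scalar.\<close>

lemma U_commutator:
  assumes u: "u \<in> U" and v: "v \<in> U"
  shows "\<exists>c. qcomm c u v"
proof -
  obtain z where z: "z \<in> U" "z * (v * u) = 1\<^sub>m n" "v * u * z = 1\<^sub>m n"
    using U_inverse[of "v * u"] u v by auto
  have "\<exists>c. z * (u * v) = c \<cdot>\<^sub>m 1\<^sub>m n"
  proof (rule commuting_scalar)
    fix h assume h: "h \<in> H"
    obtain c d where cd: "qcomm c u h" "qcomm d v h" using U_qcomm u v h by blast
    then have uv: "qcomm (c * d) (u * v) h" and vu: "qcomm (d * c) (v * u) h"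
      using u v h by (auto intro: qcomm_mult_left)
    have "qcomm (inverse (d * c)) z h" using qcomm_inverse_left[OF vu] u v h z by simp
    then have "qcomm (inverse (d * c) * (c * d)) (z * (u * v)) h"
      using qcomm_mult_left uv z u v h by simp
    moreover have "c * d \<noteq> 0" using qcomm_nonzero[OF uv] u v h by simp
    ultimately show "qcomm 1 (z * (u * v)) h" by (metis left_inverse mult.commute)
  qed (use u v z in simp)
  then obtain c where c: "z * (u * v) = c \<cdot>\<^sub>m 1\<^sub>m n" by blast
  have "u * v = (v * u * z) * (u * v)" using z u v by simp
  also have "\<dots> = (v * u) * (z * (u * v))" using z u v by (intro sq_assoc) auto
  also have "\<dots> = c \<cdot>\<^sub>m (v * u)" using c u v by simp
  finally show ?thesis by (auto simp: qcomm_def)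
qed

lemma U_trace:
  assumes u: "u \<in> U" and ns: "\<nexists>c. u = c \<cdot>\<^sub>m 1\<^sub>m n"
  shows "trace_mat u = 0"
proof -
  obtain h where h: "h \<in> H" "\<not> qcomm 1 u h" using commuting_scalar[of u] u ns by auto
  obtain c where c: "qcomm c u h" using U_qcomm u h by blast
  then have "c \<noteq> 1" using h by auto
  obtain k where k: "k \<in> GL n" "h * k = 1\<^sub>m n" using GL_inverse H_in_GL h by blast
  have "u = u * h * k" using u h k by (simp add: sq_assoc)
  also have "\<dots> = c \<cdot>\<^sub>m (h * u * k)" using c u h k by (simp add: qcomm_def)
  finally have "trace_mat u = c * trace_mat (h * u * k)"
    by (metis GL_M H_in_GL U_GL h(1) k(1) sq_mult trace_mat_smult u)
  also have "h * u * k = h * (u * k)" using u h k by (simp add: sq_assoc)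
  also have "trace_mat (h * (u * k)) = trace_mat (u * k * h)"
    using u h k by (intro trace_mat_mult_commute[of _ n n]) auto
  also have "u * k * h = u"
    using mat_mult_left_right_inverse[of h n k] u h k by (simp add: sq_assoc)
  finally show ?thesis using \<open>c \<noteq> 1\<close> by simp
qed

abbreviation PU :: "complex mat set monoid" where
  "PU \<equiv> (PSL n)\<lparr>carrier := proj_class n ` U\<rparr>"

lemma subgroup_PU: "subgroup (proj_class n ` U) (PSL n)"
proof -
  interpret group "PSL n" by (rule group_PSL)
  show ?thesis
  proof (rule subgroupI)
    fix a assume "a \<in> proj_class n ` U"
    then obtain u where u: "u \<in> U" "a = proj_class n u" by blast
    obtain v where "v \<in> U" "u * v = 1\<^sub>m n" using U_inverse u by blast
    then show "inv\<^bsub>PSL n\<^esub> a \<in> proj_class n ` U" using inv_PSL[of u v] u by auto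
  next
    fix a b assume "a \<in> proj_class n ` U" "b \<in> proj_class n ` U"
    then show "a \<otimes>\<^bsub>PSL n\<^esub> b \<in> proj_class n ` U"
      using mult_PSL U_mult by auto
  next
    show "proj_class n ` U \<noteq> {}" using U_one by blast
  qed auto
qed

lemma comm_group_PU: "comm_group PU"
proof -
  interpret group "PSL n" by (rule group_PSL)
  interpret G: group PU using subgroup_PU by (rule subgroup_imp_group)
  show ?thesis
  proof (rule G.group_comm_groupI)
    fix a b assume "a \<in> carrier PU" "b \<in> carrier PU"
    then obtain u v where "u \<in> U" "v \<in> U" "a = proj_class n u" "b = proj_class n v" by auto
    then show "a \<otimes>\<^bsub>PU\<^esub> b = b \<otimes>\<^bsub>PU\<^esub> a"
      using commute_PSL[of u v] U_commutator[of u v] by (simp add: qcomm_def)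
  qed
qed

lemma pow_PU: "u \<in> U \<Longrightarrow> proj_class n u [^]\<^bsub>PU\<^esub> (k :: nat) = proj_class n (u ^\<^sub>m k)"
  using carrier_matD[OF GL_M[OF U_GL[of u]]] by (induction k) (simp_all add: one_PSL mult_PSL)

lemma mult_PU: "u \<in> U \<Longrightarrow> v \<in> U \<Longrightarrow> proj_class n u \<otimes>\<^bsub>PU\<^esub> proj_class n v = proj_class n (u * v)"
  by (simp add: mult_PSL)

lemma one_PU: "u \<in> U \<Longrightarrow> proj_class n u = \<one>\<^bsub>PU\<^esub> \<longleftrightarrow> (\<exists>c. u = c \<cdot>\<^sub>m 1\<^sub>m n)"
  by (simp add: proj_class_eq_one)

text \<open>The product of the two averages is an idempotent of trace \<open>n / (m * k)\<close>.\<close>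

lemma commuting_orders_dvd:
  assumes xw: "x \<in> U" "w \<in> U" "w * x = x * w" and x: "x ^\<^sub>m m = 1\<^sub>m n" "m > 0" and w: "w ^\<^sub>m k = 1\<^sub>m n" "k > 0"
    and ind: "\<And>i j. i < m \<Longrightarrow> j < k \<Longrightarrow> \<exists>c. x ^\<^sub>m i * w ^\<^sub>m j = c \<cdot>\<^sub>m 1\<^sub>m n \<Longrightarrow> i = 0 \<and> j = 0"
  shows "m * k dvd n"
proof -
  define E where "E = average x m"
  define F where "F = average w k"
  have M: "x \<in> M" "w \<in> M" "E \<in> M" "F \<in> M" using xw by (auto simp: E_def F_def)
  have wE: "w * E = E * w" unfolding E_def using M xw by (intro average_commute) auto
  have FE: "E * F = F * E" unfolding F_def using M wE by (intro average_commute) auto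
  have EE: "E * E = E" and FF: "F * F = F"
    unfolding E_def F_def using M x w by (auto intro: average_idempotent)
  have "E * F * (E * F) = E * (F * E) * F" using M by (simp add: sq_assoc)
  also have "\<dots> = E * E * (F * F)" unfolding FE[symmetric] using M by (simp add: sq_assoc)
  finally have "E * F * (E * F) = E * F" unfolding EE FF .
  then obtain r where r: "trace_mat (E * F) = of_nat r"
    using idempotent_trace[of "E * F" n] M by auto
  have "E * F = (1 / of_nat m) \<cdot>\<^sub>m (msum (\<lambda>i. x ^\<^sub>m i) m * F)"
    unfolding E_def average_def using M by simp
  also have "msum (\<lambda>i. x ^\<^sub>m i) m * F = msum (\<lambda>i. x ^\<^sub>m i * F) m"
    using M by (simp add: msum_right)
  also have "\<dots> = msum (\<lambda>i. (1 / of_nat k) \<cdot>\<^sub>m msum (\<lambda>j. x ^\<^sub>m i * w ^\<^sub>m j) k) m"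
    unfolding F_def average_def using M by (intro msum_cong) (simp add: msum_left)
  finally have "trace_mat (E * F) = (1 / of_nat m) * (\<Sum>i<m. (1 / of_nat k) * (\<Sum>j<k. trace_mat (x ^\<^sub>m i * w ^\<^sub>m j)))"
    using M by (simp add: trace_msum trace_mat_smult[OF msum_M] trace_mat_smult[of _ n])
  \<comment> \<open>By \<open>ind\<close> every product other than the identity is non-scalar, hence
    traceless by \<open>U_trace\<close>.\<close>
  also have "(\<Sum>i<m. (1 / of_nat k) * (\<Sum>j<k. trace_mat (x ^\<^sub>m i * w ^\<^sub>m j)))
      = (\<Sum>i<m. (1 / of_nat k) * (\<Sum>j<k. if i = 0 \<and> j = 0 then of_nat n else 0))"
  proof (intro sum.cong refl arg_cong[where f = "(*) _"])
    fix i j assume "i \<in> {..<m}" "j \<in> {..<k}"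
    then have ij: "i < m" "j < k" by auto
    show "trace_mat (x ^\<^sub>m i * w ^\<^sub>m j) = (if i = 0 \<and> j = 0 then of_nat n else 0)"
    proof (cases "i = 0 \<and> j = 0")
      case True
      then show ?thesis using M by simp
    next
      case False
      then show ?thesis using U_trace[of "x ^\<^sub>m i * w ^\<^sub>m j"] ind[OF ij] xw by auto
    qed
  qed
  also have "\<dots> = (\<Sum>i<m. if i = 0 then of_nat n / of_nat k else 0)"
    using w(2) by (intro sum.cong refl) auto
  also have "\<dots> = of_nat n / of_nat k" using x(2) by simp
  finally have "of_nat r * (of_nat m * of_nat k) = (of_nat n :: complex)"
    unfolding r using x(2) w(2) by (simp add: field_simps)
  then have "r * (m * k) = n" by (metis of_nat_eq_iff of_nat_mult)
  then show ?thesis by (metis dvd_triv_right)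
qed

end

section \<open>Normal pairs and their uniqueness\<close>

text \<open>One coherent choice of primitive roots: \<open>unity_root_mult\<close> links the root of
  order \<open>q * k\<close> to the root of order \<open>k\<close>, so commutators with
  \<open>y\<close> can be read as powers of an eigenvalue of \<open>x\<close>.\<close>

definition unity_root :: "nat \<Rightarrow> complex" where
  "unity_root m = cis (2 * pi / real m)"

lemma unity_root_pow: "unity_root m ^ j = cis (2 * pi * real j / real m)"
  by (simp add: unity_root_def DeMoivre mult_ac)

lemma unity_root_nonzero [simp]: "unity_root m \<noteq> 0"
  by (simp add: unity_root_def)

lemma unity_root_order [simp]: "m > 0 \<Longrightarrow> unity_root m ^ m = 1"
  by (simp add: unity_root_pow cis_2pi)

lemma unity_root_inj:
  assumes "unity_root m ^ i = unity_root m ^ j" "i < m" "j < m"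
  shows "i = j"
proof -
  have "inj_on (\<lambda>k. cis (2 * pi * real k / real m)) {..<m}"
    using bij_betw_roots_unity[of m] assms by (auto simp: bij_betw_def)
  then show ?thesis using assms by (auto simp: unity_root_pow inj_on_def)
qed

lemma unity_root_surj:
  assumes "c ^ m = 1" "m > 0"
  obtains t where "t < m" "c = unity_root m ^ t"
proof -
  have "c \<in> (\<lambda>k. cis (2 * pi * real k / real m)) ` {..<m}"
    using bij_betw_roots_unity[of m] assms by (auto simp: bij_betw_def)
  then show ?thesis using that by (auto simp: unity_root_pow)
qed

lemma unity_root_mod: "m > 0 \<Longrightarrow> unity_root m ^ (j mod m) = unity_root m ^ j"
  by (metis div_mult_mod_eq mult.commute mult_1 power_add power_mult power_one unity_root_order)

lemma unity_root_eq_one: "m > 0 \<Longrightarrow> unity_root m ^ j = 1 \<longleftrightarrow> m dvd j"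
proof
  assume m: "m > 0" and "unity_root m ^ j = 1"
  then have "unity_root m ^ (j mod m) = unity_root m ^ 0" by (simp add: unity_root_mod)
  then have "j mod m = 0" using m by (intro unity_root_inj) auto
  then show "m dvd j" by auto
qed (auto simp: power_mult)

lemma unity_root_mult: "q > 0 \<Longrightarrow> unity_root (q * k) ^ q = unity_root k"
  by (simp add: unity_root_pow) (simp add: unity_root_def)

lemma iso_pow_eq_one:
  assumes f: "f \<in> iso G K" and G: "group G" and K: "group K"
    and exp: "\<And>h. h \<in> carrier K \<Longrightarrow> h [^]\<^bsub>K\<^esub> (m :: nat) = \<one>\<^bsub>K\<^esub>" and x: "x \<in> carrier G"
  shows "x [^]\<^bsub>G\<^esub> m = \<one>\<^bsub>G\<^esub>"
proof -
  interpret G: group G by fact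
  interpret K: group K by fact
  interpret group_hom G K f using f G K by (simp add: group_hom_def group_hom_axioms_def iso_def)
  have "f (x [^]\<^bsub>G\<^esub> m) = f \<one>\<^bsub>G\<^esub>" using exp x by (simp add: hom_nat_pow)
  moreover have "inj_on f (carrier G)" using f by (simp add: iso_def bij_betw_def)
  ultimately show ?thesis using x G.nat_pow_closed G.one_closed inj_onD[of f "carrier G" "x [^]\<^bsub>G\<^esub> m" "\<one>\<^bsub>G\<^esub>"] by blast
qed

section \<open>Normal pairs, eigenprojections and simultaneous conjugacy\<close>

context matrix_dim
begin

text \<open>The standard form of the two generators. The condition on scalar powers gives the class
  of \<open>x\<close> order exactly \<open>m\<close>; the trace condition gives all eigenspaces of
  \<open>x\<close> dimension \<open>n / m\<close>. Neither mentions the irreducible set, so pairs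
  from different centralizers can be compared.\<close>

definition normal_pair :: "nat \<Rightarrow> nat \<Rightarrow> complex mat \<Rightarrow> complex mat \<Rightarrow> bool" where
  "normal_pair m k x y \<longleftrightarrow> x \<in> GL n \<and> y \<in> GL n \<and> m > 0 \<and> k > 0 \<and> k dvd m \<and>
     x ^\<^sub>m m = 1\<^sub>m n \<and> y ^\<^sub>m k = 1\<^sub>m n \<and> qcomm (unity_root k) x y \<and>
     (\<forall>i. (\<exists>c. x ^\<^sub>m i = c \<cdot>\<^sub>m 1\<^sub>m n) \<longrightarrow> m dvd i) \<and>
     (\<forall>i. 0 < i \<and> i < m \<longrightarrow> trace_mat (x ^\<^sub>m i) = 0)"

definition pair_classes :: "nat \<Rightarrow> nat \<Rightarrow> complex mat \<Rightarrow> complex mat \<Rightarrow> complex mat set set" where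
  "pair_classes m k x y = (\<lambda>(i, j). proj_class n (x ^\<^sub>m i * y ^\<^sub>m j)) ` ({..<m} \<times> {..<k})"

lemma scalar_power_diff:
  assumes x: "x \<in> GL n" and eq: "x ^\<^sub>m i = c \<cdot>\<^sub>m x ^\<^sub>m j" and ij: "i \<le> j"
  shows "\<exists>d. x ^\<^sub>m (j - i) = d \<cdot>\<^sub>m 1\<^sub>m n"
proof -
  have c: "c \<noteq> 0" using GL_smult_nonzero[of c "x ^\<^sub>m j"] GL_pow[OF x, of i] unfolding eq by simp
  have "x ^\<^sub>m i * 1\<^sub>m n = x ^\<^sub>m i" using x by simp
  also have "\<dots> = c \<cdot>\<^sub>m (x ^\<^sub>m i * x ^\<^sub>m (j - i))"
    using eq ij x sq_pow_add[of x i "j - i"] by simp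
  also have "\<dots> = x ^\<^sub>m i * (c \<cdot>\<^sub>m x ^\<^sub>m (j - i))" using x by simp
  finally have "1\<^sub>m n = c \<cdot>\<^sub>m x ^\<^sub>m (j - i)" by (rule GL_cancel_left) (use x in auto)
  then have "inverse c \<cdot>\<^sub>m 1\<^sub>m n = inverse c \<cdot>\<^sub>m (c \<cdot>\<^sub>m x ^\<^sub>m (j - i))" by simp
  also have "\<dots> = x ^\<^sub>m (j - i)" using c by simp
  finally show ?thesis by metis
qed

text \<open>The commutator of a product with \<open>x\<close> recovers \<open>j\<close>; cancelling
  the power of \<open>y\<close> leaves proportional powers of \<open>x\<close>, which determine
  \<open>i\<close> below \<open>m\<close>.\<close>

lemma card_pair_classes:
  assumes "normal_pair m k x y"
  shows "card (pair_classes m k x y) = m * k"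
proof -
  have x: "x \<in> GL n" and y: "y \<in> GL n" and k: "k > 0" and q: "qcomm (unity_root k) x y"
    and ord: "\<And>i c. x ^\<^sub>m i = c \<cdot>\<^sub>m 1\<^sub>m n \<Longrightarrow> m dvd i"
    using assms unfolding normal_pair_def by blast+
  have "inj_on (\<lambda>(i, j). proj_class n (x ^\<^sub>m i * y ^\<^sub>m j)) ({..<m} \<times> {..<k})"
  proof (rule inj_onI, safe)
    fix i j i' j'
    assume lt: "i < m" "j < k" "i' < m" "j' < k"
      and "proj_class n (x ^\<^sub>m i * y ^\<^sub>m j) = proj_class n (x ^\<^sub>m i' * y ^\<^sub>m j')"
    then obtain c where c: "x ^\<^sub>m i * y ^\<^sub>m j = c \<cdot>\<^sub>m (x ^\<^sub>m i' * y ^\<^sub>m j')"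
      using x y by (auto simp: proj_class_eq_iff)
    have qx: "qcomm (unity_root k ^ b) x (x ^\<^sub>m a * y ^\<^sub>m b)" for a b
    proof -
      have "qcomm (1 ^ a) x (x ^\<^sub>m a)" by (rule qcomm_pow_right) (use x in \<open>auto simp: qcomm_def\<close>)
      moreover have "qcomm (unity_root k ^ b) x (y ^\<^sub>m b)" by (rule qcomm_pow_right) (use q x y in auto)
      ultimately have "qcomm (1 ^ a * unity_root k ^ b) x (x ^\<^sub>m a * y ^\<^sub>m b)"
        by (rule qcomm_mult_right) (use x y in auto)
      then show ?thesis by simp
    qed
    have "qcomm (unity_root k ^ j') x (x ^\<^sub>m i * y ^\<^sub>m j)"
      unfolding c by (rule qcomm_smult_right[OF qx]) (use x y in auto)
    then have "unity_root k ^ j' = unity_root k ^ j"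
      by (rule qcomm_unique[OF _ qx]) (use x y in auto)
    then have j: "j = j'" using unity_root_inj lt by metis
    have "x ^\<^sub>m i * y ^\<^sub>m j = (c \<cdot>\<^sub>m x ^\<^sub>m i') * y ^\<^sub>m j" using c j x y by simp
    then have e: "x ^\<^sub>m i = c \<cdot>\<^sub>m x ^\<^sub>m i'" by (rule GL_cancel_right) (use x y in auto)
    have c0: "c \<noteq> 0" using GL_smult_nonzero[of c "x ^\<^sub>m i'"] GL_pow[OF x, of i] unfolding e by simp
    have e': "x ^\<^sub>m i' = inverse c \<cdot>\<^sub>m x ^\<^sub>m i" unfolding e using c0 by simp
    have "i = i'"
    proof (cases "i \<le> i'")
      case True
      then have "m dvd i' - i" using scalar_power_diff[OF x e] ord by blast
      then show ?thesis using lt True by (auto dest!: dvd_imp_le)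
    next
      case False
      then have "m dvd i - i'" using scalar_power_diff[OF x e'] ord by force
      then show ?thesis using lt False by (auto dest!: dvd_imp_le)
    qed
    then show "i = i' " "j = j'" using j by auto
  qed
  then show ?thesis by (simp add: pair_classes_def card_image)
qed

text \<open>For \<open>x\<close> with \<open>m\<close>-th power 1, the projection onto the
  eigenspace for \<open>unity_root m ^ e\<close>: these are the vectors fixed by the rescaled
  matrix. The index is any natural number and matters only modulo \<open>m\<close>.\<close>

definition eigenprojection :: "nat \<Rightarrow> complex mat \<Rightarrow> nat \<Rightarrow> complex mat" where
  "eigenprojection m x e = average (inverse (unity_root m) ^ e \<cdot>\<^sub>m x) m"

lemma eigenprojection_M [simp]: "eigenprojection m x e \<in> M"
  by (simp add: eigenprojection_def)

lemma eigenprojection_props: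
  assumes x: "x \<in> M" "x ^\<^sub>m m = 1\<^sub>m n" and m: "m > 0"
  shows "x * eigenprojection m x e = unity_root m ^ e \<cdot>\<^sub>m eigenprojection m x e"
    and "eigenprojection m x e * x = unity_root m ^ e \<cdot>\<^sub>m eigenprojection m x e"
    and "eigenprojection m x e * eigenprojection m x e = eigenprojection m x e"
    and "eigenprojection m x (e + m) = eigenprojection m x e"
proof -
  define c where "c = inverse (unity_root m) ^ e"
  have c: "unity_root m ^ e * c = 1" by (simp add: c_def power_inverse)
  have cm: "c ^ m = 1"
    by (metis c_def m mult.commute power_inverse power_mult power_one unity_root_order inverse_1)
  have M: "c \<cdot>\<^sub>m x \<in> M" and pow: "(c \<cdot>\<^sub>m x) ^\<^sub>m m = 1\<^sub>m n" using x cm by (auto simp: sq_pow_smult)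
  have P: "eigenprojection m x e = average (c \<cdot>\<^sub>m x) m" by (simp add: eigenprojection_def c_def)
  have "c \<cdot>\<^sub>m (x * eigenprojection m x e) = eigenprojection m x e"
    unfolding P using average_fixed[OF M pow] x by simp
  then have "unity_root m ^ e \<cdot>\<^sub>m (c \<cdot>\<^sub>m (x * eigenprojection m x e)) = unity_root m ^ e \<cdot>\<^sub>m eigenprojection m x e"
    by simp
  then show 1: "x * eigenprojection m x e = unity_root m ^ e \<cdot>\<^sub>m eigenprojection m x e"
    using c by simp
  have "x * average (c \<cdot>\<^sub>m x) m = average (c \<cdot>\<^sub>m x) m * x" using x by (intro average_commute) auto
  then show "eigenprojection m x e * x = unity_root m ^ e \<cdot>\<^sub>m eigenprojection m x e"
    using 1 unfolding P by simp
  show "eigenprojection m x e * eigenprojection m x e = eigenprojection m x e"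
    unfolding P by (rule average_idempotent[OF M pow m])
  show "eigenprojection m x (e + m) = eigenprojection m x e"
    using m by (simp add: eigenprojection_def power_add power_inverse)
qed

text \<open>After exchanging the sums, the geometric sum over \<open>e\<close> annihilates every
  power of \<open>x\<close> except the zeroth.\<close>

lemma eigenprojection_sum:
  assumes x: "x \<in> M" and m: "m > 0"
  shows "msum (eigenprojection m x) m = 1\<^sub>m n"
proof -
  define w where "w = inverse (unity_root m)"
  have P: "eigenprojection m x e = (1 / of_nat m) \<cdot>\<^sub>m msum (\<lambda>i. w ^ (e * i) \<cdot>\<^sub>m x ^\<^sub>m i) m" for e
    using x by (simp add: eigenprojection_def average_def w_def sq_pow_smult power_mult)
  have orth: "(\<Sum>e<m. w ^ (e * i)) = (if i = 0 then of_nat m else 0)" if "i < m" for i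
  proof (cases "i = 0")
    case False
    have "w ^ i \<noteq> 1" using unity_root_eq_one[OF m, of i] False that
      by (auto simp: w_def power_inverse dest: dvd_imp_le)
    moreover have "(w ^ i) ^ m = 1" using m
      by (metis inverse_1 mult.commute power_inverse power_mult power_one unity_root_order w_def)
    ultimately show ?thesis using geometric_sum[of "w ^ i" m] False
      by (simp add: mult.commute flip: power_mult)
  qed simp
  show ?thesis
  proof (rule eq_matI)
    fix a b assume "a < dim_row (1\<^sub>m n :: complex mat)" "b < dim_col (1\<^sub>m n :: complex mat)"
    then have ab: "a < n" "b < n" by auto
    have "msum (eigenprojection m x) m $$ (a, b)
        = (\<Sum>e<m. (1 / of_nat m) * (\<Sum>i<m. w ^ (e * i) * (x ^\<^sub>m i) $$ (a, b)))"
      using ab carrier_matD[OF x] carrier_matD[OF pow_carrier_mat[OF x]] by (simp add: msum_def P)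
    also have "\<dots> = (1 / of_nat m) * (\<Sum>e<m. \<Sum>i<m. w ^ (e * i) * (x ^\<^sub>m i) $$ (a, b))"
      by (simp add: sum_distrib_left)
    also have "(\<Sum>e<m. \<Sum>i<m. w ^ (e * i) * (x ^\<^sub>m i) $$ (a, b))
        = (\<Sum>i<m. (\<Sum>e<m. w ^ (e * i)) * (x ^\<^sub>m i) $$ (a, b))"
      by (subst sum.swap) (simp add: sum_distrib_right)
    also have "\<dots> = (\<Sum>i<m. if i = 0 then of_nat m * (x ^\<^sub>m 0) $$ (a, b) else 0)"
      by (intro sum.cong) (auto simp: orth)
    also have "\<dots> = of_nat m * (x ^\<^sub>m 0) $$ (a, b)" using m by (simp add: sum.delta)
    finally show "msum (eigenprojection m x) m $$ (a, b) = 1\<^sub>m n $$ (a, b)"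
      using m x by simp
  qed (auto simp: msum_def)
qed

lemma eigenprojection_trace:
  assumes x: "x \<in> M" and tr: "\<And>i. 0 < i \<Longrightarrow> i < m \<Longrightarrow> trace_mat (x ^\<^sub>m i) = 0" and m: "m > 0"
  shows "trace_mat (eigenprojection m x e) = of_nat n / of_nat m"
proof -
  define c where "c = inverse (unity_root m) ^ e"
  have "trace_mat (eigenprojection m x e) = 1 / of_nat m * (\<Sum>i<m. trace_mat (c ^ i \<cdot>\<^sub>m x ^\<^sub>m i))"
    using x by (simp add: eigenprojection_def c_def average_def sq_pow_smult trace_mat_smult[OF msum_M] trace_msum)
  also have "(\<Sum>i<m. trace_mat (c ^ i \<cdot>\<^sub>m x ^\<^sub>m i)) = (\<Sum>i<m. if i = 0 then of_nat n else 0)"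
    using x tr by (intro sum.cong) (auto simp: trace_mat_smult[OF pow_carrier_mat[OF x]])
  also have "\<dots> = of_nat n" using m by simp
  finally show ?thesis by simp
qed

text \<open>If \<open>v\<close> has eigenvalue \<open>unity_root m ^ e\<close>, then
  \<open>y v\<close> has eigenvalue \<open>unity_root m ^ (e + q)\<close>; in terms of averages,
  \<open>y\<close> intertwines the two rescalings of \<open>x\<close>.\<close>

lemma eigenprojection_shift:
  assumes x: "x \<in> M" and y: "y \<in> M" and q: "qcomm (unity_root m ^ q) x y"
  shows "y * eigenprojection m x e = eigenprojection m x (e + q) * y"
proof -
  define a where "a = inverse (unity_root m) ^ e \<cdot>\<^sub>m x"
  define b where "b = inverse (unity_root m) ^ (e + q) \<cdot>\<^sub>m x"
  have ab: "a \<in> M" "b \<in> M" using x by (auto simp: a_def b_def)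
  have "b * y = y * a"
    using q x y by (simp add: a_def b_def qcomm_def power_add power_inverse mult.assoc)
  then have "y * a ^\<^sub>m i = b ^\<^sub>m i * y" for i
    using ab y by (induction i) (simp_all add: sq_assoc, metis pow_carrier_mat sq_assoc)
  then show ?thesis using ab y
    by (simp add: eigenprojection_def a_def[symmetric] b_def[symmetric] average_def msum_left msum_right)
qed

text \<open>Evaluating \<open>A * x * B\<close> from either side gives \<open>c\<close> times and
  \<open>d\<close> times the same product.\<close>

lemma mult_eq_zero_of_eigen:
  assumes A: "A \<in> M" and B: "B \<in> M" and x: "x \<in> M"
    and Ax: "A * x = c \<cdot>\<^sub>m A" and xB: "x * B = d \<cdot>\<^sub>m B" and cd: "c \<noteq> d"
  shows "A * B = 0\<^sub>m n n"
proof (rule eq_matI)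
  have "c \<cdot>\<^sub>m (A * B) = (A * x) * B" using A B Ax by simp
  also have "\<dots> = A * (x * B)" by (rule sq_assoc[OF A x B])
  also have "\<dots> = d \<cdot>\<^sub>m (A * B)" using A B xB by simp
  finally have e: "c \<cdot>\<^sub>m (A * B) = d \<cdot>\<^sub>m (A * B)" .
  fix i j assume ij: "i < dim_row (0\<^sub>m n n :: complex mat)" "j < dim_col (0\<^sub>m n n :: complex mat)"
  have AB: "A * B \<in> M" using A B by simp
  have "(c \<cdot>\<^sub>m (A * B)) $$ (i, j) = (d \<cdot>\<^sub>m (A * B)) $$ (i, j)" using e by simp
  then have "c * (A * B) $$ (i, j) = d * (A * B) $$ (i, j)" using ij carrier_matD[OF AB] by simp
  then have "(A * B) $$ (i, j) = 0" using cd by simp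
  then show "(A * B) $$ (i, j) = 0\<^sub>m n n $$ (i, j)" using ij by simp
qed (use A B in auto)

text \<open>The conjugating matrix \<open>T\<close> is the sum over all \<open>e\<close> of maps
  between corresponding eigenspaces, chosen to respect the shifts by \<open>y1\<close> and
  \<open>y2\<close>; \<open>T'\<close> is the sum of their inverses.\<close>

lemma normal_pairs_conjugate:
  assumes p1: "normal_pair m k x1 y1" and p2: "normal_pair m k x2 y2"
  obtains T T' where "T \<in> M" "T' \<in> M" "T * T' = 1\<^sub>m n" "x2 * T = T * x1" "y2 * T = T * y1"
proof -
  define \<zeta> where "\<zeta> = unity_root m"
  obtain q where m_eq: "m = q * k" and m: "m > 0" and k: "k > 0" and q: "q > 0"
    using p1 unfolding normal_pair_def by (metis dvd_def mult.commute mult_pos_pos neq0_conv mult_is_0)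
  have root: "unity_root k = \<zeta> ^ q" using unity_root_mult[OF q] by (simp add: \<zeta>_def m_eq)
  have G: "x1 \<in> GL n" "y1 \<in> GL n" "x2 \<in> GL n" "y2 \<in> GL n"
    using p1 p2 unfolding normal_pair_def by blast+
  then have M: "x1 \<in> M" "y1 \<in> M" "x2 \<in> M" "y2 \<in> M" by auto
  have pow: "x1 ^\<^sub>m m = 1\<^sub>m n" "y1 ^\<^sub>m k = 1\<^sub>m n" "x2 ^\<^sub>m m = 1\<^sub>m n" "y2 ^\<^sub>m k = 1\<^sub>m n"
    and qc: "qcomm (\<zeta> ^ q) x1 y1" "qcomm (\<zeta> ^ q) x2 y2"
    using p1 p2 unfolding normal_pair_def root by blast+
  define P1 where "P1 = eigenprojection m x1"
  define P2 where "P2 = eigenprojection m x2"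
  have PM [simp]: "P1 e \<in> M" "P2 e \<in> M" for e by (simp_all add: P1_def P2_def)
  note E1 = eigenprojection_props[OF M(1) pow(1) m, folded P1_def \<zeta>_def]
  note E2 = eigenprojection_props[OF M(3) pow(3) m, folded P2_def \<zeta>_def]
  have shift1: "y1 * P1 e = P1 (e + q) * y1" for e
    unfolding P1_def by (rule eigenprojection_shift) (use M qc in \<open>auto simp: \<zeta>_def\<close>)
  \<comment> \<open>Both traces are \<open>n / m\<close>, so corresponding eigenspaces have equal
    dimension and can be identified.\<close>
  have "trace_mat (P1 e) = trace_mat (P2 e)" for e
    unfolding P1_def P2_def using p1 p2 M m
    by (subst (1 2) eigenprojection_trace) (auto simp: normal_pair_def)
  then have "\<forall>e. \<exists>A B. A \<in> M \<and> B \<in> M \<and> B * A = P1 e \<and> P2 e * A = A \<and> A * P1 e = A \<and> P1 e * B = B \<and> B * P2 e = B"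
    using idempotents_equivalent[OF PM(1) E1(3) PM(2) E2(3)] by metis
  then obtain A B where AB: "\<And>e. A e \<in> M" "\<And>e. B e \<in> M" "\<And>e. B e * A e = P1 e" "\<And>e. P2 e * A e = A e"
    "\<And>e. A e * P1 e = A e" "\<And>e. P1 e * B e = B e" "\<And>e. B e * P2 e = B e"
    by metis
  obtain z1 where z1: "z1 \<in> GL n" "y1 * z1 = 1\<^sub>m n" "z1 * y1 = 1\<^sub>m n" using GL_inverse G by blast
  obtain z2 where z2: "z2 \<in> GL n" "y2 * z2 = 1\<^sub>m n" "z2 * y2 = 1\<^sub>m n" using GL_inverse G by blast
  have zM: "z1 \<in> M" "z2 \<in> M" using z1 z2 by auto
  have cancel: "a * (b * C) = C" if "a * b = 1\<^sub>m n" "a \<in> M" "b \<in> M" "C \<in> M" for a b C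
    using that by (simp flip: sq_assoc)
  have pow_inverse: "b ^\<^sub>m t * a ^\<^sub>m t = 1\<^sub>m n" if "b * a = 1\<^sub>m n" "a \<in> M" "b \<in> M" for a b t
  proof (induction t)
    case (Suc t)
    have "a ^\<^sub>m Suc t = a * a ^\<^sub>m t" using sq_pow_add[of a 1 t] that by simp
    then show ?case using Suc that by (simp add: sq_assoc cancel)
  qed (use that in simp)
  have xB: "x1 * B e = \<zeta> ^ e \<cdot>\<^sub>m B e" "B e * x2 = \<zeta> ^ e \<cdot>\<^sub>m B e"
    and xA: "x2 * A e = \<zeta> ^ e \<cdot>\<^sub>m A e" "A e * x1 = \<zeta> ^ e \<cdot>\<^sub>m A e" for e
  proof -
    have "x1 * B e = (x1 * P1 e) * B e" using M AB(2)[of e] AB(6)[of e] by (simp add: sq_assoc)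
    then show "x1 * B e = \<zeta> ^ e \<cdot>\<^sub>m B e" using AB(2)[of e] AB(6)[of e] E1(1) by simp
    have "B e * x2 = B e * (P2 e * x2)" using M AB(2)[of e] AB(7)[of e] by (simp flip: sq_assoc)
    then show "B e * x2 = \<zeta> ^ e \<cdot>\<^sub>m B e" using AB(2)[of e] AB(7)[of e] E2(2) by simp
    have "x2 * A e = (x2 * P2 e) * A e" using M AB(1)[of e] AB(4)[of e] by (simp add: sq_assoc)
    then show "x2 * A e = \<zeta> ^ e \<cdot>\<^sub>m A e" using AB(1)[of e] AB(4)[of e] E2(1) by simp
    have "A e * x1 = A e * (P1 e * x1)" using M AB(1)[of e] AB(5)[of e] by (simp flip: sq_assoc)
    then show "A e * x1 = \<zeta> ^ e \<cdot>\<^sub>m A e" using AB(1)[of e] AB(5)[of e] E1(2) by simp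
  qed
  txt \<open>Writing \<open>e = q * t + r\<close> with \<open>r < q\<close>, the map \<open>N e\<close> carries the \<open>\<zeta> ^ e\<close>-eigenspace of \<open>x1\<close> to that of
    \<open>x2\<close>: only the first \<open>q\<close> isomorphisms \<open>A r\<close> are chosen freely, the others are forced by
    compatibility with \<open>y1\<close> and \<open>y2\<close>.\<close>
  define N where "N e = y2 ^\<^sub>m (e div q) * A (e mod q) * z1 ^\<^sub>m (e div q)" for e
  \<comment> \<open>The map in the opposite direction, with the two pairs exchanged.\<close>
  define N' where "N' e = y1 ^\<^sub>m (e div q) * B (e mod q) * z2 ^\<^sub>m (e div q)" for e
  have NM [simp]: "N e \<in> M" "N' e \<in> M" for e using M zM AB by (auto simp: N_def N'_def)
  have \<zeta>_split: "(\<zeta> ^ q) ^ (e div q) * \<zeta> ^ (e mod q) = \<zeta> ^ e" for e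
    by (simp flip: power_mult power_add)
  \<comment> \<open>Moving \<open>x\<close> past the power of \<open>y\<close> contributes
    \<open>(\<zeta> ^ q) ^ t\<close>, and \<open>C\<close> contributes its eigenvalue; by
    \<open>\<zeta>_split\<close> the product is \<open>\<zeta> ^ e\<close> for
    \<open>t = e div q\<close>.\<close>
  have sandwich: "x * (y ^\<^sub>m t * C * W) = ((\<zeta> ^ q) ^ t * c) \<cdot>\<^sub>m (y ^\<^sub>m t * C * W)"
    if "qcomm (\<zeta> ^ q) x y" "x \<in> M" "y \<in> M" "C \<in> M" "W \<in> M" "x * C = c \<cdot>\<^sub>m C" for x y C W t c
  proof -
    have "x * y ^\<^sub>m t = (\<zeta> ^ q) ^ t \<cdot>\<^sub>m (y ^\<^sub>m t * x)"
      using qcomm_pow_right[OF that(1), of t] that by (simp add: qcomm_def)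
    then have "x * (y ^\<^sub>m t * C * W) = (\<zeta> ^ q) ^ t \<cdot>\<^sub>m (y ^\<^sub>m t * (x * C) * W)"
      using that(2-5) by (simp flip: sq_assoc)
    then show ?thesis using that by simp
  qed
  have sandwich': "(W * C * z ^\<^sub>m t) * x = ((\<zeta> ^ q) ^ t * c) \<cdot>\<^sub>m (W * C * z ^\<^sub>m t)"
    if "qcomm (\<zeta> ^ q) x y" "x \<in> GL n" "y \<in> GL n" "z * y = 1\<^sub>m n" "z \<in> M" "C \<in> M" "W \<in> M" "C * x = c \<cdot>\<^sub>m C" for x y z C W t c
  proof -
    have "qcomm (inverse (\<zeta> ^ q)) y x" using qcomm_swap[OF that(1)] that by (simp add: \<zeta>_def)
    then have "qcomm (inverse (inverse (\<zeta> ^ q))) z x"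
      by (rule qcomm_inverse_left) (use that in auto)
    then have "qcomm ((\<zeta> ^ q) ^ t) (z ^\<^sub>m t) x" using qcomm_pow_left[of _ z x t] that by simp
    then have "z ^\<^sub>m t * x = (\<zeta> ^ q) ^ t \<cdot>\<^sub>m (x * z ^\<^sub>m t)" by (simp add: qcomm_def)
    then have "(W * C * z ^\<^sub>m t) * x = (\<zeta> ^ q) ^ t \<cdot>\<^sub>m (W * ((C * x) * z ^\<^sub>m t))"
      using that(2,3,5-7) by (simp add: sq_assoc)
    then show ?thesis using that by (simp add: sq_assoc)
  qed
  have xN: "x2 * N e = \<zeta> ^ e \<cdot>\<^sub>m N e" for e
    unfolding N_def using sandwich[OF qc(2) M(3,4) AB(1) pow_carrier_mat[OF zM(1)] xA(1)] by (simp add: \<zeta>_split)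
  have Nx: "N e * x1 = \<zeta> ^ e \<cdot>\<^sub>m N e" for e
    unfolding N_def using sandwich'[OF qc(1) G(1,2) z1(3) zM(1) AB(1) pow_carrier_mat[OF M(4)] xA(2)]
    by (simp add: \<zeta>_split)
  have N'x: "N' e * x2 = \<zeta> ^ e \<cdot>\<^sub>m N' e" for e
    unfolding N'_def using sandwich'[OF qc(2) G(3,4) z2(3) zM(2) AB(2) pow_carrier_mat[OF M(2)] xB(2)]
    by (simp add: \<zeta>_split)
  have shift_pow: "y1 ^\<^sub>m t * P1 e = P1 (e + q * t) * y1 ^\<^sub>m t" for t e
  proof (induction t arbitrary: e)
    case (Suc t)
    have "y1 ^\<^sub>m Suc t * P1 e = y1 ^\<^sub>m t * (y1 * P1 e)" using M by (simp add: sq_assoc)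
    also have "\<dots> = (y1 ^\<^sub>m t * P1 (e + q)) * y1" unfolding shift1 using M by (simp add: sq_assoc)
    also have "\<dots> = P1 (e + q * Suc t) * y1 ^\<^sub>m Suc t" unfolding Suc using M by (simp add: sq_assoc add_ac)
    finally show ?case .
  qed (use M in simp)
  \<comment> \<open>The powers of \<open>y2\<close> cancel in the middle, \<open>B r * A r\<close>
    is \<open>P1 r\<close>, and conjugating it by the \<open>t\<close>-th power of \<open>y1\<close>
    moves the index to \<open>r + q * t = e\<close>.\<close>
  have diag: "N' e * N e = P1 e" for e
  proof -
    define t where "t = e div q"
    define r where "r = e mod q"
    have "N' e * N e = y1 ^\<^sub>m t * (B r * (z2 ^\<^sub>m t * (y2 ^\<^sub>m t * (A r * z1 ^\<^sub>m t))))"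
      unfolding N_def N'_def t_def r_def using M zM AB(1,2) by (simp add: sq_assoc)
    also have "z2 ^\<^sub>m t * (y2 ^\<^sub>m t * (A r * z1 ^\<^sub>m t)) = A r * z1 ^\<^sub>m t"
      by (rule cancel[OF pow_inverse]) (use z2 zM M AB in auto)
    also have "B r * (A r * z1 ^\<^sub>m t) = P1 r * z1 ^\<^sub>m t"
      using AB(1-3) zM by (simp flip: sq_assoc)
    also have "y1 ^\<^sub>m t * (P1 r * z1 ^\<^sub>m t) = (y1 ^\<^sub>m t * P1 r) * z1 ^\<^sub>m t"
      using M zM by (simp flip: sq_assoc)
    also have "\<dots> = P1 (r + q * t) * (y1 ^\<^sub>m t * z1 ^\<^sub>m t)"
      unfolding shift_pow using M zM by (simp add: sq_assoc)
    also have "y1 ^\<^sub>m t * z1 ^\<^sub>m t = 1\<^sub>m n" by (rule pow_inverse) (use z1 M zM in auto)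
    finally show ?thesis by (simp add: r_def t_def)
  qed
  \<comment> \<open>\<open>N f\<close> takes values in one eigenspace of \<open>x2\<close>, while
    \<open>N' e\<close> only sees another.\<close>
  have orth: "N' e * N f = 0\<^sub>m n n" if "e < m" "f < m" "e \<noteq> f" for e f
    using mult_eq_zero_of_eigen[OF NM(2) NM(1) M(3) N'x xN] unity_root_inj[of m e f] that
    unfolding \<zeta>_def by blast
  define T where "T = msum N m"
  define T' where "T' = msum N' m"
  have TM: "T \<in> M" "T' \<in> M" by (simp_all add: T_def T'_def)
  have "T' * T = msum (\<lambda>e. msum (\<lambda>f. N' e * N f) m) m"
  proof -
    have "T' * T = msum (\<lambda>e. N' e * T) m" unfolding T'_def by (rule msum_right) (use TM in auto)
    also have "\<dots> = msum (\<lambda>e. msum (\<lambda>f. N' e * N f) m) m"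
      unfolding T_def by (intro msum_cong msum_left) auto
    finally show ?thesis .
  qed
  also have "\<dots> = msum P1 m"
  proof (rule msum_cong)
    fix e assume e: "e < m"
    have "msum (\<lambda>f. N' e * N f) m = N' e * N e"
      by (rule msum_single) (use e orth in auto)
    then show "msum (\<lambda>f. N' e * N f) m = P1 e" by (simp add: diag)
  qed
  also have "\<dots> = 1\<^sub>m n" unfolding P1_def by (rule eigenprojection_sum[OF M(1) m])
  finally have T'T: "T' * T = 1\<^sub>m n" .
  then have TT': "T * T' = 1\<^sub>m n" using mat_mult_left_right_inverse[of T' n T] TM by simp
  have "x2 * T = T * x1"
    unfolding T_def using M by (simp add: msum_left msum_right xN Nx)
  moreover have "y2 * T = T * y1"
  proof -
    \<comment> \<open>The shift by \<open>q\<close> wraps around at \<open>m = q * k\<close>. The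
      wrapped maps agree because \<open>y1\<close> and \<open>y2\<close> both have
      \<open>k\<close>-th power 1.\<close>
    have period: "N (e + m) = N e" for e
    proof -
      have "z1 ^\<^sub>m k = 1\<^sub>m n" using pow_inverse[OF z1(3) M(2) zM(1), of k] pow(2) zM by simp
      moreover have "(e + m) div q = e div q + k" using q by (simp add: m_eq)
      moreover have "(e + m) mod q = e mod q" by (simp add: m_eq)
      ultimately show ?thesis unfolding N_def using M zM pow(4) by (simp add: sq_pow_add)
    qed
    have step: "y2 * N e = N (e + q) * y1" for e
    proof -
      define t where "t = e div q"
      define C where "C = A (e mod q)"
      have C: "C \<in> M" using AB by (simp add: C_def)
      have "N (e + q) * y1 = y2 ^\<^sub>m Suc t * C * z1 ^\<^sub>m Suc t * y1"
        using q by (simp add: N_def t_def C_def)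
      also have "\<dots> = y2 ^\<^sub>m Suc t * (C * (z1 ^\<^sub>m t * (z1 * y1)))"
        using M zM C by (simp add: sq_assoc)
      also have "y2 ^\<^sub>m Suc t = y2 * y2 ^\<^sub>m t" using sq_pow_add[of y2 1 t] M by simp
      also have "y2 * y2 ^\<^sub>m t * (C * (z1 ^\<^sub>m t * (z1 * y1))) = y2 * (y2 ^\<^sub>m t * C * z1 ^\<^sub>m t)"
        using M zM C z1(3) by (simp add: sq_assoc)
      finally show ?thesis by (simp add: N_def t_def C_def)
    qed
    have "y2 * T = msum (\<lambda>e. N (e + q) * y1) m"
      unfolding T_def using M by (simp add: msum_left step)
    also have "\<dots> = msum (\<lambda>e. N (e + q)) m * y1" using M by (simp add: msum_right)
    also have "msum (\<lambda>e. N (e + q)) m = T" unfolding T_def by (rule msum_shift) (rule period)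
    finally show ?thesis .
  qed
  ultimately show ?thesis using that TM TT' by blast
qed

end

section \<open>Squarefree dimensions\<close>

lemma (in comm_group) mult_pow_rearrange:
  fixes a b i :: nat
  assumes x: "x \<in> carrier G" and w: "w \<in> carrier G"
  shows "x [^] a \<otimes> (w \<otimes> x [^] i) [^] b = w [^] b \<otimes> x [^] (a + i * b)"
proof -
  have "(w \<otimes> x [^] i) [^] b = w [^] b \<otimes> x [^] (i * b)"
    using x w by (simp add: nat_pow_distrib nat_pow_pow)
  moreover have "x [^] (a + i * b) = x [^] a \<otimes> x [^] (i * b)" using x by (simp add: nat_pow_mult)
  ultimately show ?thesis using x w by (simp add: m_ac)
qed

context irreducible_set
begin

text \<open>\<open>X\<close> realizes the exponent \<open>m\<close>. The commutators of
  \<open>x\<close> with \<open>U\<close> form a cyclic group of \<open>m\<close>-th roots of unity;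
  \<open>y0\<close> gives a generator of it, and multiplying by a power of \<open>x\<close> turns
  \<open>y0\<close> into \<open>y\<close> of order \<open>k\<close>.\<close>

lemma exists_normal_pair:
  assumes sq: "squarefree n"
  obtains m k x y where "normal_pair m k x y" "proj_class n ` U = pair_classes m k x y"
    "\<And>g. g \<in> carrier PU \<Longrightarrow> g [^]\<^bsub>PU\<^esub> m = \<one>\<^bsub>PU\<^esub>"
    "\<And>i :: nat. proj_class n x [^]\<^bsub>PU\<^esub> i = \<one>\<^bsub>PU\<^esub> \<Longrightarrow> m dvd i" "proj_class n x \<in> carrier PU"
proof -
  interpret G: comm_group PU by (rule comm_group_PU)
  let ?cl = "proj_class n"
  have cl [simp]: "?cl u \<in> carrier PU" if "u \<in> U" for u using that by simp
  have exp: "g [^]\<^bsub>PU\<^esub> n = \<one>\<^bsub>PU\<^esub>" if g: "g \<in> carrier PU" for g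
  proof -
    obtain u where "u \<in> U" "g = ?cl u" using g by auto
    then show ?thesis using pow_PU[of u n] one_PU[of "u ^\<^sub>m n"] U_pow_scalar[of u] by simp
  qed
  obtain X where X: "X \<in> carrier PU" and ordX: "G.ord X > 0"
    and expX: "\<And>g. g \<in> carrier PU \<Longrightarrow> g [^]\<^bsub>PU\<^esub> G.ord X = \<one>\<^bsub>PU\<^esub>"
    using G.exists_exponent_element[OF sq n_pos exp] by blast
  define m where "m = G.ord X"
  have m: "m > 0" using ordX by (simp add: m_def)
  \<comment> \<open>The \<open>k\<close>-th power of a lift is a scalar \<open>c\<close>; dividing
    the lift by a \<open>k\<close>-th root of \<open>c\<close> makes the power exactly 1.\<close>
  have normalize: "\<exists>d. d \<noteq> 0 \<and> (d \<cdot>\<^sub>m u) ^\<^sub>m k = 1\<^sub>m n"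
    if u: "u \<in> U" "?cl u [^]\<^bsub>PU\<^esub> k = \<one>\<^bsub>PU\<^esub>" "k > 0" for u k
  proof -
    have "\<exists>c. u ^\<^sub>m k = c \<cdot>\<^sub>m 1\<^sub>m n" using u pow_PU one_PU[of "u ^\<^sub>m k"] by simp
    then obtain c where c: "u ^\<^sub>m k = c \<cdot>\<^sub>m 1\<^sub>m n" by blast
    have "c \<noteq> 0" using GL_smult_nonzero[of c "1\<^sub>m n"] GL_pow[of u k] u(1) unfolding c by simp
    then obtain d where "d \<noteq> 0" "d ^ k = inverse c"
      using complex_root_exists[of "inverse c" k] u(3) by auto
    then show ?thesis using c \<open>c \<noteq> 0\<close> u(1) by (intro exI[of _ d]) (simp add: sq_pow_smult)
  qed
  have cl_smult: "?cl (d \<cdot>\<^sub>m u) = ?cl u" if "d \<noteq> 0" "u \<in> U" for d u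
    using that proj_class_eq_iff[of "d \<cdot>\<^sub>m u" u] by auto
  obtain x0 where x0: "x0 \<in> U" "X = ?cl x0" using X by auto
  obtain d0 where d0: "d0 \<noteq> 0" "(d0 \<cdot>\<^sub>m x0) ^\<^sub>m m = 1\<^sub>m n"
    using normalize[OF x0(1) _ m] expX[OF X] x0 by (auto simp: m_def)
  define x where "x = d0 \<cdot>\<^sub>m x0"
  have x: "x \<in> U" "?cl x = X" "x ^\<^sub>m m = 1\<^sub>m n" using d0 x0 cl_smult by (auto simp: x_def)
  have ord_dvd: "m dvd i" if "X [^]\<^bsub>PU\<^esub> i = \<one>\<^bsub>PU\<^esub>" for i :: nat
    using that G.pow_eq_id[OF X] by (simp add: m_def)
  have scalar_dvd: "m dvd i" if "x ^\<^sub>m i = c \<cdot>\<^sub>m 1\<^sub>m n" for i c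
    by (rule ord_dvd) (metis U_pow one_PU pow_PU that x(1,2))
  have inv_pow: "g [^]\<^bsub>PU\<^esub> l \<otimes>\<^bsub>PU\<^esub> g [^]\<^bsub>PU\<^esub> ((m - 1) * l) = \<one>\<^bsub>PU\<^esub>"
    if "g \<in> carrier PU" for g and l :: nat
  proof -
    have "l + (m - 1) * l = m * l" using m by (cases m) auto
    then have "g [^]\<^bsub>PU\<^esub> l \<otimes>\<^bsub>PU\<^esub> g [^]\<^bsub>PU\<^esub> ((m - 1) * l) = (g [^]\<^bsub>PU\<^esub> m) [^]\<^bsub>PU\<^esub> l"
      using G.nat_pow_mult[OF that] G.nat_pow_pow[OF that] by metis
    then show ?thesis using expX[OF that] by (simp only: m_def G.nat_pow_one)
  qed
  \<comment> \<open>\<open>adjusted_root\<close> transported to matrices, with a lift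
    \<open>v\<close> whose \<open>k\<close>-th power is exactly 1.\<close>
  have adjust: "\<exists>k i v. k > 0 \<and> k dvd m \<and> v \<in> U \<and> ?cl v = ?cl w \<otimes>\<^bsub>PU\<^esub> X [^]\<^bsub>PU\<^esub> (i :: nat)
      \<and> v ^\<^sub>m k = 1\<^sub>m n \<and> (\<exists>d. v = d \<cdot>\<^sub>m (w * x ^\<^sub>m i))
      \<and> (\<forall>j l :: nat. ?cl w [^]\<^bsub>PU\<^esub> j = X [^]\<^bsub>PU\<^esub> l \<longrightarrow> k dvd j)" if w: "w \<in> U" for w
  proof -
    obtain k i :: nat where ki: "k > 0" "k dvd m" "(?cl w \<otimes>\<^bsub>PU\<^esub> X [^]\<^bsub>PU\<^esub> i) [^]\<^bsub>PU\<^esub> k = \<one>\<^bsub>PU\<^esub>"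
      "\<And>j l :: nat. ?cl w [^]\<^bsub>PU\<^esub> j = X [^]\<^bsub>PU\<^esub> l \<Longrightarrow> k dvd j"
      using G.adjusted_root[OF X cl[OF w] ordX expX[OF cl[OF w]]] unfolding m_def by blast
    have e: "?cl w \<otimes>\<^bsub>PU\<^esub> X [^]\<^bsub>PU\<^esub> i = ?cl (w * x ^\<^sub>m i)"
      using w x pow_PU[OF x(1), of i] mult_PU[of w "x ^\<^sub>m i"] by simp
    have wx: "w * x ^\<^sub>m i \<in> U" using w x by simp
    obtain d where d: "d \<noteq> 0" "(d \<cdot>\<^sub>m (w * x ^\<^sub>m i)) ^\<^sub>m k = 1\<^sub>m n"
      using normalize[OF wx _ ki(1)] ki(3) unfolding e by blast
    show ?thesis
      using ki d cl_smult[OF d(1) wx] e U_smult[OF wx d(1)] by metis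
  qed
  \<comment> \<open>This is where squarefreeness excludes independent commuting lifts: it forces the
    order of \<open>w\<close> modulo powers of \<open>X\<close> to be 1.\<close>
  have central: "\<exists>l :: nat. ?cl w = X [^]\<^bsub>PU\<^esub> l" if w: "w \<in> U" "qcomm 1 w x" for w
  proof -
    obtain k i v d where k: "k > 0" "k dvd m" and v: "v \<in> U" "?cl v = ?cl w \<otimes>\<^bsub>PU\<^esub> X [^]\<^bsub>PU\<^esub> (i :: nat)"
      "v ^\<^sub>m k = 1\<^sub>m n" "v = d \<cdot>\<^sub>m (w * x ^\<^sub>m i)"
      and least: "\<And>j l :: nat. ?cl w [^]\<^bsub>PU\<^esub> j = X [^]\<^bsub>PU\<^esub> l \<Longrightarrow> k dvd j"
      using adjust[OF w(1)] by blast
    have W: "?cl w \<in> carrier PU" using w by simp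
    have "qcomm (1 ^ i) (x ^\<^sub>m i) x"
      by (rule qcomm_pow_left) (use x in \<open>auto simp: qcomm_def\<close>)
    then have "qcomm (1 * 1) (w * x ^\<^sub>m i) x"
      by (intro qcomm_mult_left) (use w x in auto)
    then have "qcomm 1 v x" unfolding v(4) using w x by (intro qcomm_smult_left) auto
    then have comm: "v * x = x * v" by (simp add: qcomm_def)
    \<comment> \<open>A scalar product of powers of \<open>x\<close> and \<open>v\<close> would put
      the \<open>b\<close>-th power of \<open>w\<close> among the powers of \<open>X\<close>; then
      \<open>k\<close> divides \<open>b\<close>, so \<open>b = 0\<close>, and then \<open>m\<close>
      divides \<open>a\<close>.\<close>
    have "m * k dvd n"
    proof (rule commuting_orders_dvd[OF x(1) v(1) comm x(3) m v(3) k(1)])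
      fix a b assume ab: "a < m" "b < k" and s: "\<exists>c. x ^\<^sub>m a * v ^\<^sub>m b = c \<cdot>\<^sub>m 1\<^sub>m n"
      have "X [^]\<^bsub>PU\<^esub> a \<otimes>\<^bsub>PU\<^esub> (?cl w \<otimes>\<^bsub>PU\<^esub> X [^]\<^bsub>PU\<^esub> i) [^]\<^bsub>PU\<^esub> b = \<one>\<^bsub>PU\<^esub>"
        using s one_PU[of "x ^\<^sub>m a * v ^\<^sub>m b"] mult_PU[of "x ^\<^sub>m a" "v ^\<^sub>m b"] pow_PU[of x a] pow_PU[of v b] x v
        by simp
      then have "?cl w [^]\<^bsub>PU\<^esub> b \<otimes>\<^bsub>PU\<^esub> X [^]\<^bsub>PU\<^esub> (a + i * b) = \<one>\<^bsub>PU\<^esub>"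
        unfolding G.mult_pow_rearrange[OF X W] .
      then have "?cl w [^]\<^bsub>PU\<^esub> b \<otimes>\<^bsub>PU\<^esub> X [^]\<^bsub>PU\<^esub> (a + i * b) = X [^]\<^bsub>PU\<^esub> ((m - 1) * (a + i * b)) \<otimes>\<^bsub>PU\<^esub> X [^]\<^bsub>PU\<^esub> (a + i * b)"
        using inv_pow[OF X, of "a + i * b"] X G.m_comm G.nat_pow_closed by metis
      then have "?cl w [^]\<^bsub>PU\<^esub> b = X [^]\<^bsub>PU\<^esub> ((m - 1) * (a + i * b))"
        using W X G.right_cancel G.nat_pow_closed by metis
      then have "k dvd b" by (rule least)
      then have b: "b = 0" using ab(2) nat_dvd_not_less by blast
      have "x ^\<^sub>m a * v ^\<^sub>m b = x ^\<^sub>m a" unfolding b using x(1) carrier_matD[OF GL_M[OF U_GL[OF v(1)]]] by simp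
      then have "m dvd a" using scalar_dvd s by metis
      then show "a = 0 \<and> b = 0" using b ab(1) nat_dvd_not_less by blast
    qed
    have "k = 1"
    proof (rule ccontr)
      assume "k \<noteq> 1"
      then obtain p where p: "prime p" "p dvd k" using prime_factor_nat by blast
      then have "p dvd m" using k by auto
      then have "p ^ 2 dvd m * k" using p by (simp add: power2_eq_square mult_dvd_mono)
      then have "p ^ 2 dvd n" using \<open>m * k dvd n\<close> dvd_trans by blast
      then show False using sq p(1) unfolding squarefree_def by (auto simp: prime_nat_iff)
    qed
    then have "v = 1 \<cdot>\<^sub>m 1\<^sub>m n"
      using v(3) carrier_matD[OF GL_M[OF U_GL[OF v(1)]]] GL_M[OF U_GL[OF v(1)]] by simp
    then have "?cl w \<otimes>\<^bsub>PU\<^esub> X [^]\<^bsub>PU\<^esub> i = \<one>\<^bsub>PU\<^esub>"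
      using one_PU[OF v(1)] v(2) by metis
    then have "?cl w \<otimes>\<^bsub>PU\<^esub> X [^]\<^bsub>PU\<^esub> i = X [^]\<^bsub>PU\<^esub> ((m - 1) * i) \<otimes>\<^bsub>PU\<^esub> X [^]\<^bsub>PU\<^esub> i"
      using inv_pow[OF X, of i] X G.m_comm G.nat_pow_closed by metis
    then have "?cl w = X [^]\<^bsub>PU\<^esub> ((m - 1) * i)"
      using W X G.right_cancel G.nat_pow_closed by metis
    then show ?thesis by blast
  qed
  define \<zeta> where "\<zeta> = unity_root m"
  \<comment> \<open>The exponents of commutators of \<open>x\<close> with elements of
    \<open>U\<close>. The least positive one, \<open>q\<close>, generates them all; the set is
    nonempty because \<open>x\<close> commutes with itself, which is exponent
    \<open>m\<close>.\<close>
  define Q where "Q t \<longleftrightarrow> t > 0 \<and> (\<exists>w\<in>U. qcomm (\<zeta> ^ t) x w)" for t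
  define q where "q = (LEAST t. Q t)"
  have "Q m" unfolding Q_def using m x by (auto simp: \<zeta>_def qcomm_def intro!: bexI[of _ x])
  then have "Q q" unfolding q_def by (rule LeastI)
  then obtain y0 where q: "q > 0" and y0: "y0 \<in> U" "qcomm (\<zeta> ^ q) x y0" by (auto simp: Q_def)
  \<comment> \<open>Division with remainder: dividing \<open>w\<close> by the power
    \<open>t div q\<close> of \<open>y0\<close> leaves the commutator exponent
    \<open>t mod q\<close>, which is 0 by minimality. What is left commutes with \<open>x\<close>,
    so \<open>central\<close> makes it a power of \<open>X\<close>.\<close>
  have reduce: "q dvd t \<and> (\<exists>l :: nat. ?cl w = X [^]\<^bsub>PU\<^esub> l \<otimes>\<^bsub>PU\<^esub> ?cl y0 [^]\<^bsub>PU\<^esub> (t div q))"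
    if w: "w \<in> U" "qcomm (\<zeta> ^ t) x w" for w t
  proof -
    define s where "s = t div q"
    define v where "v = w * y0 ^\<^sub>m ((m - 1) * s)"
    have v: "v \<in> U" using w y0 by (simp add: v_def)
    have "qcomm (\<zeta> ^ t * (\<zeta> ^ q) ^ ((m - 1) * s)) x v"
      unfolding v_def by (intro qcomm_mult_right qcomm_pow_right) (use w y0 x in auto)
    also have "\<zeta> ^ t * (\<zeta> ^ q) ^ ((m - 1) * s) = \<zeta> ^ (t mod q)"
    proof -
      define r where "r = t mod q"
      have "t = r + q * s" by (simp add: r_def s_def)
      then have "t + q * ((m - 1) * s) = r + m * (q * s)"
        using m by (cases m) (auto simp: algebra_simps)
      then have "\<zeta> ^ t * (\<zeta> ^ q) ^ ((m - 1) * s) = \<zeta> ^ (t mod q) * (\<zeta> ^ m) ^ (q * s)"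
        unfolding r_def by (metis power_add power_mult)
      then show ?thesis using m by (simp add: \<zeta>_def)
    qed
    finally have qv: "qcomm (\<zeta> ^ (t mod q)) x v" .
    then have "t mod q = 0"
      using not_less_Least[of "t mod q" Q, folded q_def] mod_less_divisor[OF q, of t] v
      unfolding Q_def by (metis neq0_conv)
    then have "qcomm 1 x v" using qv by simp
    then have "qcomm 1 v x" by (simp add: qcomm_def)
    then obtain l where l: "?cl v = X [^]\<^bsub>PU\<^esub> (l :: nat)" using central[OF v] by blast
    have "?cl v = ?cl w \<otimes>\<^bsub>PU\<^esub> ?cl y0 [^]\<^bsub>PU\<^esub> ((m - 1) * s)"
      unfolding v_def using w y0 pow_PU[OF y0(1)] mult_PU[of w "y0 ^\<^sub>m ((m - 1) * s)"] by simp
    then have "X [^]\<^bsub>PU\<^esub> l \<otimes>\<^bsub>PU\<^esub> ?cl y0 [^]\<^bsub>PU\<^esub> s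
        = ?cl w \<otimes>\<^bsub>PU\<^esub> (?cl y0 [^]\<^bsub>PU\<^esub> s \<otimes>\<^bsub>PU\<^esub> ?cl y0 [^]\<^bsub>PU\<^esub> ((m - 1) * s))"
      using l cl[OF w(1)] cl[OF y0(1)] G.m_assoc G.m_comm G.nat_pow_closed by metis
    then have "?cl w = X [^]\<^bsub>PU\<^esub> l \<otimes>\<^bsub>PU\<^esub> ?cl y0 [^]\<^bsub>PU\<^esub> s"
      using inv_pow[OF cl[OF y0(1)]] cl[OF w(1)] G.r_one by metis
    then show ?thesis using \<open>t mod q = 0\<close> by (auto simp: s_def)
  qed
  obtain k i y d where k: "k > 0" "k dvd m" and y: "y \<in> U" "?cl y = ?cl y0 \<otimes>\<^bsub>PU\<^esub> X [^]\<^bsub>PU\<^esub> (i :: nat)"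
    "y ^\<^sub>m k = 1\<^sub>m n" "y = d \<cdot>\<^sub>m (y0 * x ^\<^sub>m i)"
    and least: "\<And>j l :: nat. ?cl y0 [^]\<^bsub>PU\<^esub> j = X [^]\<^bsub>PU\<^esub> l \<Longrightarrow> k dvd j"
    using adjust[OF y0(1)] by blast
  have "qcomm (1 ^ i) x (x ^\<^sub>m i)"
    by (rule qcomm_pow_right) (use x in \<open>auto simp: qcomm_def\<close>)
  then have "qcomm (\<zeta> ^ q * 1) x (y0 * x ^\<^sub>m i)"
    by (intro qcomm_mult_right) (use y0 x in auto)
  then have xy: "qcomm (\<zeta> ^ q) x y"
    unfolding y(4) using y0 x by (intro qcomm_smult_right) auto
  \<comment> \<open>One divisibility comes from the commutator of \<open>x\<close> with the
    \<open>k\<close>-th power of \<open>y\<close>, which is 1. For the other, the power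
    \<open>m / q\<close> of \<open>y0\<close> commutes with \<open>x\<close>, hence is a power of
    \<open>X\<close>, and \<open>k\<close> divides such exponents.\<close>
  have "m = q * k"
  proof (rule dvd_antisym)
    have "qcomm ((\<zeta> ^ q) ^ k) x (y ^\<^sub>m k)" using qcomm_pow_right[OF xy] x(1) y(1) by simp
    moreover have "qcomm 1 x (y ^\<^sub>m k)" unfolding y(3) using x by simp
    ultimately have "(\<zeta> ^ q) ^ k = 1" by (rule qcomm_unique) (use x(1) y(1) in auto)
    then show "m dvd q * k" using unity_root_eq_one[OF m, of "q * k"] by (simp add: \<zeta>_def power_mult)
  next
    have "q dvd m" using reduce[of x m] x m by (auto simp: \<zeta>_def qcomm_def)
    then obtain r where r: "m = q * r" by auto
    have "qcomm ((\<zeta> ^ q) ^ r) x (y0 ^\<^sub>m r)" using qcomm_pow_right[OF y0(2)] x y0 by simp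
    also have "(\<zeta> ^ q) ^ r = 1" using m r by (simp add: \<zeta>_def flip: power_mult)
    finally have "qcomm 1 (y0 ^\<^sub>m r) x" by (simp add: qcomm_def)
    then obtain l where "?cl (y0 ^\<^sub>m r) = X [^]\<^bsub>PU\<^esub> (l :: nat)" using central[of "y0 ^\<^sub>m r"] y0 by auto
    then have "k dvd r" using least pow_PU[OF y0(1)] by simp
    then show "q * k dvd m" using r by simp
  qed
  have root: "\<zeta> ^ q = unity_root k" using unity_root_mult[OF q, of k] \<open>m = q * k\<close> by (simp add: \<zeta>_def)
  have trace0: "trace_mat (x ^\<^sub>m j) = 0" if "0 < j" "j < m" for j
  proof (rule U_trace)
    show "\<nexists>c. x ^\<^sub>m j = c \<cdot>\<^sub>m 1\<^sub>m n"
      using scalar_dvd nat_dvd_not_less[OF that] by blast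
  qed (use x in simp)
  have "qcomm (unity_root k) x y" using xy root by simp
  moreover have "\<forall>i. (\<exists>c. x ^\<^sub>m i = c \<cdot>\<^sub>m 1\<^sub>m n) \<longrightarrow> m dvd i" using scalar_dvd by blast
  moreover have "\<forall>i. 0 < i \<and> i < m \<longrightarrow> trace_mat (x ^\<^sub>m i) = 0" using trace0 by blast
  ultimately have pair: "normal_pair m k x y"
    unfolding normal_pair_def using U_GL[OF x(1)] U_GL[OF y(1)] x(3) y(3) m k by blast
  \<comment> \<open>Undoes the adjustment of \<open>y0\<close>, so that products in \<open>X\<close>
    and \<open>y0\<close> can be rewritten in \<open>X\<close> and \<open>y\<close>.\<close>
  have Y: "?cl y0 = ?cl y \<otimes>\<^bsub>PU\<^esub> X [^]\<^bsub>PU\<^esub> ((m - 1) * i)"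
    unfolding y(2) using inv_pow[OF X, of i] X cl[OF y0(1)] G.m_assoc G.r_one G.nat_pow_closed by metis
  have red_x: "X [^]\<^bsub>PU\<^esub> (l :: nat) = ?cl (x ^\<^sub>m (l mod m))" for l
  proof -
    have "x ^\<^sub>m l = x ^\<^sub>m (m * (l div m) + l mod m)" by simp
    also have "\<dots> = (x ^\<^sub>m m) ^\<^sub>m (l div m) * x ^\<^sub>m (l mod m)"
      using x(1,3) sq_pow_add[of x "m * (l div m)" "l mod m"] sq_pow_mult[of x m "l div m"] by simp
    finally show ?thesis using pow_PU[OF x(1), of l] x by simp
  qed
  have red_y: "?cl y [^]\<^bsub>PU\<^esub> (l :: nat) = ?cl (y ^\<^sub>m (l mod k))" for l
  proof -
    have "y ^\<^sub>m l = y ^\<^sub>m (k * (l div k) + l mod k)" by simp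
    also have "\<dots> = (y ^\<^sub>m k) ^\<^sub>m (l div k) * y ^\<^sub>m (l mod k)"
      using y(1,3) sq_pow_add[of y "k * (l div k)" "l mod k"] sq_pow_mult[of y k "l div k"] by simp
    finally show ?thesis using pow_PU[OF y(1), of l] y(1,3) by simp
  qed
  have "?cl w \<in> pair_classes m k x y" if w: "w \<in> U" for w
  proof -
    obtain c where c: "qcomm c w x" using U_commutator[OF w x(1)] by blast
    have c0: "c \<noteq> 0" using qcomm_nonzero[OF c] w x by simp
    then have c': "qcomm (inverse c) x w" using qcomm_swap[OF c] w x by simp
    then have "inverse c ^ m = 1" using qcomm_pow_eq_one[OF c', of m 1] w x by simp
    then obtain t where "inverse c = \<zeta> ^ t" using unity_root_surj[OF _ m] unfolding \<zeta>_def by blast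
    then obtain l where l: "?cl w = X [^]\<^bsub>PU\<^esub> (l :: nat) \<otimes>\<^bsub>PU\<^esub> ?cl y0 [^]\<^bsub>PU\<^esub> (t div q)"
      using reduce[OF w] c' by metis
    define s where "s = t div q"
    have "?cl y0 [^]\<^bsub>PU\<^esub> s = X [^]\<^bsub>PU\<^esub> ((m - 1) * i * s) \<otimes>\<^bsub>PU\<^esub> ?cl y [^]\<^bsub>PU\<^esub> s"
      unfolding Y using G.nat_pow_distrib[OF cl[OF y(1)], of "X [^]\<^bsub>PU\<^esub> ((m - 1) * i)" s] X
        G.nat_pow_pow[OF X] G.m_comm cl[OF y(1)] G.nat_pow_closed by metis
    then have "?cl w = X [^]\<^bsub>PU\<^esub> (l + (m - 1) * i * s) \<otimes>\<^bsub>PU\<^esub> ?cl y [^]\<^bsub>PU\<^esub> s"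
      using l X cl[OF y(1)] G.m_assoc G.nat_pow_mult[OF X] G.nat_pow_closed unfolding s_def by metis
    then have "?cl w = ?cl (x ^\<^sub>m ((l + (m - 1) * i * s) mod m) * y ^\<^sub>m (s mod k))"
      unfolding red_x red_y using x(1,3) y(1,3) mult_PU by simp
    then show ?thesis using m k unfolding pair_classes_def by force
  qed
  moreover have "pair_classes m k x y \<subseteq> ?cl ` U"
    using x(1,3) y(1,3) by (auto simp: pair_classes_def)
  ultimately have "?cl ` U = pair_classes m k x y" by blast
  then show ?thesis
    by (rule that[OF pair]) (use expX ord_dvd x X in \<open>auto simp: m_def\<close>)
qed

end

section \<open>Conjugacy of isomorphic centralizers\<close>

context matrix_dim
begin

lemma pair_classes_conjugate:
  assumes p1: "normal_pair m k x1 y1" and p2: "normal_pair m k x2 y2"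
  shows "conjugate_subsets (PSL n) (pair_classes m k x1 y1) (pair_classes m k x2 y2)"
proof -
  obtain T T' where T: "T \<in> M" "T' \<in> M" "T * T' = 1\<^sub>m n" "x2 * T = T * x1" "y2 * T = T * y1"
    using normal_pairs_conjugate[OF p1 p2] .
  have TG: "T \<in> GL n" using GL_I T by blast
  have T'G: "T' \<in> GL n" using GL_I[of T' T] T mat_mult_left_right_inverse[of T n T'] by simp
  have G: "x1 \<in> GL n" "y1 \<in> GL n" "x2 \<in> GL n" "y2 \<in> GL n"
    using p1 p2 unfolding normal_pair_def by blast+
  have pow: "b ^\<^sub>m i * T = T * a ^\<^sub>m i" if "b * T = T * a" "a \<in> M" "b \<in> M" for a b i
  proof (induction i)
    case (Suc i)
    have "b ^\<^sub>m Suc i * T = b ^\<^sub>m i * (b * T)" using that(2,3) T(1) by (simp add: sq_assoc)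
    also have "\<dots> = (b ^\<^sub>m i * T) * a" unfolding that(1) using that(2,3) T(1) by (simp add: sq_assoc)
    also have "\<dots> = T * a ^\<^sub>m Suc i" unfolding Suc using that(2,3) T(1) by (simp add: sq_assoc)
    finally show ?case .
  qed (use that T in simp)
  have conj: "proj_class n T \<otimes>\<^bsub>PSL n\<^esub> proj_class n (x1 ^\<^sub>m i * y1 ^\<^sub>m j) \<otimes>\<^bsub>PSL n\<^esub> inv\<^bsub>PSL n\<^esub> (proj_class n T)
      = proj_class n (x2 ^\<^sub>m i * y2 ^\<^sub>m j)" for i j
  proof -
    have "T * (x1 ^\<^sub>m i * y1 ^\<^sub>m j) = (x2 ^\<^sub>m i * T) * y1 ^\<^sub>m j"
      using pow[OF T(4)] G T(1) by (simp add: sq_assoc)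
    also have "\<dots> = x2 ^\<^sub>m i * y2 ^\<^sub>m j * T"
      using pow[OF T(5)] G T(1) by (simp add: sq_assoc)
    finally have "T * (x1 ^\<^sub>m i * y1 ^\<^sub>m j) * T' = x2 ^\<^sub>m i * y2 ^\<^sub>m j"
      using G T(1-3) by (simp add: sq_assoc)
    then show ?thesis using TG T'G G T(3) by (simp add: inv_PSL[OF TG T'G] mult_PSL)
  qed
  show ?thesis
    unfolding conjugate_subsets_def pair_classes_def image_image
    by (rule bexI[of _ "proj_class n T"]) (use TG conj in \<open>auto simp: case_prod_unfold\<close>)
qed

lemma squarefree_conjugate:
  assumes sq: "squarefree n" and H: "irreducible_set n H1" "irreducible_set n H2"
    and iso: "(PSL n)\<lparr>carrier := proj_class n ` proj_centralizer n H1\<rparr> \<cong> (PSL n)\<lparr>carrier := proj_class n ` proj_centralizer n H2\<rparr>"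
  shows "conjugate_subsets (PSL n) (proj_class n ` proj_centralizer n H1) (proj_class n ` proj_centralizer n H2)"
proof -
  interpret A: irreducible_set n H1 by fact
  interpret B: irreducible_set n H2 by fact
  interpret GA: comm_group A.PU by (rule A.comm_group_PU)
  interpret GB: comm_group B.PU by (rule B.comm_group_PU)
  obtain m k x y where a: "normal_pair m k x y" "proj_class n ` A.U = pair_classes m k x y"
    "\<And>g. g \<in> carrier A.PU \<Longrightarrow> g [^]\<^bsub>A.PU\<^esub> m = \<one>\<^bsub>A.PU\<^esub>"
    "\<And>i :: nat. proj_class n x [^]\<^bsub>A.PU\<^esub> i = \<one>\<^bsub>A.PU\<^esub> \<Longrightarrow> m dvd i" "proj_class n x \<in> carrier A.PU"
    using A.exists_normal_pair[OF sq] by blast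
  obtain m' k' x' y' where b: "normal_pair m' k' x' y'" "proj_class n ` B.U = pair_classes m' k' x' y'"
    "\<And>g. g \<in> carrier B.PU \<Longrightarrow> g [^]\<^bsub>B.PU\<^esub> m' = \<one>\<^bsub>B.PU\<^esub>"
    "\<And>i :: nat. proj_class n x' [^]\<^bsub>B.PU\<^esub> i = \<one>\<^bsub>B.PU\<^esub> \<Longrightarrow> m' dvd i" "proj_class n x' \<in> carrier B.PU"
    using B.exists_normal_pair[OF sq] by blast
  obtain f where f: "f \<in> iso A.PU B.PU" using iso by (auto simp: is_iso_def)
  obtain g where g: "g \<in> iso B.PU A.PU" using GA.iso_sym[OF iso] by (auto simp: is_iso_def)
  have "m dvd m'" using iso_pow_eq_one[OF f GA.is_group GB.is_group b(3) a(5)] a(4) by blast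
  moreover have "m' dvd m" using iso_pow_eq_one[OF g GB.is_group GA.is_group a(3) b(5)] b(4) by blast
  ultimately have m: "m' = m" by (simp add: dvd_antisym)
  have "card (carrier A.PU) = card (carrier B.PU)"
    using f bij_betw_same_card unfolding iso_def by blast
  then have "m * k = m * k'" using a b m card_pair_classes by simp
  then have "k' = k" using a(1) by (auto simp: normal_pair_def)
  then show ?thesis using pair_classes_conjugate a b m by metis
qed

end

section \<open>Dimensions divisible by a square\<close>

text \<open>Sends basis vector \<open>j\<close> to \<open>c j\<close> times basis vector
  \<open>f j\<close>. Diagonal matrices, permutation matrices and matrix units all have this form,
  and products stay within it.\<close>

definition weighted_map :: "nat \<Rightarrow> (nat \<Rightarrow> nat) \<Rightarrow> (nat \<Rightarrow> complex) \<Rightarrow> complex mat" where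
  "weighted_map n f c = mat n n (\<lambda>(i, j). if i = f j then c j else 0)"

text \<open>Cyclic shift by \<open>s\<close> of the lowest base-\<open>p\<close> digit of the index
  \<open>e\<close>; reading indices by digits decomposes the space as a tensor product with a
  \<open>p\<close>-dimensional factor.\<close>

definition shift_digit :: "nat \<Rightarrow> nat \<Rightarrow> nat \<Rightarrow> nat" where
  "shift_digit p s e = (e div p) * p + (e mod p + s) mod p"

lemma shift_digit_mod [simp]: "p > 0 \<Longrightarrow> shift_digit p s e mod p = (e mod p + s) mod p"
  by (simp add: shift_digit_def)

lemma shift_digit_div [simp]: "p > 0 \<Longrightarrow> shift_digit p s e div p = e div p"
  by (simp add: shift_digit_def)

lemma digits_less:
  fixes p :: nat
  assumes "p dvd n" "e < n div p" "i < p"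
  shows "e * p + i < n"
proof -
  obtain k where k: "n = p * k" using assms(1) by auto
  then have "Suc e \<le> k" using assms by auto
  then have "Suc e * p \<le> k * p" by (rule mult_le_mono1)
  then show ?thesis using assms(3) k by (simp add: mult.commute)
qed

lemma div_less_div: "p dvd n \<Longrightarrow> p > 0 \<Longrightarrow> e < n \<Longrightarrow> e div p < n div p" for p :: nat
  by (metis dvd_mult_div_cancel div_less_iff_less_mult mult.commute)

lemma shift_digit_less: "p dvd n \<Longrightarrow> p > 0 \<Longrightarrow> e < n \<Longrightarrow> shift_digit p s e < n"
  unfolding shift_digit_def by (intro digits_less div_less_div) auto

lemma shift_digit_add:
  assumes "p > 0"
  shows "shift_digit p s (shift_digit p t e) = shift_digit p (s + t) e"
proof -
  have "((e mod p + t) mod p + s) mod p = (e mod p + (s + t)) mod p" by (metis add.assoc add.commute mod_add_left_eq)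
  then show ?thesis using assms by (simp add: shift_digit_def)
qed

lemma shift_digit_period: "p > 0 \<Longrightarrow> shift_digit p p e = e"
  by (simp add: shift_digit_def)

lemma shift_digit_zero [simp]: "shift_digit p 0 e = e"
  by (simp add: shift_digit_def)

text \<open>The same for the second base-\<open>p\<close> digit, so it preserves indices below
  \<open>n\<close> when the square of \<open>p\<close> divides \<open>n\<close>.\<close>

definition shift_digit2 :: "nat \<Rightarrow> nat \<Rightarrow> nat \<Rightarrow> nat" where
  "shift_digit2 p s e = shift_digit p s (e div p) * p + e mod p"

lemma shift_digit2_mod [simp]: "p > 0 \<Longrightarrow> shift_digit2 p s e mod p = e mod p"
  by (simp add: shift_digit2_def)

lemma shift_digit2_div [simp]: "p > 0 \<Longrightarrow> shift_digit2 p s e div p = shift_digit p s (e div p)"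
  by (simp add: shift_digit2_def)

lemma shift_digit2_less:
  assumes "p ^ 2 dvd n" "p > 0" "e < n"
  shows "shift_digit2 p s e < n"
proof -
  have "p dvd n" "p dvd n div p"
    using assms(1,2) by (auto simp: power2_eq_square dvd_mult_left dvd_mult_imp_div)
  then show ?thesis unfolding shift_digit2_def
    using assms by (intro digits_less shift_digit_less div_less_div) auto
qed

lemma shift_digit2_add: "p > 0 \<Longrightarrow> shift_digit2 p s (shift_digit2 p t e) = shift_digit2 p (s + t) e"
  by (simp add: shift_digit2_def[of p _ "shift_digit2 p t e"] shift_digit_add) (simp add: shift_digit2_def)

lemma shift_digit2_period: "p > 0 \<Longrightarrow> shift_digit2 p p e = e"
  by (simp add: shift_digit2_def shift_digit_period)

lemma shift_digit2_zero [simp]: "shift_digit2 p 0 e = e"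
  by (simp add: shift_digit2_def)

section \<open>Invariant subspaces\<close>

lemma subspace_add: "is_subspace n W \<Longrightarrow> v \<in> W \<Longrightarrow> w \<in> W \<Longrightarrow> v + w \<in> W"
  by (simp add: is_subspace_def)

lemma subspace_smult: "is_subspace n W \<Longrightarrow> v \<in> W \<Longrightarrow> c \<cdot>\<^sub>v v \<in> W"
  by (simp add: is_subspace_def)

lemma subspace_carrier: "is_subspace n W \<Longrightarrow> v \<in> W \<Longrightarrow> v \<in> carrier_vec n"
  by (auto simp: is_subspace_def)

lemma subspace_scale_back:
  assumes W: "is_subspace n W" and "c \<cdot>\<^sub>v v \<in> W" "c \<noteq> 0" "v \<in> carrier_vec n"
  shows "v \<in> W"
proof -
  have "inverse c \<cdot>\<^sub>v (c \<cdot>\<^sub>v v) \<in> W" using assms subspace_smult by blast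
  then show ?thesis using assms by (simp add: smult_smult_assoc)
qed

lemma subspace_unit_vecs:
  assumes W: "is_subspace n W" and units: "\<And>j. j < n \<Longrightarrow> unit_vec n j \<in> W"
  shows "W = carrier_vec n"
proof (intro equalityI subsetI)
  fix v :: "complex vec" assume v: "v \<in> carrier_vec n"
  have "k \<le> n \<Longrightarrow> vec n (\<lambda>e. if e < k then v $ e else 0) \<in> W" for k
  proof (induction k)
    case 0
    have "vec n (\<lambda>e. if e < 0 then v $ e else 0) = 0\<^sub>v n" by (intro eq_vecI) auto
    then show ?case using W by (simp add: is_subspace_def)
  next
    case (Suc k)
    have "vec n (\<lambda>e. if e < Suc k then v $ e else 0)
        = vec n (\<lambda>e. if e < k then v $ e else 0) + v $ k \<cdot>\<^sub>v unit_vec n k"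
      using Suc.prems by (intro eq_vecI) (auto simp: less_Suc_eq)
    then show ?case using Suc subspace_add[OF W] subspace_smult[OF W] units by simp
  qed
  then have "vec n (\<lambda>e. if e < n then v $ e else 0) \<in> W" by simp
  also have "vec n (\<lambda>e. if e < n then v $ e else 0) = v" using v by (intro eq_vecI) auto
  finally show "v \<in> W" .
qed (rule subspace_carrier[OF W])

text \<open>The irreducible systems must consist of invertible matrices, so they contain
  \<open>1 + A\<close> where a matrix unit \<open>A\<close> is wanted; this recovers invariance
  under \<open>A\<close>.\<close>

lemma subspace_add_cancel:
  assumes W: "is_subspace n W" and A: "A \<in> carrier_mat n n" and v: "v \<in> W" and w: "(1\<^sub>m n + A) *\<^sub>v v \<in> W"
  shows "A *\<^sub>v v \<in> W"
proof -
  have vc: "v \<in> carrier_vec n" using subspace_carrier[OF W v] .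
  have "A *\<^sub>v v = (1\<^sub>m n + A) *\<^sub>v v + (- 1) \<cdot>\<^sub>v v"
    using A vc by (intro eq_vecI) (auto simp: add_mult_distrib_mat_vec[of _ n n])
  then show ?thesis using subspace_add[OF W w subspace_smult[OF W v]] by simp
qed

section \<open>Calculus of weighted maps\<close>

lemma weighted_map_M [simp]: "weighted_map n f c \<in> carrier_mat n n"
  by (simp add: weighted_map_def)

lemma weighted_map_dim [simp]: "dim_row (weighted_map n f c) = n" "dim_col (weighted_map n f c) = n"
  by (simp_all add: weighted_map_def)

lemma mult_entry:
  assumes "A \<in> carrier_mat r s" "B \<in> carrier_mat s t" "i < r" "j < t"
  shows "(A * B) $$ (i, j) = (\<Sum>l<s. A $$ (i, l) * B $$ (l, j))"
  using assms by (auto simp: scalar_prod_def lessThan_atLeast0)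

lemma weighted_map_mult:
  assumes "\<And>j. j < n \<Longrightarrow> g j < n"
  shows "weighted_map n f c * weighted_map n g d = weighted_map n (\<lambda>j. f (g j)) (\<lambda>j. c (g j) * d j)"
proof (rule eq_matI)
  fix i j assume "i < dim_row (weighted_map n (\<lambda>j. f (g j)) (\<lambda>j. c (g j) * d j))"
    "j < dim_col (weighted_map n (\<lambda>j. f (g j)) (\<lambda>j. c (g j) * d j))"
  then have ij: "i < n" "j < n" by auto
  have "(weighted_map n f c * weighted_map n g d) $$ (i, j)
      = (\<Sum>l<n. if l = g j then (if i = f l then c l * d j else 0) else 0)"
    unfolding mult_entry[OF weighted_map_M weighted_map_M ij]
    by (rule sum.cong[OF refl]) (use ij in \<open>simp add: weighted_map_def\<close>)
  also have "\<dots> = (if i = f (g j) then c (g j) * d j else 0)" using assms ij by simp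
  finally show "(weighted_map n f c * weighted_map n g d) $$ (i, j)
      = weighted_map n (\<lambda>j. f (g j)) (\<lambda>j. c (g j) * d j) $$ (i, j)"
    using ij by (simp add: weighted_map_def)
qed auto

lemma weighted_map_cong:
  assumes "\<And>j. j < n \<Longrightarrow> c j = d j" "\<And>j. j < n \<Longrightarrow> d j \<noteq> 0 \<Longrightarrow> f j = g j"
  shows "weighted_map n f c = weighted_map n g d"
proof (rule eq_matI)
  fix i j assume "i < dim_row (weighted_map n g d)" "j < dim_col (weighted_map n g d)"
  then have ij: "i < n" "j < n" by auto
  then show "weighted_map n f c $$ (i, j) = weighted_map n g d $$ (i, j)"
    using assms[of j] by (cases "d j = 0") (auto simp: weighted_map_def)
qed auto

lemma weighted_map_smult: "a \<cdot>\<^sub>m weighted_map n f c = weighted_map n f (\<lambda>j. a * c j)"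
  by (rule eq_matI) (auto simp: weighted_map_def)

lemma weighted_map_one: "weighted_map n (\<lambda>j. j) (\<lambda>_. 1) = 1\<^sub>m n"
  by (rule eq_matI) (auto simp: weighted_map_def)

lemma weighted_map_unit:
  assumes "j < n"
  shows "weighted_map n f c *\<^sub>v unit_vec n j = c j \<cdot>\<^sub>v unit_vec n (f j)"
proof (rule eq_vecI)
  fix i assume "i < dim_vec (c j \<cdot>\<^sub>v unit_vec n (f j))"
  then have i: "i < n" by simp
  then have "(weighted_map n f c *\<^sub>v unit_vec n j) $ i = weighted_map n f c $$ (i, j)"
    using assms by simp
  then show "(weighted_map n f c *\<^sub>v unit_vec n j) $ i = (c j \<cdot>\<^sub>v unit_vec n (f j)) $ i"
    using i assms by (simp add: weighted_map_def unit_vec_def)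
qed simp

lemma weighted_map_apply:
  assumes "w \<in> carrier_vec n" "i < n"
  shows "(weighted_map n f c *\<^sub>v w) $ i = (\<Sum>j<n. if i = f j then c j * w $ j else 0)"
  using assms by (auto simp: weighted_map_def scalar_prod_def lessThan_atLeast0 intro!: sum.cong)

text \<open>The vector is the product of the factors \<open>D - l\<close>, for \<open>D\<close> the
  diagonal matrix of \<open>d\<close>, applied to \<open>w\<close>. Taking \<open>L\<close> to be
  the unwanted eigenvalues isolates one eigencomponent up to a nonzero factor.\<close>

lemma diagonal_component:
  assumes W: "is_subspace n W" and inv: "\<And>v. v \<in> W \<Longrightarrow> weighted_map n (\<lambda>e. e) d *\<^sub>v v \<in> W"
    and w: "w \<in> W" and fin: "finite L"
  shows "vec n (\<lambda>e. (\<Prod>l\<in>L. d e - l) * w $ e) \<in> W"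
  using fin
proof (induction L rule: finite_induct)
  case empty
  have "vec n (\<lambda>e. w $ e) = w" using subspace_carrier[OF W w] by (intro eq_vecI) auto
  then show ?case using w by simp
next
  case (insert l L)
  define v where "v = vec n (\<lambda>e. (\<Prod>l\<in>L. d e - l) * w $ e)"
  have v: "v \<in> W" "v \<in> carrier_vec n" using insert.IH by (auto simp: v_def)
  have dv: "(weighted_map n (\<lambda>e. e) d *\<^sub>v v) $ i = d i * v $ i" if "i < n" for i
    unfolding weighted_map_apply[OF v(2) that] using that by simp
  have "vec n (\<lambda>e. (\<Prod>l\<in>insert l L. d e - l) * w $ e) = weighted_map n (\<lambda>e. e) d *\<^sub>v v + (- l) \<cdot>\<^sub>v v"
  proof (rule eq_vecI)
    fix i assume "i < dim_vec (weighted_map n (\<lambda>e. e) d *\<^sub>v v + (- l) \<cdot>\<^sub>v v)"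
    then have i: "i < n" using v(2) by simp
    have "(weighted_map n (\<lambda>e. e) d *\<^sub>v v + (- l) \<cdot>\<^sub>v v) $ i = (d i - l) * v $ i"
      using i v(2) dv[OF i] by (simp add: algebra_simps del: index_mult_mat_vec)
    then show "vec n (\<lambda>e. (\<Prod>l\<in>insert l L. d e - l) * w $ e) $ i
        = (weighted_map n (\<lambda>e. e) d *\<^sub>v v + (- l) \<cdot>\<^sub>v v) $ i"
      using i insert.hyps by (simp add: v_def mult.assoc)
  qed (use v(2) in simp)
  then show ?case using subspace_add[OF W inv[OF v(1)] subspace_smult[OF W v(1)]] by simp
qed

section \<open>Dual systems and double centralizers\<close>

context matrix_dim
begin

text \<open>Conjugation by \<open>u\<close> turns \<open>h\<close> into \<open>c\<close> times
  \<open>h\<close> and preserves the trace.\<close>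

lemma qcomm_trace:
  assumes q: "qcomm c u h" and u: "u \<in> GL n" and h: "h \<in> M" and tr: "trace_mat h \<noteq> 0"
  shows "c = 1"
proof -
  obtain v where v: "v \<in> GL n" "u * v = 1\<^sub>m n" "v * u = 1\<^sub>m n" using GL_inverse u by blast
  have "trace_mat h = trace_mat (h * (u * v))" using h v by simp
  also have "h * (u * v) = (h * u) * v" using h u v by (simp add: sq_assoc)
  also have "c * trace_mat ((h * u) * v) = trace_mat (c \<cdot>\<^sub>m (h * u) * v)"
    using h u v trace_mat_smult[of "h * u * v" n c] by simp
  finally have "c * trace_mat h = trace_mat (u * h * v)"
    using q h u v by (simp add: qcomm_def)
  also have "\<dots> = trace_mat (v * (u * h))" using u v h by (intro trace_mat_mult_commute[of _ n n]) auto
  also have "v * (u * h) = h" using u v h by (simp flip: sq_assoc)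
  finally show ?thesis using tr by simp
qed

lemma GL_of_order: "A \<in> M \<Longrightarrow> A ^\<^sub>m k = 1\<^sub>m n \<Longrightarrow> k > 0 \<Longrightarrow> A \<in> GL n"
  using sq_pow_add[of A 1 "k - 1"] by (intro GL_I[of A "A ^\<^sub>m (k - 1)"]) auto

text \<open>An element commuting with \<open>K\<close> up to scalars commutes exactly with the members of nonzero trace
  (\<open>qcomm_trace\<close>), so by Schur's lemma it is determined up to a scalar by its commutators with
  \<open>h1\<close> and \<open>h2\<close>; the pair \<open>g1\<close>, \<open>g2\<close> realizes all possible values of these commutators.\<close>

definition dual_system :: "nat \<Rightarrow> complex mat set \<Rightarrow> complex mat \<Rightarrow> complex mat \<Rightarrow> complex mat \<Rightarrow> complex mat \<Rightarrow> bool" where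
  "dual_system p K h1 h2 g1 g2 \<longleftrightarrow> K \<subseteq> GL n \<and> irreducible_SL n K \<and> h1 \<in> K \<and> h2 \<in> K \<and>
     h1 ^\<^sub>m p = 1\<^sub>m n \<and> h2 ^\<^sub>m p = 1\<^sub>m n \<and> (\<forall>h\<in>K. h = h1 \<or> h = h2 \<or> trace_mat h \<noteq> 0) \<and>
     g1 \<in> GL n \<and> g2 \<in> GL n \<and> g1 ^\<^sub>m p = 1\<^sub>m n \<and> g2 ^\<^sub>m p = 1\<^sub>m n \<and>
     (\<forall>h\<in>K. h = h1 \<or> h = h2 \<or> qcomm 1 g1 h \<and> qcomm 1 g2 h) \<and>
     qcomm (unity_root p) g1 h1 \<and> qcomm 1 g1 h2 \<and> qcomm 1 g2 h1 \<and> qcomm (unity_root p) g2 h2 \<and>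
     (\<exists>c. qcomm c g1 g2)"

lemma qcomm_pow_mult:
  assumes "qcomm c g1 h" "qcomm d g2 h" "g1 \<in> M" "g2 \<in> M" "h \<in> M"
  shows "qcomm (c ^ a * d ^ b) (g1 ^\<^sub>m a * g2 ^\<^sub>m b) h"
  using assms by (intro qcomm_mult_left qcomm_pow_left) auto

text \<open>The commutator with \<open>h1\<close> reads off \<open>a\<close>, and the one with
  \<open>h2\<close> reads off \<open>b\<close>.\<close>

lemma dual_system_inj:
  assumes "dual_system p K h1 h2 g1 g2"
  shows "inj_on (\<lambda>(a, b). proj_class n (g1 ^\<^sub>m a * g2 ^\<^sub>m b)) ({..<p} \<times> {..<p})"
proof (rule inj_onI, safe)
  have K: "K \<subseteq> GL n" "h1 \<in> K" "h2 \<in> K" and g: "g1 \<in> GL n" "g2 \<in> GL n"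
    and q: "qcomm (unity_root p) g1 h1" "qcomm 1 g1 h2" "qcomm 1 g2 h1" "qcomm (unity_root p) g2 h2"
    using assms unfolding dual_system_def by blast+
  then have h: "h1 \<in> GL n" "h2 \<in> GL n" by auto
  fix a b a' b' assume lt: "a < p" "b < p" "a' < p" "b' < p"
    and "proj_class n (g1 ^\<^sub>m a * g2 ^\<^sub>m b) = proj_class n (g1 ^\<^sub>m a' * g2 ^\<^sub>m b')"
  then obtain c where c: "g1 ^\<^sub>m a * g2 ^\<^sub>m b = c \<cdot>\<^sub>m (g1 ^\<^sub>m a' * g2 ^\<^sub>m b')"
    using g by (auto simp: proj_class_eq_iff)
  have G: "g1 ^\<^sub>m a * g2 ^\<^sub>m b \<in> GL n" using g by simp
  have "qcomm (unity_root p ^ a * 1 ^ b) (g1 ^\<^sub>m a * g2 ^\<^sub>m b) h1"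
    using q g h by (intro qcomm_pow_mult) auto
  moreover have "qcomm (unity_root p ^ a' * 1 ^ b') (c \<cdot>\<^sub>m (g1 ^\<^sub>m a' * g2 ^\<^sub>m b')) h1"
    using q g h by (intro qcomm_smult_left qcomm_pow_mult) auto
  ultimately have "unity_root p ^ a * 1 ^ b = unity_root p ^ a' * 1 ^ b'"
    using qcomm_unique[OF _ _ G h(1)] c by metis
  then show "a = a'" using unity_root_inj lt by simp
  have "qcomm (1 ^ a * unity_root p ^ b) (g1 ^\<^sub>m a * g2 ^\<^sub>m b) h2"
    using q g h by (intro qcomm_pow_mult) auto
  moreover have "qcomm (1 ^ a' * unity_root p ^ b') (c \<cdot>\<^sub>m (g1 ^\<^sub>m a' * g2 ^\<^sub>m b')) h2"
    using q g h by (intro qcomm_smult_left qcomm_pow_mult) auto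
  ultimately have "1 ^ a * unity_root p ^ b = 1 ^ a' * unity_root p ^ b'"
    using qcomm_unique[OF _ _ G h(2)] c by metis
  then show "b = b'" using unity_root_inj lt by simp
qed

text \<open>\<open>S\<close> contains the classes of \<open>K\<close>, so it inherits
  irreducibility, and \<open>g1\<close>, \<open>g2\<close> centralize it by its very definition.
  Conversely, a \<open>u\<close> centralizing \<open>S\<close> has the same commutators with
  \<open>K\<close> as a suitable product of powers of \<open>g1\<close> and \<open>g2\<close>, hence
  differs from it by a scalar.\<close>

lemma dual_system_centralizer:
  assumes ds: "dual_system p K h1 h2 g1 g2" and p: "p > 0"
  defines "S \<equiv> centralizer (PSL n) {proj_class n g1, proj_class n g2}"
  shows "subgroup S (PSL n)" "irreducible_PSL n S" "centralizer (PSL n) S = pair_classes p p g1 g2"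
proof -
  have K: "K \<subseteq> GL n" "irreducible_SL n K" "h1 \<in> K" "h2 \<in> K" and g: "g1 \<in> GL n" "g2 \<in> GL n"
    and hp: "h1 ^\<^sub>m p = 1\<^sub>m n" "h2 ^\<^sub>m p = 1\<^sub>m n" and gp: "g1 ^\<^sub>m p = 1\<^sub>m n" "g2 ^\<^sub>m p = 1\<^sub>m n"
    and tr: "\<And>h. h \<in> K \<Longrightarrow> h = h1 \<or> h = h2 \<or> trace_mat h \<noteq> 0"
    and gK: "\<And>h. h \<in> K \<Longrightarrow> h = h1 \<or> h = h2 \<or> qcomm 1 g1 h \<and> qcomm 1 g2 h"
    and q: "qcomm (unity_root p) g1 h1" "qcomm 1 g1 h2" "qcomm 1 g2 h1" "qcomm (unity_root p) g2 h2"
    and gg: "\<exists>c. qcomm c g1 g2"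
    using ds unfolding dual_system_def by blast+
  have h: "h1 \<in> GL n" "h2 \<in> GL n" using K by auto
  have gS: "{proj_class n g1, proj_class n g2} \<subseteq> carrier (PSL n)" using g by simp
  show subgroup: "subgroup S (PSL n)" unfolding S_def by (rule subgroup_centralizer_PSL[OF gS])
  then have Sc: "S \<subseteq> carrier (PSL n)" by (rule subgroup.subset)
  have gK': "\<exists>c. qcomm c g1 k" "\<exists>c. qcomm c g2 k" if "k \<in> K" for k
    using gK[OF that] q by blast+
  have KS: "proj_class n k \<in> S" if k: "k \<in> K" for k
  proof -
    have kG: "k \<in> GL n" using k K by blast
    have "proj_class n g1 \<otimes>\<^bsub>PSL n\<^esub> proj_class n k = proj_class n k \<otimes>\<^bsub>PSL n\<^esub> proj_class n g1"
      "proj_class n g2 \<otimes>\<^bsub>PSL n\<^esub> proj_class n k = proj_class n k \<otimes>\<^bsub>PSL n\<^esub> proj_class n g2"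
      using commute_PSL[OF g(1) kG] commute_PSL[OF g(2) kG] gK'[OF k] unfolding qcomm_def by blast+
    then show ?thesis using kG by (simp add: S_def centralizer_def)
  qed
  \<comment> \<open>The preimage of \<open>S\<close> contains only matrices of determinant one, so
    members of \<open>K\<close> enter it after rescaling.\<close>
  have scaled: "\<exists>d. d \<noteq> 0 \<and> d \<cdot>\<^sub>m k \<in> \<Union>S" if k: "k \<in> K" for k
  proof -
    have kG: "k \<in> GL n" using k K by blast
    obtain d where d: "d \<noteq> 0" "det (d \<cdot>\<^sub>m k) = 1" using GL_normalize[OF kG] .
    then have "d \<cdot>\<^sub>m k \<in> proj_class n k" using GL_M[OF kG] unfolding proj_class_def by auto
    then show ?thesis using d KS[OF k] by blast
  qed
  show irr: "irreducible_PSL n S"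
    unfolding irreducible_PSL_def irreducible_SL_def
  proof (intro allI impI, elim conjE)
    fix W assume W: "is_subspace n W" and inv: "\<forall>A\<in>\<Union>S. \<forall>w\<in>W. A *\<^sub>v w \<in> W"
    have "k *\<^sub>v w \<in> W" if k: "k \<in> K" and w: "w \<in> W" for k w
    proof -
      have kM: "k \<in> M" using k K GL_M by blast
      obtain d where d: "d \<noteq> 0" "d \<cdot>\<^sub>m k \<in> \<Union>S" using scaled k by blast
      have "d \<cdot>\<^sub>v (k *\<^sub>v w) = (d \<cdot>\<^sub>m k) *\<^sub>v w"
        using kM subspace_carrier[OF W w] by (intro eq_vecI) auto
      then have "d \<cdot>\<^sub>v (k *\<^sub>v w) \<in> W" using inv d(2) w by metis
      then show ?thesis by (rule subspace_scale_back[OF W _ d(1)]) (use kM subspace_carrier[OF W w] in simp)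
    qed
    then show "W = {0\<^sub>v n} \<or> W = carrier_vec n" using K(2) W unfolding irreducible_SL_def by blast
  qed
  define U where "U = proj_centralizer n (\<Union>S)"
  have Z: "centralizer (PSL n) S = proj_class n ` U" unfolding U_def by (rule centralizer_PSL[OF Sc])
  have member: "proj_class n g \<in> centralizer (PSL n) S" if "g \<in> {g1, g2}" for g
    using that gS unfolding S_def centralizer_def by auto
  have gpow: "proj_class n (g1 ^\<^sub>m a * g2 ^\<^sub>m b) \<in> centralizer (PSL n) S" for a b
  proof -
    interpret C: subgroup "centralizer (PSL n) S" "PSL n" by (rule subgroup_centralizer_PSL[OF Sc])
    have "proj_class n (g ^\<^sub>m a) \<in> centralizer (PSL n) S" if "g \<in> {g1, g2}" for g a
    proof (induction a)
      case 0
      then show ?case using C.one_closed that g carrier_matD[OF GL_M[of g]] by (auto simp: one_PSL)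
    next
      case (Suc a)
      have gG: "g \<in> GL n" using that g by auto
      have "proj_class n (g ^\<^sub>m a * g) \<in> centralizer (PSL n) S"
        unfolding mult_PSL[OF GL_pow[OF gG] gG, symmetric] using Suc member[OF that] by (rule C.m_closed)
      then show ?case by simp
    qed
    then have "proj_class n (g1 ^\<^sub>m a) \<otimes>\<^bsub>PSL n\<^esub> proj_class n (g2 ^\<^sub>m b) \<in> centralizer (PSL n) S"
      by (intro C.m_closed) auto
    then show ?thesis using g by (simp add: mult_PSL)
  qed
  have inverse_pow: "g ^\<^sub>m ((p - 1) * a) * g ^\<^sub>m a = 1\<^sub>m n" if "g \<in> M" "g ^\<^sub>m p = 1\<^sub>m n" for g a
  proof -
    have "(p - 1) * a + a = p * a" using p by (cases p) auto
    then show ?thesis using sq_pow_add[OF that(1), of "(p - 1) * a" a] sq_pow_mult[OF that(1), of p a] that(2) by simp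
  qed
  have root_pow: "unity_root p ^ a * unity_root p ^ ((p - 1) * a) = 1" for a
  proof -
    have "a + (p - 1) * a = p * a" using p by (cases p) auto
    then have "unity_root p ^ a * unity_root p ^ ((p - 1) * a) = (unity_root p ^ p) ^ a"
      by (metis power_add power_mult)
    then show ?thesis using p by simp
  qed
  have "proj_class n u \<in> pair_classes p p g1 g2" if u: "u \<in> U" for u
  proof -
    have uG: "u \<in> GL n" using u proj_centralizer_GL unfolding U_def by blast
    have uK: "\<exists>c. qcomm c u k" if k: "k \<in> K" for k
    proof -
      have kM: "k \<in> M" using k K GL_M by blast
      obtain d where d: "d \<noteq> 0" "d \<cdot>\<^sub>m k \<in> \<Union>S" using scaled k by blast
      then obtain c where "qcomm c u (d \<cdot>\<^sub>m k)"
        using u unfolding U_def proj_centralizer_def qcomm_def by blast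
      then have "qcomm c u (inverse d \<cdot>\<^sub>m (d \<cdot>\<^sub>m k))"
        by (rule qcomm_smult_right) (use kM uG in auto)
      then show ?thesis using d(1) by auto
    qed
    have root: "\<exists>a<p. qcomm (unity_root p ^ a) u k" if k: "k \<in> K" "k ^\<^sub>m p = 1\<^sub>m n" for k
    proof -
      have kG: "k \<in> GL n" using k K by blast
      obtain c where c: "qcomm c u k" using uK k by blast
      have "qcomm (c ^ p) u (k ^\<^sub>m p)" using qcomm_pow_right[OF c] uG kG by simp
      moreover have "qcomm 1 u (k ^\<^sub>m p)" unfolding k(2) using uG by simp
      ultimately have "c ^ p = 1" by (rule qcomm_unique) (use uG kG in auto)
      then obtain a where "a < p" "c = unity_root p ^ a" using unity_root_surj p by blast
      then show ?thesis using c by blast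
    qed
    obtain a where a: "a < p" "qcomm (unity_root p ^ a) u h1" using root K(3) hp(1) by blast
    obtain b where b: "b < p" "qcomm (unity_root p ^ b) u h2" using root K(4) hp(2) by blast
    \<comment> \<open>Chosen so that its commutators with \<open>h1\<close> and \<open>h2\<close>
      are inverse to those of \<open>u\<close>; \<open>(p - 1) * a\<close> stands for
      \<open>- a\<close>.\<close>
    define z where "z = g1 ^\<^sub>m ((p - 1) * a) * g2 ^\<^sub>m ((p - 1) * b)"
    have zG: "z \<in> GL n" using g by (simp add: z_def)
    have "\<exists>c. u * z = c \<cdot>\<^sub>m 1\<^sub>m n"
    proof -
      interpret irreducible_set n K using K by unfold_locales
      show ?thesis
      proof (rule commuting_scalar)
        fix k assume k: "k \<in> K"
        have kG: "k \<in> GL n" using k K by blast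
        consider "k = h1" | "k = h2" | "k \<noteq> h1" "k \<noteq> h2" by blast
        then show "qcomm 1 (u * z) k"
        proof cases
          case 1
          have "qcomm (unity_root p ^ a * (unity_root p ^ ((p - 1) * a) * 1 ^ ((p - 1) * b))) (u * z) h1"
            unfolding z_def using a q g h uG by (intro qcomm_mult_left qcomm_pow_left) auto
          then show ?thesis using root_pow[of a] 1 by simp
        next
          case 2
          have "qcomm (unity_root p ^ b * (1 ^ ((p - 1) * a) * unity_root p ^ ((p - 1) * b))) (u * z) h2"
            unfolding z_def using b q g h uG by (intro qcomm_mult_left qcomm_pow_left) auto
          then show ?thesis using root_pow[of b] 2 by simp
        next
          case 3
          obtain c where "qcomm c u k" using uK k by blast
          then have "qcomm 1 u k" using qcomm_trace[of c u k] uG kG tr[OF k] 3 by auto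
          then have "qcomm (1 * (1 ^ ((p - 1) * a) * 1 ^ ((p - 1) * b))) (u * z) k"
            unfolding z_def using gK[OF k] 3 g kG uG by (intro qcomm_mult_left qcomm_pow_left) auto
          then show ?thesis by simp
        qed
      qed (use uG zG in simp)
    qed
    then obtain c where c: "u * z = c \<cdot>\<^sub>m 1\<^sub>m n" by blast
    \<comment> \<open>The inverse of \<open>z\<close> appears with \<open>g2\<close> on the left;
      restoring the order used in \<open>pair_classes\<close> costs only a scalar.\<close>
    obtain e where e: "qcomm e (g2 ^\<^sub>m b) (g1 ^\<^sub>m a)"
    proof -
      obtain e where e: "qcomm e g1 g2" using gg by blast
      have "qcomm (inverse e) g2 g1" using qcomm_swap[OF e qcomm_nonzero[OF e g]] g by simp
      then have "qcomm ((inverse e ^ b) ^ a) (g2 ^\<^sub>m b) (g1 ^\<^sub>m a)"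
        using g by (intro qcomm_pow_left qcomm_pow_right) auto
      then show ?thesis using that by blast
    qed
    have "z * (g2 ^\<^sub>m b * g1 ^\<^sub>m a) = g1 ^\<^sub>m ((p - 1) * a) * ((g2 ^\<^sub>m ((p - 1) * b) * g2 ^\<^sub>m b) * g1 ^\<^sub>m a)"
      unfolding z_def using g by (simp add: sq_assoc)
    also have "\<dots> = 1\<^sub>m n" using inverse_pow g gp by simp
    finally have z1: "z * (g2 ^\<^sub>m b * g1 ^\<^sub>m a) = 1\<^sub>m n" .
    have "u = u * (z * (g2 ^\<^sub>m b * g1 ^\<^sub>m a))" using z1 uG by simp
    also have "\<dots> = (u * z) * (g2 ^\<^sub>m b * g1 ^\<^sub>m a)" using uG zG g by (simp add: sq_assoc)
    also have "\<dots> = c \<cdot>\<^sub>m (g2 ^\<^sub>m b * g1 ^\<^sub>m a)" unfolding c using g by simp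
    also have "\<dots> = (c * e) \<cdot>\<^sub>m (g1 ^\<^sub>m a * g2 ^\<^sub>m b)" using e by (simp add: qcomm_def)
    finally have "proj_class n u = proj_class n (g1 ^\<^sub>m a * g2 ^\<^sub>m b)"
      using proj_class_eq_iff[OF uG] g by auto
    then show ?thesis using a b unfolding pair_classes_def by auto
  qed
  then show "centralizer (PSL n) S = pair_classes p p g1 g2"
    using gpow unfolding Z pair_classes_def by auto
qed

text \<open>Reordering costs powers of \<open>c\<close>, which are invisible in PSL. The
  multiplication table is that of pairs of residues modulo \<open>p\<close>, whether or not the
  lifts commute.\<close>

lemma pair_classes_mult:
  assumes g: "g1 \<in> GL n" "g2 \<in> GL n" and gp: "g1 ^\<^sub>m p = 1\<^sub>m n" "g2 ^\<^sub>m p = 1\<^sub>m n" and q: "qcomm c g1 g2"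
  shows "proj_class n (g1 ^\<^sub>m a * g2 ^\<^sub>m b) \<otimes>\<^bsub>PSL n\<^esub> proj_class n (g1 ^\<^sub>m a' * g2 ^\<^sub>m b')
    = proj_class n (g1 ^\<^sub>m ((a + a') mod p) * g2 ^\<^sub>m ((b + b') mod p))"
proof -
  have red: "g ^\<^sub>m (i mod p) = g ^\<^sub>m i" if "g \<in> M" "g ^\<^sub>m p = 1\<^sub>m n" for g i
    using sq_pow_add[OF that(1), of "p * (i div p)" "i mod p"] sq_pow_mult[OF that(1), of p "i div p"] that by simp
  have "qcomm (inverse c) g2 g1" using qcomm_swap[OF q qcomm_nonzero[OF q g]] g by simp
  then have "qcomm ((inverse c ^ b) ^ a') (g2 ^\<^sub>m b) (g1 ^\<^sub>m a')"
    using g by (intro qcomm_pow_left qcomm_pow_right) auto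
  then obtain e where e: "g2 ^\<^sub>m b * g1 ^\<^sub>m a' = e \<cdot>\<^sub>m (g1 ^\<^sub>m a' * g2 ^\<^sub>m b)" unfolding qcomm_def by blast
  have "(g1 ^\<^sub>m a * g2 ^\<^sub>m b) * (g1 ^\<^sub>m a' * g2 ^\<^sub>m b') = g1 ^\<^sub>m a * ((g2 ^\<^sub>m b * g1 ^\<^sub>m a') * g2 ^\<^sub>m b')"
    using g by (simp add: sq_assoc)
  also have "\<dots> = e \<cdot>\<^sub>m (g1 ^\<^sub>m (a + a') * g2 ^\<^sub>m (b + b'))"
    unfolding e using g by (simp add: sq_assoc sq_pow_add)
  finally have "(g1 ^\<^sub>m a * g2 ^\<^sub>m b) * (g1 ^\<^sub>m a' * g2 ^\<^sub>m b') = e \<cdot>\<^sub>m (g1 ^\<^sub>m ((a + a') mod p) * g2 ^\<^sub>m ((b + b') mod p))"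
    using red g gp by simp
  moreover have "(g1 ^\<^sub>m a * g2 ^\<^sub>m b) * (g1 ^\<^sub>m a' * g2 ^\<^sub>m b') \<in> GL n"
    "g1 ^\<^sub>m ((a + a') mod p) * g2 ^\<^sub>m ((b + b') mod p) \<in> GL n" using g by simp_all
  ultimately have "proj_class n ((g1 ^\<^sub>m a * g2 ^\<^sub>m b) * (g1 ^\<^sub>m a' * g2 ^\<^sub>m b'))
      = proj_class n (g1 ^\<^sub>m ((a + a') mod p) * g2 ^\<^sub>m ((b + b') mod p))"
    using proj_class_eq_iff by blast
  then show ?thesis using g by (simp add: mult_PSL)
qed

lemma dual_systems_iso:
  assumes ds: "dual_system p K h1 h2 g1 g2" "dual_system p K' h1' h2' g1' g2'" and p: "p > 0"
  shows "(PSL n)\<lparr>carrier := pair_classes p p g1 g2\<rparr> \<cong> (PSL n)\<lparr>carrier := pair_classes p p g1' g2'\<rparr>"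
proof -
  define D where "D = {..<p} \<times> {..<p}"
  define F where "F = (\<lambda>(a, b). proj_class n (g1 ^\<^sub>m a * g2 ^\<^sub>m b))"
  define F' where "F' = (\<lambda>(a, b). proj_class n (g1' ^\<^sub>m a * g2' ^\<^sub>m b))"
  have bij: "bij_betw F D (pair_classes p p g1 g2)" "bij_betw F' D (pair_classes p p g1' g2')"
    using dual_system_inj ds unfolding bij_betw_def F_def F'_def D_def pair_classes_def by auto
  define add where "add = (\<lambda>(a, b) (a', b'). ((a + a') mod p, (b + b') mod p :: nat))"
  have add_D: "add x y \<in> D" for x y using p by (auto simp: add_def D_def split: prod.splits)
  have F_add: "F x \<otimes>\<^bsub>PSL n\<^esub> F y = F (add x y)" for x y
  proof -
    have "g1 \<in> GL n" "g2 \<in> GL n" "g1 ^\<^sub>m p = 1\<^sub>m n" "g2 ^\<^sub>m p = 1\<^sub>m n" "\<exists>c. qcomm c g1 g2"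
      using ds(1) unfolding dual_system_def by blast+
    then show ?thesis using pair_classes_mult by (auto simp: F_def add_def split: prod.splits)
  qed
  have F'_add: "F' x \<otimes>\<^bsub>PSL n\<^esub> F' y = F' (add x y)" for x y
  proof -
    have "g1' \<in> GL n" "g2' \<in> GL n" "g1' ^\<^sub>m p = 1\<^sub>m n" "g2' ^\<^sub>m p = 1\<^sub>m n" "\<exists>c. qcomm c g1' g2'"
      using ds(2) unfolding dual_system_def by blast+
    then show ?thesis using pair_classes_mult by (auto simp: F'_def add_def split: prod.splits)
  qed
  define f where "f = F' \<circ> inv_into D F"
  have fF: "f (F x) = F' x" if "x \<in> D" for x
    using that bij(1) by (simp add: f_def bij_betw_def)
  have f: "bij_betw f (pair_classes p p g1 g2) (pair_classes p p g1' g2')"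
    unfolding f_def by (rule bij_betw_trans[OF bij_betw_inv_into[OF bij(1)] bij(2)])
  have hom: "f (x \<otimes>\<^bsub>PSL n\<^esub> y) = f x \<otimes>\<^bsub>PSL n\<^esub> f y"
    if xy: "x \<in> pair_classes p p g1 g2" "y \<in> pair_classes p p g1 g2" for x y
  proof -
    have "x \<in> F ` D" "y \<in> F ` D" using xy bij(1) by (simp_all add: bij_betw_def)
    then obtain a b where a: "a \<in> D" "x = F a" and b: "b \<in> D" "y = F b" by blast
    have "f (x \<otimes>\<^bsub>PSL n\<^esub> y) = f (F (add a b))" unfolding a(2) b(2) F_add ..
    also have "\<dots> = F' a \<otimes>\<^bsub>PSL n\<^esub> F' b" unfolding fF[OF add_D] F'_add ..
    also have "\<dots> = f x \<otimes>\<^bsub>PSL n\<^esub> f y" unfolding a(2) b(2) fF[OF a(1)] fF[OF b(1)] ..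
    finally show ?thesis .
  qed
  have "f \<in> iso ((PSL n)\<lparr>carrier := pair_classes p p g1 g2\<rparr>) ((PSL n)\<lparr>carrier := pair_classes p p g1' g2'\<rparr>)"
    using f hom bij_betwE[OF f] by (auto simp: iso_def hom_def)
  then show ?thesis by (rule is_isoI)
qed

text \<open>Whether lifts commute is unchanged by rescaling and by conjugation, and all lifts of the
  classes generated by \<open>d1\<close> and \<open>d2\<close> commute.\<close>

lemma commuting_pair_not_conjugate:
  assumes g: "g1 \<in> GL n" "g2 \<in> GL n" "\<not> qcomm 1 g1 g2" and d: "d1 \<in> GL n" "d2 \<in> GL n" "qcomm 1 d1 d2"
    and A: "proj_class n g1 \<in> A" "proj_class n g2 \<in> A"
  shows "\<not> conjugate_subsets (PSL n) A (pair_classes p p d1 d2)"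
proof
  assume "conjugate_subsets (PSL n) A (pair_classes p p d1 d2)"
  then obtain t where t: "t \<in> carrier (PSL n)"
    "pair_classes p p d1 d2 = (\<lambda>x. t \<otimes>\<^bsub>PSL n\<^esub> x \<otimes>\<^bsub>PSL n\<^esub> inv\<^bsub>PSL n\<^esub> t) ` A"
    unfolding conjugate_subsets_def by blast
  obtain T where T: "T \<in> GL n" "t = proj_class n T" using t(1) by (auto simp: carrier_PSL)
  obtain T' where T': "T' \<in> GL n" "T * T' = 1\<^sub>m n" "T' * T = 1\<^sub>m n" using GL_inverse T(1) by blast
  have lift: "\<exists>e a b. T * g * T' = e \<cdot>\<^sub>m (d1 ^\<^sub>m a * d2 ^\<^sub>m b)" if gg: "g \<in> GL n" "proj_class n g \<in> A" for g
  proof -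
    have "proj_class n (T * g * T') = t \<otimes>\<^bsub>PSL n\<^esub> proj_class n g \<otimes>\<^bsub>PSL n\<^esub> inv\<^bsub>PSL n\<^esub> t"
      unfolding T(2) using gg(1) T(1) T' by (simp add: mult_PSL inv_PSL[OF T(1) T'(1,2)])
    then have "proj_class n (T * g * T') \<in> pair_classes p p d1 d2" unfolding t(2) using gg(2) by auto
    then obtain a b where "proj_class n (T * g * T') = proj_class n (d1 ^\<^sub>m a * d2 ^\<^sub>m b)"
      unfolding pair_classes_def by auto
    then show ?thesis using proj_class_eq_iff[of "T * g * T'" "d1 ^\<^sub>m a * d2 ^\<^sub>m b"] gg(1) T(1) T'(1) d by auto
  qed
  obtain e a b where 1: "T * g1 * T' = e \<cdot>\<^sub>m (d1 ^\<^sub>m a * d2 ^\<^sub>m b)" using lift g A by blast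
  obtain e' a' b' where 2: "T * g2 * T' = e' \<cdot>\<^sub>m (d1 ^\<^sub>m a' * d2 ^\<^sub>m b')" using lift g A by blast
  have q: "qcomm 1 d1 d1" "qcomm 1 d2 d2" "qcomm 1 d2 d1" using d(3) by (simp_all add: qcomm_def)
  have dd: "qcomm 1 x (d1 ^\<^sub>m i * d2 ^\<^sub>m j)" if "qcomm 1 x d1" "qcomm 1 x d2" "x \<in> M" for x i j
  proof -
    have "qcomm (1 ^ i * 1 ^ j) x (d1 ^\<^sub>m i * d2 ^\<^sub>m j)"
      using that d by (intro qcomm_mult_right qcomm_pow_right) auto
    then show ?thesis by simp
  qed
  have "qcomm (1 ^ a * 1 ^ b) (d1 ^\<^sub>m a * d2 ^\<^sub>m b) (d1 ^\<^sub>m a' * d2 ^\<^sub>m b')"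
    using dd q d by (intro qcomm_mult_left qcomm_pow_left) auto
  then have "qcomm 1 (T * g1 * T') (T * g2 * T')"
    unfolding 1 2 using d by (intro qcomm_smult_left qcomm_smult_right) auto
  then have e: "(T * g1 * T') * (T * g2 * T') = (T * g2 * T') * (T * g1 * T')" by (simp add: qcomm_def)
  have M: "T \<in> M" "T' \<in> M" "g1 \<in> M" "g2 \<in> M" using T T' g by auto
  have prod: "(T * x * T') * (T * y * T') = T * (x * y) * T'" if "x \<in> M" "y \<in> M" for x y
  proof -
    have "(T * x * T') * (T * y * T') = T * (x * ((T' * T) * (y * T')))"
      using M that by (simp add: sq_assoc)
    then show ?thesis using M that T'(3) by (simp add: sq_assoc)
  qed
  have "T * (g1 * g2) * T' = T * (g2 * g1) * T'" using e prod M by simp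
  then have "T * (g1 * g2) = T * (g2 * g1)" by (rule GL_cancel_right) (use T' M in auto)
  then have "g1 * g2 = g2 * g1" by (rule GL_cancel_left) (use T M in auto)
  then show False using g(3) by (simp add: qcomm_def)
qed

end

lemma vec_nonzero_index:
  assumes "w \<in> carrier_vec n" "w \<noteq> 0\<^sub>v n"
  obtains e where "e < n" "w $ e \<noteq> 0"
proof -
  have "\<exists>e<n. w $ e \<noteq> 0"
  proof (rule ccontr)
    assume "\<not> (\<exists>e<n. w $ e \<noteq> 0)"
    then have "w = 0\<^sub>v n" using assms(1) by (intro eq_vecI) auto
    then show False using assms(2) by simp
  qed
  then show ?thesis using that by blast
qed

lemma trace_one_plus:
  assumes "A \<in> carrier_mat n n"
  shows "trace_mat (1\<^sub>m n + A) = of_nat n + trace_mat A"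
  using assms by (simp add: trace_mat_def sum.distrib)

lemma trace_weighted_map: "trace_mat (weighted_map n f c) = (\<Sum>i<n. if i = f i then c i else 0)"
  by (auto simp: trace_mat_def weighted_map_def intro!: sum.cong)

section \<open>Clock and shift matrices\<close>

context matrix_dim
begin

text \<open>The inverse is \<open>1 + s A\<close>, where \<open>s\<close> solves
  \<open>s + 1 + s * t = 0\<close>. It is applied to nilpotent (\<open>t = 0\<close>) and idempotent
  (\<open>t = 1\<close>) matrices.\<close>

lemma GL_one_plus:
  assumes A: "A \<in> M" and AA: "A * A = t \<cdot>\<^sub>m A" and t: "t \<noteq> - 1"
  shows "1\<^sub>m n + A \<in> GL n"
proof (rule GL_I)
  define s where "s = - 1 / (1 + t)"
  have s: "s + 1 + s * t = 0" using t by (simp add: s_def field_simps add_eq_0_iff)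
  have "(1\<^sub>m n + A) * (1\<^sub>m n + s \<cdot>\<^sub>m A) = (1\<^sub>m n + A) + s \<cdot>\<^sub>m (A + t \<cdot>\<^sub>m A)"
    using A AA by (simp add: add_mult_distrib_mat[of _ n n _ _ n] mult_add_distrib_mat[of _ n n _ n])
  also have "\<dots> = 1\<^sub>m n"
  proof (rule eq_matI)
    fix i j assume "i < dim_row (1\<^sub>m n :: complex mat)" "j < dim_col (1\<^sub>m n :: complex mat)"
    then have ij: "i < n" "j < n" by auto
    then have "((1\<^sub>m n + A) + s \<cdot>\<^sub>m (A + t \<cdot>\<^sub>m A)) $$ (i, j)
        = 1\<^sub>m n $$ (i, j) + (s + 1 + s * t) * A $$ (i, j)"
      using A by (simp add: algebra_simps)
    then show "((1\<^sub>m n + A) + s \<cdot>\<^sub>m (A + t \<cdot>\<^sub>m A)) $$ (i, j) = 1\<^sub>m n $$ (i, j)"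
      using s by simp
  qed (use A in auto)
  finally show "(1\<^sub>m n + A) * (1\<^sub>m n + s \<cdot>\<^sub>m A) = 1\<^sub>m n" .
qed (use A in auto)

lemma qcomm_one_plus:
  assumes "qcomm 1 u A" "u \<in> M" "A \<in> M"
  shows "qcomm 1 u (1\<^sub>m n + A)"
  using assms by (simp add: qcomm_def add_mult_distrib_mat[of _ n n _ _ n] mult_add_distrib_mat[of _ n n _ n])

lemma qcomm_diagonal:
  assumes "\<And>j. j < n \<Longrightarrow> f j < n" "\<And>j. j < n \<Longrightarrow> w j \<noteq> 0 \<Longrightarrow> d (f j) = c * d j"
  shows "qcomm c (weighted_map n (\<lambda>e. e) d) (weighted_map n f w)"
proof -
  have "weighted_map n (\<lambda>e. e) d * weighted_map n f w = weighted_map n f (\<lambda>j. d (f j) * w j)"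
    using assms(1) by (rule weighted_map_mult)
  moreover have "weighted_map n f w * weighted_map n (\<lambda>e. e) d = weighted_map n f (\<lambda>j. w j * d j)"
    by (rule weighted_map_mult)
  moreover have "weighted_map n f (\<lambda>j. d (f j) * w j) = weighted_map n f (\<lambda>j. c * (w j * d j))"
    by (rule weighted_map_cong) (use assms(2) in auto)
  ultimately show ?thesis by (simp add: qcomm_def weighted_map_smult)
qed

lemma qcomm_maps:
  assumes "\<And>j. j < n \<Longrightarrow> f j < n" "\<And>j. j < n \<Longrightarrow> g j < n" "\<And>j. j < n \<Longrightarrow> w (f j) = w j"
    "\<And>j. j < n \<Longrightarrow> w j \<noteq> 0 \<Longrightarrow> f (g j) = g (f j)"
  shows "qcomm 1 (weighted_map n f (\<lambda>_. 1)) (weighted_map n g w)"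
proof -
  have "weighted_map n f (\<lambda>_. 1) * weighted_map n g w = weighted_map n (\<lambda>j. f (g j)) (\<lambda>j. 1 * w j)"
    using assms(2) by (rule weighted_map_mult)
  moreover have "weighted_map n g w * weighted_map n f (\<lambda>_. 1) = weighted_map n (\<lambda>j. g (f j)) (\<lambda>j. w (f j) * 1)"
    using assms(1) by (rule weighted_map_mult)
  moreover have "weighted_map n (\<lambda>j. f (g j)) (\<lambda>j. 1 * w j) = weighted_map n (\<lambda>j. g (f j)) (\<lambda>j. w (f j) * 1)"
    by (rule weighted_map_cong) (use assms(3,4) in auto)
  ultimately show ?thesis by (simp add: qcomm_def)
qed

lemma pow_shift_map:
  assumes "\<And>s e. e < n \<Longrightarrow> f s e < n" "\<And>s t e. f s (f t e) = f (s + t) e" "\<And>e. f 0 e = e"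
  shows "weighted_map n (f 1) (\<lambda>_. 1) ^\<^sub>m k = weighted_map n (f k) (\<lambda>_. 1)"
proof (induction k)
  case 0
  show ?case by (simp add: assms(3) weighted_map_one)
next
  case (Suc k)
  then show ?case by (simp add: weighted_map_mult[of n "f (Suc 0)", OF assms(1)] assms(2))
qed

lemma pow_diagonal: "weighted_map n (\<lambda>e. e) d ^\<^sub>m k = weighted_map n (\<lambda>e. e) (\<lambda>e. d e ^ k)"
  by (induction k) (auto simp: weighted_map_one weighted_map_mult mult.commute)

definition digit_shift :: "nat \<Rightarrow> complex mat" where
  "digit_shift p = weighted_map n (shift_digit p 1) (\<lambda>_. 1)"

definition digit2_shift :: "nat \<Rightarrow> complex mat" where
  "digit2_shift p = weighted_map n (shift_digit2 p 1) (\<lambda>_. 1)"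

text \<open>With \<open>digit_shift\<close> these are the generalized Pauli matrices;
  \<open>d\<close> selects the digit on which the clock acts.\<close>

definition clock :: "nat \<Rightarrow> (nat \<Rightarrow> nat) \<Rightarrow> complex mat" where
  "clock p d = weighted_map n (\<lambda>e. e) (\<lambda>e. unity_root p ^ d e)"

lemma concrete_M [simp]: "digit_shift p \<in> M" "digit2_shift p \<in> M" "clock p d \<in> M"
  by (simp_all add: digit_shift_def digit2_shift_def clock_def)

lemma digit_shift_order:
  assumes "p dvd n" "p > 0"
  shows "digit_shift p ^\<^sub>m p = 1\<^sub>m n"
proof -
  have "digit_shift p ^\<^sub>m p = weighted_map n (shift_digit p p) (\<lambda>_. 1)"
    unfolding digit_shift_def using assms by (intro pow_shift_map) (auto simp: shift_digit_less shift_digit_add)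
  also have "\<dots> = weighted_map n (\<lambda>e. e) (\<lambda>_. 1)"
    by (rule weighted_map_cong) (use assms in \<open>auto simp: shift_digit_period\<close>)
  finally show ?thesis by (simp add: weighted_map_one)
qed

lemma digit2_shift_order:
  assumes "p ^ 2 dvd n" "p > 0"
  shows "digit2_shift p ^\<^sub>m p = 1\<^sub>m n"
proof -
  have "digit2_shift p ^\<^sub>m p = weighted_map n (shift_digit2 p p) (\<lambda>_. 1)"
    unfolding digit2_shift_def using assms by (intro pow_shift_map) (auto simp: shift_digit2_less shift_digit2_add)
  also have "\<dots> = weighted_map n (\<lambda>e. e) (\<lambda>_. 1)"
    by (rule weighted_map_cong) (use assms in \<open>auto simp: shift_digit2_period\<close>)
  finally show ?thesis by (simp add: weighted_map_one)
qed

lemma clock_order: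
  assumes "p > 0"
  shows "clock p d ^\<^sub>m p = 1\<^sub>m n"
proof -
  have "(unity_root p ^ d e) ^ p = 1" for e
    using assms by (metis mult.commute power_mult power_one unity_root_order)
  then show ?thesis by (simp add: clock_def pow_diagonal weighted_map_one)
qed

lemma clock_qcomm:
  assumes "\<And>j. j < n \<Longrightarrow> f j < n" "\<And>j. j < n \<Longrightarrow> w j \<noteq> 0 \<Longrightarrow> d (f j) = d j"
  shows "qcomm 1 (clock p d) (weighted_map n f w)"
  unfolding clock_def using assms by (intro qcomm_diagonal) auto

lemma clock_qcomm_shift:
  assumes "\<And>j. j < n \<Longrightarrow> f j < n" "\<And>j. j < n \<Longrightarrow> d (f j) = (d j + 1) mod p" "p > 0"
  shows "qcomm (unity_root p) (clock p d) (weighted_map n f w)"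
  unfolding clock_def using assms by (intro qcomm_diagonal) (auto simp: unity_root_mod)

lemma clocks_commute: "qcomm 1 (clock p d) (clock p d')"
  unfolding clock_def[of p d'] by (rule clock_qcomm) auto

subsection \<open>A non-commuting pair\<close>

text \<open>The tensor product of the matrix unit \<open>E_ab\<close> on blocks with the identity on
  the lowest digit; it therefore commutes with the clock and shift of that digit.\<close>

definition block_unit :: "nat \<Rightarrow> nat \<Rightarrow> nat \<Rightarrow> complex mat" where
  "block_unit p a b = weighted_map n (\<lambda>e. a * p + e mod p) (\<lambda>e. if e div p = b then 1 else 0)"

definition block_system :: "nat \<Rightarrow> complex mat set" where
  "block_system p = {digit_shift p, clock p (\<lambda>e. e mod p)} \<union>
     {1\<^sub>m n + block_unit p a b | a b. a < n div p \<and> b < n div p \<and> a \<noteq> b}"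

lemma block_unit_M [simp]: "block_unit p a b \<in> M"
  by (simp add: block_unit_def)

text \<open>The clock isolates one value of the lowest digit and a block unit isolates one block,
  which leaves a single basis vector. Block units and shifts carry it to all the others.\<close>

lemma block_system_irreducible:
  assumes p: "p dvd n" "p > 0" and blocks: "n div p \<ge> 2"
  shows "irreducible_SL n (block_system p)"
  unfolding irreducible_SL_def
proof (intro allI impI, elim conjE)
  fix W assume W: "is_subspace n W" and inv: "\<forall>A\<in>block_system p. \<forall>w\<in>W. A *\<^sub>v w \<in> W"
  show "W = {0\<^sub>v n} \<or> W = carrier_vec n"
  proof (cases "W = {0\<^sub>v n}")
    case False
    then obtain w where w: "w \<in> W" "w \<noteq> 0\<^sub>v n" using W unfolding is_subspace_def by blast
    obtain e0 where e0: "e0 < n" "w $ e0 \<noteq> 0"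
      using vec_nonzero_index[OF subspace_carrier[OF W w(1)] w(2)] .
    define i0 where "i0 = e0 mod p"
    define b where "b = e0 div p"
    have i0: "i0 < p" using p by (simp add: i0_def)
    have b: "b < n div p" using e0 p by (simp add: b_def div_less_div)
    \<comment> \<open>The clock eigenvalues other than the one at digit \<open>i0\<close>, so the
      product over \<open>L\<close> vanishes at every other digit and is nonzero at
      \<open>i0\<close>.\<close>
    define L where "L = (\<lambda>i. unity_root p ^ i) ` ({..<p} - {i0})"
    define w' where "w' = vec n (\<lambda>e. (\<Prod>l\<in>L. unity_root p ^ (e mod p) - l) * w $ e)"
    have "clock p (\<lambda>e. e mod p) *\<^sub>v v \<in> W" if "v \<in> W" for v
      using inv that by (simp add: block_system_def)
    then have w': "w' \<in> W"
      unfolding w'_def using w by (intro diagonal_component[OF W]) (auto simp: clock_def L_def)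
    have zero: "w' $ e = 0" if "e < n" "e mod p \<noteq> i0" for e
    proof -
      have "unity_root p ^ (e mod p) \<in> L" "finite L" using that p by (auto simp: L_def)
      then have "(\<Prod>l\<in>L. unity_root p ^ (e mod p) - l) = 0" by (intro prod_zero) auto
      then show ?thesis using that by (simp add: w'_def)
    qed
    have "unity_root p ^ i0 \<notin> L" using unity_root_inj i0 by (force simp: L_def)
    then have nz: "w' $ e0 \<noteq> 0" using e0 by (auto simp: w'_def L_def i0_def)
    have block: "block_unit p a c *\<^sub>v v \<in> W" if "a < n div p" "c < n div p" "a \<noteq> c" "v \<in> W" for a c v
    proof (rule subspace_add_cancel[OF W block_unit_M that(4)])
      show "(1\<^sub>m n + block_unit p a c) *\<^sub>v v \<in> W" using inv that unfolding block_system_def by blast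
    qed
    \<comment> \<open>The system has only off-diagonal block units, so block \<open>b\<close> is
      isolated by moving it to a different block.\<close>
    obtain a where a: "a < n div p" "a \<noteq> b"
      using blocks by (cases "b = 0") (auto intro: that[of 1] that[of 0])
    have unit_less: "c * p + i0 < n" if "c < n div p" for c using digits_less p(1) that i0 by blast
    have "block_unit p a b *\<^sub>v w' = w' $ e0 \<cdot>\<^sub>v unit_vec n (a * p + i0)"
    proof (rule eq_vecI)
      fix i assume "i < dim_vec (w' $ e0 \<cdot>\<^sub>v unit_vec n (a * p + i0))"
      then have i: "i < n" by simp
      have "(block_unit p a b *\<^sub>v w') $ i = (\<Sum>j<n. if i = a * p + j mod p then (if j div p = b then 1 else 0) * w' $ j else 0)"
        unfolding block_unit_def using weighted_map_apply[OF subspace_carrier[OF W w'] i] .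
      also have "\<dots> = (\<Sum>j<n. if j = e0 then (if i = a * p + i0 then w' $ e0 else 0) else 0)"
      proof (rule sum.cong[OF refl])
        fix j assume "j \<in> {..<n}"
        then have j: "j < n" by simp
        have eq: "j = e0" if "j div p = b" "j mod p = i0"
          by (metis b_def i0_def div_mult_mod_eq that)
        show "(if i = a * p + j mod p then (if j div p = b then 1 else 0) * w' $ j else 0)
            = (if j = e0 then (if i = a * p + i0 then w' $ e0 else 0) else 0)"
        proof (cases "j = e0")
          case True
          then show ?thesis by (simp add: b_def i0_def)
        next
          case False
          then have "j div p \<noteq> b \<or> w' $ j = 0" using eq zero[OF j] by blast
          then show ?thesis using False by auto
        qed
      qed
      also have "\<dots> = (w' $ e0 \<cdot>\<^sub>v unit_vec n (a * p + i0)) $ i"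
        using i e0(1) by (simp add: unit_vec_def)
      finally show "(block_unit p a b *\<^sub>v w') $ i = (w' $ e0 \<cdot>\<^sub>v unit_vec n (a * p + i0)) $ i" .
    qed (simp add: block_unit_def)
    then have "w' $ e0 \<cdot>\<^sub>v unit_vec n (a * p + i0) \<in> W" using block[OF a(1) b a(2) w'] by simp
    then have unit_a: "unit_vec n (a * p + i0) \<in> W" by (rule subspace_scale_back[OF W _ nz]) simp
    have unit_c: "unit_vec n (c * p + i0) \<in> W" if c: "c < n div p" for c
    proof (cases "c = a")
      case False
      have "block_unit p c a *\<^sub>v unit_vec n (a * p + i0) = unit_vec n (c * p + i0)"
        unfolding block_unit_def weighted_map_unit[OF unit_less[OF a(1)]] using i0 by simp
      then show ?thesis using block[OF c a(1) False unit_a] by simp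
    qed (use unit_a in simp)
    have shift: "unit_vec n (shift_digit p k e) \<in> W" if e: "e < n" "unit_vec n e \<in> W" for k e
    proof (induction k)
      case (Suc k)
      have "digit_shift p *\<^sub>v unit_vec n (shift_digit p k e) = unit_vec n (shift_digit p (Suc k) e)"
        unfolding digit_shift_def using weighted_map_unit[OF shift_digit_less[OF p e(1)]] p
        by (simp add: shift_digit_add)
      moreover have "digit_shift p *\<^sub>v unit_vec n (shift_digit p k e) \<in> W"
        using inv Suc unfolding block_system_def by blast
      ultimately show ?case by simp
    qed (use e in simp)
    have "unit_vec n e \<in> W" if e: "e < n" for e
    proof -
      have c: "e div p < n div p" using div_less_div e p by blast
      have "shift_digit p (e mod p + p - i0) ((e div p) * p + i0) = (e div p) * p + (i0 + (e mod p + p - i0)) mod p"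
        using i0 by (simp add: shift_digit_def)
      also have "i0 + (e mod p + p - i0) = e mod p + p" using i0 by simp
      also have "(e div p) * p + (e mod p + p) mod p = e" by simp
      finally show ?thesis using shift[OF unit_less[OF c] unit_c[OF c], of "e mod p + p - i0"] by simp
    qed
    then show ?thesis using subspace_unit_vecs[OF W] by blast
  qed simp
qed

text \<open>Clock and shift are dual to each other. The inverse of the shift, written as its power
  \<open>p - 1\<close>, is used for \<open>g2\<close> so that its commutator with the clock is
  \<open>unity_root p\<close> and not the inverse root.\<close>

lemma block_dual_system:
  assumes p: "p dvd n" "p > 0" and blocks: "n div p \<ge> 2"
  shows "dual_system p (block_system p) (digit_shift p) (clock p (\<lambda>e. e mod p))
    (clock p (\<lambda>e. e mod p)) (digit_shift p ^\<^sub>m (p - 1))"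
proof -
  let ?X = "digit_shift p" and ?Z = "clock p (\<lambda>e. e mod p)"
  have Xp: "?X ^\<^sub>m p = 1\<^sub>m n" by (rule digit_shift_order[OF p])
  have Zp: "?Z ^\<^sub>m p = 1\<^sub>m n" by (rule clock_order[OF p(2)])
  have G: "?X \<in> GL n" "?Z \<in> GL n" using GL_of_order Xp Zp p(2) by auto
  have X'p: "(?X ^\<^sub>m (p - 1)) ^\<^sub>m p = 1\<^sub>m n"
    using sq_pow_mult[of ?X p "p - 1"] sq_pow_mult[of ?X "p - 1" p] Xp by (simp add: mult.commute)
  have ZX: "qcomm (unity_root p) ?Z ?X"
    unfolding digit_shift_def using p by (intro clock_qcomm_shift) (auto simp: shift_digit_less)
  have ZZ: "qcomm 1 ?Z ?Z" by (simp add: qcomm_def)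
  have XX: "qcomm (1 ^ (p - 1)) (?X ^\<^sub>m (p - 1)) ?X" by (rule qcomm_pow_left) (auto simp: qcomm_def)
  have ZX': "qcomm (unity_root p ^ (p - 1)) ?Z (?X ^\<^sub>m (p - 1))" by (rule qcomm_pow_right[OF ZX]) auto
  have inv_root: "inverse (unity_root p ^ (p - 1)) = unity_root p"
  proof -
    have "unity_root p * unity_root p ^ (p - 1) = 1"
      using p(2) by (simp flip: power_Suc)
    then show ?thesis by (metis inverse_unique mult.commute)
  qed
  have X'Z: "qcomm (unity_root p) (?X ^\<^sub>m (p - 1)) ?Z"
    using qcomm_swap[OF ZX'] inv_root by simp
  have fun_less: "a * p + j mod p < n" if "a < n div p" for a j
    using digits_less[OF p(1) that] p(2) by simp
  have ZN: "qcomm 1 ?Z (block_unit p a b)" if "a < n div p" for a b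
    unfolding block_unit_def using fun_less[OF that] by (intro clock_qcomm) auto
  have XN: "qcomm 1 ?X (block_unit p a b)" if "a < n div p" for a b
    unfolding block_unit_def digit_shift_def using fun_less[OF that] p
    by (intro qcomm_maps) (auto simp: shift_digit_less, auto simp: shift_digit_def)
  have X'N: "qcomm 1 (?X ^\<^sub>m (p - 1)) (block_unit p a b)" if "a < n div p" for a b
    using qcomm_pow_left[OF XN[OF that], of b "p - 1"] by simp
  have NN: "block_unit p a b * block_unit p a b = 0 \<cdot>\<^sub>m block_unit p a b" if "a < n div p" "a \<noteq> b" for a b
    unfolding block_unit_def weighted_map_smult using fun_less[OF that(1)] that(2) p(2)
    by (subst weighted_map_mult) (auto intro!: weighted_map_cong)
  have N_GL: "1\<^sub>m n + block_unit p a b \<in> GL n" if "a < n div p" "a \<noteq> b" for a b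
    by (rule GL_one_plus[OF block_unit_M NN[OF that]]) simp
  have tr: "trace_mat (1\<^sub>m n + block_unit p a b) \<noteq> 0" if "a < n div p" "a \<noteq> b" for a b
  proof -
    have "trace_mat (block_unit p a b) = 0"
      unfolding block_unit_def trace_weighted_map
    proof (rule sum.neutral, safe)
      fix i assume "i < n"
      have "i div p = a" if "i = a * p + i mod p"
        using that div_mult_mod_eq[of i p] p(2) by (metis add_right_cancel mult_right_cancel neq0_conv)
      then show "(if i = a * p + i mod p then if i div p = b then 1 else 0 else 0) = (0 :: complex)"
        using that(2) by auto
    qed
    then show ?thesis using n_pos by (simp add: trace_one_plus)
  qed
  have mem: "?X \<in> block_system p" "?Z \<in> block_system p" by (simp_all add: block_system_def)
  have cases: "h = ?X \<or> h = ?Z \<or> (\<exists>a b. h = 1\<^sub>m n + block_unit p a b \<and> a < n div p \<and> a \<noteq> b)"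
    if "h \<in> block_system p" for h
    using that unfolding block_system_def by blast
  show ?thesis
    unfolding dual_system_def
  proof (intro conjI)
    show "block_system p \<subseteq> GL n" using cases G N_GL by blast
    show "\<forall>h\<in>block_system p. h = ?X \<or> h = ?Z \<or> trace_mat h \<noteq> 0" using cases tr by blast
    show "\<forall>h\<in>block_system p. h = ?X \<or> h = ?Z \<or> qcomm 1 ?Z h \<and> qcomm 1 (?X ^\<^sub>m (p - 1)) h"
    proof
      fix h assume "h \<in> block_system p"
      then consider "h = ?X \<or> h = ?Z" | a b where "h = 1\<^sub>m n + block_unit p a b" "a < n div p"
        using cases by blast
      then show "h = ?X \<or> h = ?Z \<or> qcomm 1 ?Z h \<and> qcomm 1 (?X ^\<^sub>m (p - 1)) h"
      proof cases
        case 2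
        then show ?thesis using qcomm_one_plus[OF ZN] qcomm_one_plus[OF X'N] by simp
      qed blast
    qed
    show "irreducible_SL n (block_system p)" by (rule block_system_irreducible[OF p blocks])
    show "\<exists>c. qcomm c ?Z (?X ^\<^sub>m (p - 1))" using ZX' by blast
    show "qcomm 1 (?X ^\<^sub>m (p - 1)) ?X" using XX by simp
    show "?X ^\<^sub>m (p - 1) \<in> GL n" using G by simp
  qed (fact mem Xp Zp G X'p ZX ZZ X'Z)+
qed

subsection \<open>A commuting pair\<close>

definition same_digits :: "nat \<Rightarrow> nat \<Rightarrow> nat \<Rightarrow> bool" where
  "same_digits p a b \<longleftrightarrow> a mod p = b mod p \<and> (a div p) mod p = (b div p) mod p"

text \<open>For indices below \<open>n\<close> this is \<open>matrix_unit n a b\<close>, written as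
  a weighted map to use the product rules for these.\<close>

definition entry_unit :: "nat \<Rightarrow> nat \<Rightarrow> complex mat" where
  "entry_unit a b = weighted_map n (\<lambda>_. a) (\<lambda>e. if e = b then 1 else 0)"

text \<open>The matrices commuting with the clocks of both low digits are block diagonal, one block
  per pair of digit values; the entry units span them. The two shifts permute the blocks
  transitively.\<close>

definition diagonal_system :: "nat \<Rightarrow> complex mat set" where
  "diagonal_system p = {digit_shift p, digit2_shift p} \<union>
     {1\<^sub>m n + entry_unit a b | a b. a < n \<and> b < n \<and> same_digits p a b}"

lemma entry_unit_M [simp]: "entry_unit a b \<in> M"
  by (simp add: entry_unit_def)

lemma diagonal_system_irreducible:
  assumes p2: "p ^ 2 dvd n" and p: "p > 0"
  shows "irreducible_SL n (diagonal_system p)"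
  unfolding irreducible_SL_def
proof (intro allI impI, elim conjE)
  fix W assume W: "is_subspace n W" and inv: "\<forall>A\<in>diagonal_system p. \<forall>w\<in>W. A *\<^sub>v w \<in> W"
  have pn: "p dvd n" using p2 by (auto simp: power2_eq_square dvd_mult_left)
  show "W = {0\<^sub>v n} \<or> W = carrier_vec n"
  proof (cases "W = {0\<^sub>v n}")
    case False
    then obtain w where w: "w \<in> W" "w \<noteq> 0\<^sub>v n" using W unfolding is_subspace_def by blast
    obtain a where a: "a < n" "w $ a \<noteq> 0"
      using vec_nonzero_index[OF subspace_carrier[OF W w(1)] w(2)] .
    have entry: "entry_unit c d *\<^sub>v v \<in> W" if "c < n" "d < n" "same_digits p c d" "v \<in> W" for c d v
    proof (rule subspace_add_cancel[OF W entry_unit_M that(4)])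
      show "(1\<^sub>m n + entry_unit c d) *\<^sub>v v \<in> W" using inv that unfolding diagonal_system_def by blast
    qed
    have "entry_unit a a *\<^sub>v w = w $ a \<cdot>\<^sub>v unit_vec n a"
    proof (rule eq_vecI)
      fix i assume "i < dim_vec (w $ a \<cdot>\<^sub>v unit_vec n a)"
      then have i: "i < n" by simp
      have "(entry_unit a a *\<^sub>v w) $ i = (\<Sum>j<n. if i = a then (if j = a then 1 else 0) * w $ j else 0)"
        unfolding entry_unit_def using weighted_map_apply[OF subspace_carrier[OF W w(1)] i] .
      also have "\<dots> = (\<Sum>j<n. if j = a then (if i = a then w $ a else 0) else 0)"
        by (intro sum.cong) auto
      also have "\<dots> = (w $ a \<cdot>\<^sub>v unit_vec n a) $ i" using i a(1) by (simp add: unit_vec_def)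
      finally show "(entry_unit a a *\<^sub>v w) $ i = (w $ a \<cdot>\<^sub>v unit_vec n a) $ i" .
    qed (simp add: entry_unit_def)
    then have "w $ a \<cdot>\<^sub>v unit_vec n a \<in> W" using entry[OF a(1) a(1) _ w(1)] by (simp add: same_digits_def)
    then have unit_a: "unit_vec n a \<in> W" by (rule subspace_scale_back[OF W _ a(2)]) simp
    have shift: "unit_vec n (shift_digit p k e) \<in> W" if e: "e < n" "unit_vec n e \<in> W" for k e
    proof (induction k)
      case (Suc k)
      have "digit_shift p *\<^sub>v unit_vec n (shift_digit p k e) = unit_vec n (shift_digit p (Suc k) e)"
        unfolding digit_shift_def using weighted_map_unit[OF shift_digit_less[OF pn p e(1)]] p
        by (simp add: shift_digit_add)
      moreover have "digit_shift p *\<^sub>v unit_vec n (shift_digit p k e) \<in> W"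
        using inv Suc unfolding diagonal_system_def by blast
      ultimately show ?case by simp
    qed (use e in simp)
    have shift2: "unit_vec n (shift_digit2 p k e) \<in> W" if e: "e < n" "unit_vec n e \<in> W" for k e
    proof (induction k)
      case (Suc k)
      have "digit2_shift p *\<^sub>v unit_vec n (shift_digit2 p k e) = unit_vec n (shift_digit2 p (Suc k) e)"
        unfolding digit2_shift_def using weighted_map_unit[OF shift_digit2_less[OF p2 p e(1)]] p
        by (simp add: shift_digit2_add)
      moreover have "digit2_shift p *\<^sub>v unit_vec n (shift_digit2 p k e) \<in> W"
        using inv Suc unfolding diagonal_system_def by blast
      ultimately show ?case by simp
    qed (use e in simp)
    have "unit_vec n e \<in> W" if e: "e < n" for e
    proof -
      \<comment> \<open>The shifts that bring both digits of \<open>a\<close> to those of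
        \<open>e\<close>; adding \<open>p\<close> avoids truncated subtraction.\<close>
      define s where "s = e mod p + p - a mod p"
      define t where "t = (e div p) mod p + p - (a div p) mod p"
      define c where "c = shift_digit p s (shift_digit2 p t a)"
      have le: "a mod p \<le> p" "(a div p) mod p \<le> p" using p by (simp_all add: less_imp_le)
      have cn: "c < n" unfolding c_def using shift_digit_less[OF pn p] shift_digit2_less[OF p2 p a(1)] by blast
      have c: "unit_vec n c \<in> W"
        unfolding c_def using shift shift2 a(1) unit_a shift_digit2_less[OF p2 p a(1)] by blast
      have "c mod p = (a mod p + s) mod p" "(c div p) mod p = ((a div p) mod p + t) mod p"
        using p by (simp_all add: c_def)
      moreover have "a mod p + s = e mod p + p" "(a div p) mod p + t = (e div p) mod p + p"
        using le by (simp_all add: s_def t_def)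
      ultimately have "same_digits p e c" by (simp add: same_digits_def)
      then have "entry_unit e c *\<^sub>v unit_vec n c \<in> W" using entry e cn c by blast
      then show ?thesis unfolding entry_unit_def weighted_map_unit[OF cn] by simp
    qed
    then show ?thesis using subspace_unit_vecs[OF W] by blast
  qed simp
qed

text \<open>Each clock has commutator \<open>unity_root p\<close> with the shift of its own digit
  and commutes with the other shift; being diagonal, the clocks commute with each other.\<close>

lemma diagonal_dual_system:
  assumes p2: "p ^ 2 dvd n" and p: "p > 0"
  shows "dual_system p (diagonal_system p) (digit_shift p) (digit2_shift p)
    (clock p (\<lambda>e. e mod p)) (clock p (\<lambda>e. (e div p) mod p))"
proof -
  let ?X = "digit_shift p" and ?Y = "digit2_shift p"
  let ?Z1 = "clock p (\<lambda>e. e mod p)" and ?Z2 = "clock p (\<lambda>e. (e div p) mod p)"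
  have pn: "p dvd n" using p2 by (auto simp: power2_eq_square dvd_mult_left)
  have Xp: "?X ^\<^sub>m p = 1\<^sub>m n" by (rule digit_shift_order[OF pn p])
  have Yp: "?Y ^\<^sub>m p = 1\<^sub>m n" by (rule digit2_shift_order[OF p2 p])
  have Zp: "?Z1 ^\<^sub>m p = 1\<^sub>m n" "?Z2 ^\<^sub>m p = 1\<^sub>m n" by (rule clock_order[OF p])+
  have G: "?X \<in> GL n" "?Y \<in> GL n" "?Z1 \<in> GL n" "?Z2 \<in> GL n" using GL_of_order Xp Yp Zp p by auto
  have q: "qcomm (unity_root p) ?Z1 ?X" "qcomm 1 ?Z1 ?Y" "qcomm 1 ?Z2 ?X" "qcomm (unity_root p) ?Z2 ?Y"
    unfolding digit_shift_def digit2_shift_def using pn p2 p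
    by (auto intro!: clock_qcomm_shift clock_qcomm simp: shift_digit_less shift_digit2_less)
  have ZE: "qcomm 1 ?Z1 (entry_unit a b)" "qcomm 1 ?Z2 (entry_unit a b)" if "a < n" "same_digits p a b" for a b
    unfolding entry_unit_def using that by (auto intro!: clock_qcomm simp: same_digits_def split: if_splits)
  \<comment> \<open>Idempotent on the diagonal and of square zero off it; \<open>GL_one_plus\<close>
    covers both cases.\<close>
  have EE: "entry_unit a b * entry_unit a b = (if a = b then 1 else 0) \<cdot>\<^sub>m entry_unit a b" if "a < n" for a b
    unfolding entry_unit_def weighted_map_smult using that
    by (subst weighted_map_mult) (auto intro!: weighted_map_cong)
  have E_GL: "1\<^sub>m n + entry_unit a b \<in> GL n" if "a < n" for a b
    by (rule GL_one_plus[OF entry_unit_M EE[OF that]]) simp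
  have tr: "trace_mat (1\<^sub>m n + entry_unit a b) \<noteq> 0" for a b
  proof -
    have "trace_mat (entry_unit a b) = (\<Sum>i<n. if i = a then if a = b then 1 else 0 else 0)"
      unfolding entry_unit_def trace_weighted_map by (intro sum.cong) auto
    also have "\<dots> = of_nat (if a < n \<and> a = b then 1 else 0)" by simp
    finally have "trace_mat (1\<^sub>m n + entry_unit a b) = of_nat (n + (if a < n \<and> a = b then 1 else 0))"
      by (simp only: trace_one_plus[OF entry_unit_M] of_nat_add)
    then show ?thesis using n_pos by (simp only: of_nat_eq_0_iff)
  qed
  have mem: "?X \<in> diagonal_system p" "?Y \<in> diagonal_system p" by (simp_all add: diagonal_system_def)
  have cases: "h = ?X \<or> h = ?Y \<or> (\<exists>a b. h = 1\<^sub>m n + entry_unit a b \<and> a < n \<and> same_digits p a b)"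
    if "h \<in> diagonal_system p" for h
    using that unfolding diagonal_system_def by blast
  show ?thesis
    unfolding dual_system_def
  proof (intro conjI)
    show "diagonal_system p \<subseteq> GL n" using cases G E_GL by blast
    show "\<forall>h\<in>diagonal_system p. h = ?X \<or> h = ?Y \<or> trace_mat h \<noteq> 0" using cases tr by blast
    show "\<forall>h\<in>diagonal_system p. h = ?X \<or> h = ?Y \<or> qcomm 1 ?Z1 h \<and> qcomm 1 ?Z2 h"
    proof
      fix h assume "h \<in> diagonal_system p"
      then consider "h = ?X \<or> h = ?Y" | a b where "h = 1\<^sub>m n + entry_unit a b" "a < n" "same_digits p a b"
        using cases by blast
      then show "h = ?X \<or> h = ?Y \<or> qcomm 1 ?Z1 h \<and> qcomm 1 ?Z2 h"
      proof cases
        case 2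
        then show ?thesis using qcomm_one_plus[OF ZE(1)] qcomm_one_plus[OF ZE(2)] by simp
      qed blast
    qed
    show "irreducible_SL n (diagonal_system p)" by (rule diagonal_system_irreducible[OF p2 p])
    show "\<exists>c. qcomm c ?Z1 ?Z2" using clocks_commute by blast
  qed (fact mem Xp Yp Zp G q)+
qed

section \<open>The counterexample when a square divides the dimension\<close>

lemma pair_classesI: "i < m \<Longrightarrow> j < k \<Longrightarrow> proj_class n (x ^\<^sub>m i * y ^\<^sub>m j) \<in> pair_classes m k x y"
  unfolding pair_classes_def by blast

lemma pow_0_1: "A \<in> M \<Longrightarrow> A ^\<^sub>m 0 = 1\<^sub>m n" "A \<in> M \<Longrightarrow> A ^\<^sub>m 1 = A"
  by auto

lemma non_squarefree_counterexample:
  assumes p2: "p ^ 2 dvd n" and p: "p > 1"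
  obtains S1 S2 where "subgroup S1 (PSL n)" "irreducible_PSL n S1" "subgroup S2 (PSL n)" "irreducible_PSL n S2"
    "(PSL n)\<lparr>carrier := centralizer (PSL n) S1\<rparr> \<cong> (PSL n)\<lparr>carrier := centralizer (PSL n) S2\<rparr>"
    "\<not> conjugate_subsets (PSL n) (centralizer (PSL n) S1) (centralizer (PSL n) S2)"
proof -
  let ?X = "digit_shift p ^\<^sub>m (p - 1)" and ?Z1 = "clock p (\<lambda>e. e mod p)" and ?Z2 = "clock p (\<lambda>e. (e div p) mod p)"
  have p0: "p > 0" using p by simp
  obtain k where "n = p ^ 2 * k" using p2 by (rule dvdE)
  then have k: "n = p * (p * k)" by (simp add: power2_eq_square)
  have "k > 0" using k n_pos by (auto intro: Nat.gr0I)
  then have "p \<le> p * k" by simp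
  then have "2 \<le> p * k" using p by linarith
  then have blocks: "n div p \<ge> 2" and pn: "p dvd n" using k p0 by simp_all
  have ds1: "dual_system p (block_system p) (digit_shift p) ?Z1 ?Z1 ?X"
    by (rule block_dual_system[OF pn p0 blocks])
  have ds2: "dual_system p (diagonal_system p) (digit_shift p) (digit2_shift p) ?Z1 ?Z2"
    by (rule diagonal_dual_system[OF p2 p0])
  note c1 = dual_system_centralizer[OF ds1 p0] and c2 = dual_system_centralizer[OF ds2 p0]
  have G: "?Z1 \<in> GL n" "?X \<in> GL n" "?Z2 \<in> GL n" and XZ: "qcomm (unity_root p) ?X ?Z1"
    using ds1 ds2 unfolding dual_system_def by blast+
  \<comment> \<open>The commutator of the two lifts is \<open>unity_root p\<close> up to inversion,
    which differs from 1 because \<open>p > 1\<close>.\<close>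
  have "\<not> qcomm 1 ?Z1 ?X"
  proof
    assume "qcomm 1 ?Z1 ?X"
    then have "qcomm 1 ?X ?Z1" by (simp add: qcomm_def)
    then have "unity_root p = 1" using qcomm_unique[OF XZ] G by blast
    then show False using unity_root_eq_one[OF p0, of 1] p by simp
  qed
  moreover have "proj_class n ?Z1 \<in> pair_classes p p ?Z1 ?X" "proj_class n ?X \<in> pair_classes p p ?Z1 ?X"
  proof -
    have "proj_class n (?Z1 ^\<^sub>m 1 * ?X ^\<^sub>m 0) \<in> pair_classes p p ?Z1 ?X"
      "proj_class n (?Z1 ^\<^sub>m 0 * ?X ^\<^sub>m 1) \<in> pair_classes p p ?Z1 ?X"
      using p by (intro pair_classesI; simp)+
    moreover have "?Z1 ^\<^sub>m 1 * ?X ^\<^sub>m 0 = ?Z1" "?Z1 ^\<^sub>m 0 * ?X ^\<^sub>m 1 = ?X"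
      using pow_0_1[OF GL_M[OF G(1)]] pow_0_1[OF GL_M[OF G(2)]] GL_M[OF G(1)] GL_M[OF G(2)]
        sq_one_left sq_one_right by metis+
    ultimately show "proj_class n ?Z1 \<in> pair_classes p p ?Z1 ?X" "proj_class n ?X \<in> pair_classes p p ?Z1 ?X" by simp_all
  qed
  ultimately have "\<not> conjugate_subsets (PSL n) (pair_classes p p ?Z1 ?X) (pair_classes p p ?Z1 ?Z2)"
    using commuting_pair_not_conjugate[OF G(1,2) _ G(1,3) clocks_commute] by blast
  then show ?thesis
    using that[OF c1(1,2) c2(1,2)] dual_systems_iso[OF ds1 ds2 p0] unfolding c1(3) c2(3) by blast
qed

lemma irreducible_set_Union:
  assumes "subgroup S (PSL n)" "irreducible_PSL n S"
  shows "irreducible_set n (\<Union>S)"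
  using proj_class_subset_GL[OF subgroup.subset[OF assms(1)]] assms(2)
  by unfold_locales (auto simp: irreducible_PSL_def)

end

theorem mainTheorem16:
  fixes n :: nat
  assumes "n \<ge> 2"
  shows "squarefree n \<longleftrightarrow>
    (\<forall>S1 S2. subgroup S1 (PSL n) \<and> irreducible_PSL n S1 \<and>
             subgroup S2 (PSL n) \<and> irreducible_PSL n S2 \<and>
             (PSL n)\<lparr>carrier := centralizer (PSL n) S1\<rparr> \<cong> (PSL n)\<lparr>carrier := centralizer (PSL n) S2\<rparr>
       \<longrightarrow> conjugate_subsets (PSL n) (centralizer (PSL n) S1) (centralizer (PSL n) S2))"
proof -
  interpret matrix_dim n using assms by unfold_locales simp
  show ?thesis
  proof (intro iffI allI impI, elim conjE)
    fix S1 S2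
    assume sq: "squarefree n" and S: "subgroup S1 (PSL n)" "irreducible_PSL n S1" "subgroup S2 (PSL n)" "irreducible_PSL n S2"
      and iso: "(PSL n)\<lparr>carrier := centralizer (PSL n) S1\<rparr> \<cong> (PSL n)\<lparr>carrier := centralizer (PSL n) S2\<rparr>"
    show "conjugate_subsets (PSL n) (centralizer (PSL n) S1) (centralizer (PSL n) S2)"
      using squarefree_conjugate[OF sq irreducible_set_Union[OF S(1,2)] irreducible_set_Union[OF S(3,4)]] iso
      unfolding centralizer_PSL[OF subgroup.subset[OF S(1)]] centralizer_PSL[OF subgroup.subset[OF S(3)]] .
  next
    assume all: "\<forall>S1 S2. subgroup S1 (PSL n) \<and> irreducible_PSL n S1 \<and>
             subgroup S2 (PSL n) \<and> irreducible_PSL n S2 \<and>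
             (PSL n)\<lparr>carrier := centralizer (PSL n) S1\<rparr> \<cong> (PSL n)\<lparr>carrier := centralizer (PSL n) S2\<rparr>
       \<longrightarrow> conjugate_subsets (PSL n) (centralizer (PSL n) S1) (centralizer (PSL n) S2)"
    show "squarefree n"
    proof (rule ccontr)
      assume "\<not> squarefree n"
      then obtain p where p: "p ^ 2 dvd n" "\<not> p dvd 1" by (auto simp: squarefree_def)
      \<comment> \<open>\<open>squarefree_def\<close> supplies only a non-unit \<open>p\<close>; the
        value 0 would force \<open>n = 0\<close>.\<close>
      have "p \<noteq> 0" using p(1) assms by (intro notI) simp
      then have "p > 1" using p(2) by (cases "p = 1") auto
      then show False using non_squarefree_counterexample[OF p(1)] all by metis
    qed
  qed
qed

end
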